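(* Let $p$ be a prime and $n\ge1$ an integer. The additive map $\omega:\mathcal{H}_{n+1}\to\mathcal{H}_n$ defined on basis elements by $\omega(\widetilde{M})=\sum_{[N]}a_n(M,N)\,\widetilde{N}$, where $[N]$ runs over isomorphism classes of finite abelian $p$-groups of $p$-rank $\le n$, is a surjective algebra homomorphism.
   Context: For $k\ge1$ let $\Lambda^k=(\mathbb{Q}_p/\mathbb{Z}_p)^k$ and, for a finite abelian $p$-group $M$, let $m_k(M)$ be the (finite) set of subgroups of $\Lambda^k$ isomorphic to $M$. Hecke algebra. Let $\Delta_k={\rm End}(\Lambda^k)\cap{\rm GL}_k(\mathbb{Q}_p)$, $\Gamma_k={\rm GL}_k(\mathbb{Z}_p)$ and $\mathcal{H}_k={\rm End}_{\mathbb{Z}[\Delta_k]}(\mathbb{Z}[\Delta_k/\Gamma_k])$. It is a free $\mathbb{Z}$-module on elements $\widetilde{M}$, $M$ running over isomorphism classes of finite abelian $p$-groups of $p$-rank $\le k$; $\widetilde{M}$ is the endomorphism sending the coset $\Gamma_k$ to $\sum\alpha\Gamma_k$ over cosets $\alpha\Gamma_k$ with $\ker(\alpha:\Lambda^k\to\Lambda^k)\cong M$. The (commutative) product is $\widetilde{M}\cdot\widetilde{N}=\sum_{[L]}c_k(M,N;L)\,\widetilde{L}$, where $c_k(M,N;L)=|K_k(M,N;L)|/|m_k(L)|$ and $K_k(M,N;L)$ is the set of pairs $(M',L')$ of subgroups of $\Lambda^k$ with $M'\subset L'$, $M'\cong M$, $L'\cong L$, $L'/M'\cong N$. The integers $a_n(M,N)$.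 Choose a split surjection $\mu:\Lambda^{n+1}\to\mathbb{Q}_p/\mathbb{Z}_p$ and put $V=\ker\mu$. For finite abelian $p$-groups $M$ with $p$-rank $\le n+1$ and $N$ with $p$-rank $\le n$, let $I_n(M,N)=\{M'\le\Lambda^{n+1}\mid M'\cong M,\ M'\cap V\cong N\}$ and $a_n(M,N)=|I_n(M,N)|/|m_n(N)|$. This is an integer, independent of the choice of $\mu$. *)

theory Defs
  imports
    "HOL-Algebra.Free_Abelian_Groups"
    "HOL-Computational_Algebra.Fraction_Field"
    "Jordan_Normal_Form.Matrix"
    "Berlekamp_Zassenhaus.Finite_Field"
begin

section \<open>The p-adic integers, the p-adic numbers, and their quotient\<close>

text \<open>As for the type of residues modulo p, the prime p is carried by a type parameter
  of class \<^class>\<open>prime_card\<close> and equals its cardinality. A p-adic integer is an element of the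
  inverse limit of the rings of integers modulo \<open>p ^ n\<close>: a coherent sequence whose \<open>n\<close>-th
  entry is the representative in \<open>{0..<p ^ n}\<close>.\<close>

typedef (overloaded) 'p padic_int =
    "{x :: nat \<Rightarrow> int. \<forall>n. x n = x (Suc n) mod int CARD('p::prime_card) ^ n}"
  by (rule exI[of _ "\<lambda>_. 0"]) simp

setup_lifting type_definition_padic_int

lemma mod_power_Suc_mod:
  fixes a q :: int shows "a mod q ^ Suc n mod q ^ n = a mod q ^ n"
  by (rule mod_mod_cancel) simp

lemma padic_int_coherent:
  "Rep_padic_int (x :: 'p::prime_card padic_int) (Suc n) mod int CARD('p) ^ n = Rep_padic_int x n"
  using Rep_padic_int[of x, unfolded mem_Collect_eq, rule_format, of n] by (rule sym)

lemma padic_int_reduced [simp]: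
  "Rep_padic_int (x :: 'p::prime_card padic_int) n mod int CARD('p) ^ n = Rep_padic_int x n"
  by (subst (1 2) padic_int_coherent[symmetric]) (rule mod_mod_trivial)

lemma padic_int_coherent_add:
  "Rep_padic_int (x :: 'p::prime_card padic_int) (m + n) mod int CARD('p) ^ m = Rep_padic_int x m"
proof (induction n)
  case (Suc n)
  let ?q = "int CARD('p)"
  have "Rep_padic_int x (m + Suc n) mod ?q ^ m
      = Rep_padic_int x (Suc (m + n)) mod ?q ^ (m + n) mod ?q ^ m"
    by (simp add: mod_mod_cancel le_imp_power_dvd)
  also have "\<dots> = Rep_padic_int x m"
    by (simp only: padic_int_coherent Suc)
  finally show ?case .
qed simp

lemma coherent_add:
  fixes a b a' b' q :: int
  assumes "a = a' mod q ^ n" "b = b' mod q ^ n"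
  shows "(a + b) mod q ^ n = (a' + b') mod q ^ Suc n mod q ^ n"
  unfolding assms mod_power_Suc_mod by (rule mod_add_eq)

lemma coherent_diff:
  fixes a b a' b' q :: int
  assumes "a = a' mod q ^ n" "b = b' mod q ^ n"
  shows "(a - b) mod q ^ n = (a' - b') mod q ^ Suc n mod q ^ n"
  unfolding assms mod_power_Suc_mod by (rule mod_diff_eq)

lemma coherent_mult:
  fixes a b a' b' q :: int
  assumes "a = a' mod q ^ n" "b = b' mod q ^ n"
  shows "(a * b) mod q ^ n = (a' * b') mod q ^ Suc n mod q ^ n"
  unfolding assms mod_power_Suc_mod by (rule mod_mult_eq)

lemma coherent_uminus:
  fixes a a' q :: int
  assumes "a = a' mod q ^ n"
  shows "(- a) mod q ^ n = (- a') mod q ^ Suc n mod q ^ n"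
  unfolding assms mod_power_Suc_mod by (rule mod_minus_eq)

instantiation padic_int :: (prime_card) comm_ring_1
begin

lift_definition zero_padic_int :: "'a padic_int" is "\<lambda>_. 0" by simp
lift_definition one_padic_int :: "'a padic_int" is "\<lambda>n. 1 mod int CARD('a) ^ n"
  by (simp only: mod_power_Suc_mod)
lift_definition plus_padic_int :: "'a padic_int \<Rightarrow> 'a padic_int \<Rightarrow> 'a padic_int"
  is "\<lambda>x y n. (x n + y n) mod int CARD('a) ^ n"
proof -
  fix x y :: "nat \<Rightarrow> int" and n
  assume "\<And>n. x n = x (Suc n) mod int CARD('a) ^ n" "\<And>n. y n = y (Suc n) mod int CARD('a) ^ n"
  from coherent_add[OF this(1)[of n] this(2)[of n]] show "(x n + y n) mod int CARD('a) ^ n = (x (Suc n) + y (Suc n)) mod int CARD('a) ^ Suc n mod int CARD('a) ^ n" .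
qed
lift_definition minus_padic_int :: "'a padic_int \<Rightarrow> 'a padic_int \<Rightarrow> 'a padic_int"
  is "\<lambda>x y n. (x n - y n) mod int CARD('a) ^ n"
proof -
  fix x y :: "nat \<Rightarrow> int" and n
  assume "\<And>n. x n = x (Suc n) mod int CARD('a) ^ n" "\<And>n. y n = y (Suc n) mod int CARD('a) ^ n"
  from coherent_diff[OF this(1)[of n] this(2)[of n]] show "(x n - y n) mod int CARD('a) ^ n = (x (Suc n) - y (Suc n)) mod int CARD('a) ^ Suc n mod int CARD('a) ^ n" .
qed
lift_definition uminus_padic_int :: "'a padic_int \<Rightarrow> 'a padic_int"
  is "\<lambda>x n. (- x n) mod int CARD('a) ^ n"
proof -
  fix x :: "nat \<Rightarrow> int" and n
  assume "\<And>n. x n = x (Suc n) mod int CARD('a) ^ n"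
  from coherent_uminus[OF this[of n]] show "(- x n) mod int CARD('a) ^ n = (- x (Suc n)) mod int CARD('a) ^ Suc n mod int CARD('a) ^ n" .
qed
lift_definition times_padic_int :: "'a padic_int \<Rightarrow> 'a padic_int \<Rightarrow> 'a padic_int"
  is "\<lambda>x y n. (x n * y n) mod int CARD('a) ^ n"
proof -
  fix x y :: "nat \<Rightarrow> int" and n
  assume "\<And>n. x n = x (Suc n) mod int CARD('a) ^ n" "\<And>n. y n = y (Suc n) mod int CARD('a) ^ n"
  from coherent_mult[OF this(1)[of n] this(2)[of n]] show "(x n * y n) mod int CARD('a) ^ n = (x (Suc n) * y (Suc n)) mod int CARD('a) ^ Suc n mod int CARD('a) ^ n" .
qed

instance
proof
  fix a b c :: "'a padic_int"
  have eqI: "(\<And>n. Rep_padic_int x n = Rep_padic_int y n) \<Longrightarrow> x = y" for x y :: "'a padic_int"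
    by (simp add: ext flip: Rep_padic_int_inject)
  note rep = zero_padic_int.rep_eq one_padic_int.rep_eq plus_padic_int.rep_eq
    minus_padic_int.rep_eq uminus_padic_int.rep_eq times_padic_int.rep_eq
  show "a * b * c = a * (b * c)" "a * b = b * a" "1 * a = a"
    "a + b + c = a + (b + c)" "a + b = b + a" "0 + a = a" "- a + a = 0" "a - b = a + - b"
    "(a + b) * c = a * c + b * c"
    by (rule eqI, simp add: rep mod_simps algebra_simps)+
  have "Rep_padic_int (0 :: 'a padic_int) 1 \<noteq> Rep_padic_int 1 1"
    using prime_gt_1_nat[OF prime_card[where 'a = 'a]]
    by (simp add: zero_padic_int.rep_eq one_padic_int.rep_eq)
  then show "(0 :: 'a padic_int) \<noteq> 1" by metis
qed

end

instance padic_int :: (prime_card) idom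
proof
  fix a b :: "'a padic_int"
  let ?q = "int CARD('a)"
  assume "a \<noteq> 0" "b \<noteq> 0"
  then obtain m l where m: "Rep_padic_int a m \<noteq> 0" and l: "Rep_padic_int b l \<noteq> 0"
    by (metis Rep_padic_int_inject ext zero_padic_int.rep_eq)
  let ?x = "Rep_padic_int a (m + l)" and ?y = "Rep_padic_int b (m + l)"
  have q: "prime_elem ?q" using prime_card_int by auto
  have "\<not> ?q ^ m dvd ?x"
    using m padic_int_coherent_add[of a m l] by (auto simp: dvd_eq_mod_eq_0)
  moreover have "\<not> ?q ^ l dvd ?y"
    using l padic_int_coherent_add[of b l m] by (auto simp: dvd_eq_mod_eq_0 add.commute)
  ultimately have "\<not> ?q ^ (m + l) dvd ?x * ?y"
  proof (rule_tac notI)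
    assume ndvd: "\<not> ?q ^ m dvd ?x" "\<not> ?q ^ l dvd ?y" and "?q ^ (m + l) dvd ?x * ?y"
    from prime_elem_power_dvd_prod[OF this(3) q] obtain i j
      where ij: "i + j = m + l" "?q ^ i dvd ?x" "?q ^ j dvd ?y" by blast
    then consider "m \<le> i" | "l \<le> j" by linarith
    then show False
      using ij ndvd by cases (meson power_le_dvd)+
  qed
  then have "Rep_padic_int (a * b) (m + l) \<noteq> 0"
    by (simp add: times_padic_int.rep_eq dvd_eq_mod_eq_0)
  then show "a * b \<noteq> 0"
    by (metis zero_padic_int.rep_eq)
qed

type_synonym 'p padic = "'p padic_int fract"

definition of_padic_int :: "'p::prime_card padic_int \<Rightarrow> 'p padic" where
  "of_padic_int a = Fract a 1"

lemma of_padic_int_add: "of_padic_int (a + b) = of_padic_int a + of_padic_int b"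
  and of_padic_int_uminus: "of_padic_int (- a) = - of_padic_int a"
  and of_padic_int_mult: "of_padic_int (a * b) = of_padic_int a * of_padic_int b"
  and of_padic_int_0: "of_padic_int 0 = 0"
  by (simp_all add: of_padic_int_def Zero_fract_def)

text \<open>\<open>'p prufer\<close> is the additive group of p-adic numbers modulo p-adic integers.\<close>

quotient_type (overloaded) 'p prufer =
    "'p::prime_card padic" / "\<lambda>x y. x - y \<in> range of_padic_int"
proof (rule equivpI)
  show "reflp (\<lambda>x y :: 'p padic. x - y \<in> range of_padic_int)"
    by (rule reflpI) (metis diff_self of_padic_int_0 rangeI)
  show "symp (\<lambda>x y :: 'p padic. x - y \<in> range of_padic_int)"
  proof (rule sympI)
    fix x y :: "'p padic"
    assume "x - y \<in> range of_padic_int"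
    then obtain a where "x - y = of_padic_int a" by auto
    then have "y - x = of_padic_int (- a)"
      by (simp add: of_padic_int_uminus flip: minus_diff_eq[of x y])
    then show "y - x \<in> range of_padic_int" by simp
  qed
  show "transp (\<lambda>x y :: 'p padic. x - y \<in> range of_padic_int)"
  proof (rule transpI)
    fix x y z :: "'p padic"
    assume "x - y \<in> range of_padic_int" "y - z \<in> range of_padic_int"
    then obtain a b where "x - y = of_padic_int a" "y - z = of_padic_int b" by auto
    moreover have "x - z = (x - y) + (y - z)" by simp
    ultimately have "x - z = of_padic_int (a + b)"
      by (simp only: of_padic_int_add)
    then show "x - z \<in> range of_padic_int" by simp
  qed
qed

instantiation prufer :: (prime_card) ab_group_add
begin

lift_definition zero_prufer :: "'a prufer" is 0 .
lift_definition plus_prufer :: "'a prufer \<Rightarrow> 'a prufer \<Rightarrow> 'a prufer" is "(+)"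
proof -
  fix x y z w :: "'a padic"
  assume "x - y \<in> range of_padic_int" "z - w \<in> range of_padic_int"
  then obtain a b where "x - y = of_padic_int a" "z - w = of_padic_int b" by auto
  moreover have "(x + z) - (y + w) = (x - y) + (z - w)" by simp
  ultimately have "(x + z) - (y + w) = of_padic_int (a + b)"
    by (simp only: of_padic_int_add)
  then show "(x + z) - (y + w) \<in> range of_padic_int" by simp
qed
lift_definition uminus_prufer :: "'a prufer \<Rightarrow> 'a prufer" is uminus
proof -
  fix x y :: "'a padic"
  assume "x - y \<in> range of_padic_int"
  then obtain a where "x - y = of_padic_int a" by auto
  moreover have "- x - - y = - (x - y)" by simp
  ultimately have "- x - - y = of_padic_int (- a)"
    by (simp only: of_padic_int_uminus)
  then show "- x - - y \<in> range of_padic_int" by simp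
qed
lift_definition minus_prufer :: "'a prufer \<Rightarrow> 'a prufer \<Rightarrow> 'a prufer" is "(-)"
proof -
  fix x y z w :: "'a padic"
  assume "x - y \<in> range of_padic_int" "z - w \<in> range of_padic_int"
  then obtain a b where "x - y = of_padic_int a" "z - w = of_padic_int b" by auto
  moreover have "(x - z) - (y - w) = (x - y) + - (z - w)" by simp
  ultimately have "(x - z) - (y - w) = of_padic_int (a + - b)"
    by (simp only: of_padic_int_add of_padic_int_uminus)
  then show "(x - z) - (y - w) \<in> range of_padic_int" by simp
qed

instance
proof
  have refl: "x - x \<in> range of_padic_int" for x :: "'a padic"
    by (metis diff_self of_padic_int_0 rangeI)
  fix a b c :: "'a prufer"
  show "a + b + c = a + (b + c)"
    by transfer (simp only: add.assoc refl)
  show "a + b = b + a"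
    by transfer (simp only: add.commute refl)
  show "0 + a = a"
    by transfer (simp only: add_0_left refl)
  show "- a + a = 0"
    by transfer (simp only: left_minus refl)
  show "a - b = a + - b"
    by transfer (metis diff_conv_add_uminus refl)
qed

end

lift_definition padic_scale :: "'p::prime_card padic_int \<Rightarrow> 'p prufer \<Rightarrow> 'p prufer"
  is "\<lambda>a x. of_padic_int a * x"
proof -
  fix a :: "'p padic_int" and x y :: "'p padic"
  assume "x - y \<in> range of_padic_int"
  then obtain b where "x - y = of_padic_int b" by auto
  then have "of_padic_int a * x - of_padic_int a * y = of_padic_int (a * b)"
    by (simp only: of_padic_int_mult right_diff_distrib[symmetric])
  then show "of_padic_int a * x - of_padic_int a * y \<in> range of_padic_int" by simp
qed

definition prufer_group :: "'p::prime_card prufer monoid" where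
  "prufer_group = \<lparr>carrier = UNIV, monoid.mult = (+), one = 0\<rparr>"

definition Lambda :: "nat \<Rightarrow> 'p::prime_card prufer vec monoid" where
  "Lambda k = monoid_vec TYPE('p prufer) k"


section \<open>Finite abelian p-groups\<close>

definition p_rank :: "nat \<Rightarrow> ('a, 'b) monoid_scheme \<Rightarrow> nat" where
  "p_rank p G = (THE r. card {x \<in> carrier G. x [^]\<^bsub>G\<^esub> p = \<one>\<^bsub>G\<^esub>} = p ^ r)"

text \<open>Every finite group is isomorphic to one whose carrier consists of natural numbers, so
  isomorphism classes of finite abelian p-groups are represented in \<^typ>\<open>nat monoid\<close>.\<close>

definition ab_pgroups :: "nat \<Rightarrow> nat \<Rightarrow> nat monoid set" where
  "ab_pgroups p k = {G. comm_group G \<and> finite (carrier G) \<and> (\<exists>e. card (carrier G) = p ^ e) \<and> p_rank p G \<le> k}"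

definition iso_classes :: "nat \<Rightarrow> nat \<Rightarrow> nat monoid set set" where
  "iso_classes p k =
    ab_pgroups p k // {(G, H). G \<in> ab_pgroups p k \<and> H \<in> ab_pgroups p k \<and> G \<cong> H}"

definition class_rep :: "nat monoid set \<Rightarrow> nat monoid" where
  "class_rep C = (SOME G. G \<in> C)"

definition subgroups_iso :: "nat \<Rightarrow> nat monoid \<Rightarrow> 'p::prime_card prufer vec set set" where
  "subgroups_iso k M = {H. subgroup H (Lambda k) \<and> (Lambda k)\<lparr>carrier := H\<rparr> \<cong> M}"


section \<open>The Hecke algebra\<close>

text \<open>The ring of endomorphisms of \<open>Lambda k\<close> is identified, as usual, with the ring of
  \<open>k \<times> k\<close> matrices over the p-adic integers, which act on column vectors as follows.\<close>

definition mat_act :: "'p::prime_card padic_int mat \<Rightarrow> 'p prufer vec \<Rightarrow> 'p prufer vec" where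
  "mat_act A v = vec (dim_row A) (\<lambda>i. \<Sum>j<dim_vec v. padic_scale (A $$ (i, j)) (v $ j))"

definition Delta :: "nat \<Rightarrow> 'p::prime_card padic_int mat set" where
  "Delta k = {A \<in> carrier_mat k k. invertible_mat (map_mat of_padic_int A :: 'p padic mat)}"

definition Gamma :: "nat \<Rightarrow> 'p::prime_card padic_int mat set" where
  "Gamma k = {A \<in> carrier_mat k k. invertible_mat A}"

definition Gcoset :: "nat \<Rightarrow> 'p::prime_card padic_int mat \<Rightarrow> 'p padic_int mat set" where
  "Gcoset k A = (\<lambda>g. A * g) ` Gamma k"

definition coset_module ::
    "nat \<Rightarrow> ('p::prime_card padic_int mat set \<Rightarrow>\<^sub>0 int) monoid" where
  "coset_module k = free_Abelian_group (Gcoset k ` Delta k)"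

definition coset_act :: "'p::prime_card padic_int mat
    \<Rightarrow> ('p padic_int mat set \<Rightarrow>\<^sub>0 int) \<Rightarrow> ('p padic_int mat set \<Rightarrow>\<^sub>0 int)" where
  "coset_act D = frag_extend (\<lambda>c. frag_of ((\<lambda>A. D * A) ` c))"

type_synonym 'p hecke_elt =
  "('p padic_int mat set \<Rightarrow>\<^sub>0 int) \<Rightarrow> ('p padic_int mat set \<Rightarrow>\<^sub>0 int)"

text \<open>A map is linear over the monoid ring of \<open>Delta k\<close> iff it is additive and commutes with the
  action of every element of \<open>Delta k\<close>. Endomorphisms are made extensional so that equality in the
  ring is equality of functions.\<close>

definition hecke :: "nat \<Rightarrow> 'p::prime_card hecke_elt ring" where
  "hecke k =
    \<lparr>carrier = {f \<in> hom (coset_module k) (coset_module k) \<inter> extensional (carrier (coset_module k)).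
        \<forall>D \<in> Delta k. \<forall>x \<in> carrier (coset_module k). f (coset_act D x) = coset_act D (f x)},
     monoid.mult = compose (carrier (coset_module k)),
     one = (\<lambda>x \<in> carrier (coset_module k). x),
     zero = (\<lambda>x \<in> carrier (coset_module k). 0),
     add = (\<lambda>f g. \<lambda>x \<in> carrier (coset_module k). f x + g x)\<rparr>"

lemma of_padic_int_sum: "of_padic_int (sum f S) = (\<Sum>i\<in>S. of_padic_int (f i))"
  by (induction S rule: infinite_finite_induct) (simp_all add: of_padic_int_add of_padic_int_0)

lemma map_mat_of_padic_int_mult:
  assumes "A \<in> carrier_mat k k" "B \<in> carrier_mat k k"
  shows "map_mat of_padic_int (A * B) = map_mat of_padic_int A * map_mat of_padic_int B"
  using assms
  by (intro eq_matI) (auto simp: scalar_prod_def of_padic_int_sum of_padic_int_mult)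

lemma invertible_mat_times:
  fixes A B :: "'a::comm_ring_1 mat"
  assumes A: "A \<in> carrier_mat k k" "invertible_mat A" and B: "B \<in> carrier_mat k k" "invertible_mat B"
  shows "invertible_mat (A * B)"
proof -
  obtain A' where A': "A * A' = 1\<^sub>m k" "A' * A = 1\<^sub>m (dim_row A')"
    using A by (auto simp: invertible_mat_def inverts_mat_def)
  obtain B' where B': "B * B' = 1\<^sub>m k" "B' * B = 1\<^sub>m (dim_row B')"
    using B by (auto simp: invertible_mat_def inverts_mat_def)
  have cA: "A' \<in> carrier_mat k k" and cB: "B' \<in> carrier_mat k k"
    using A A' B B' by (metis carrier_matD carrier_matI index_mult_mat(2,3) index_one_mat(2,3))+
  have "(A * B) * (B' * A') = A * (B * B') * A'"
    using A(1) B(1) cA cB by (simp add: assoc_mult_mat[of _ k k _ k _ k])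
  moreover have "(B' * A') * (A * B) = B' * (A' * A) * B"
    using A(1) B(1) cA cB by (simp add: assoc_mult_mat[of _ k k _ k _ k])
  ultimately show ?thesis
    using A B cA cB A' B' by (auto simp: invertible_mat_def inverts_mat_def intro!: exI[of _ "B' * A'"])
qed

lemma Delta_mult: "A \<in> Delta k \<Longrightarrow> B \<in> Delta k \<Longrightarrow> A * B \<in> Delta k"
  by (auto simp: Delta_def map_mat_of_padic_int_mult intro!: invertible_mat_times[of _ k])

lemma image_Gcoset:
  assumes "D \<in> Delta k" "A \<in> Delta k"
  shows "(\<lambda>B. D * B) ` Gcoset k A = Gcoset k (D * A)"
  using assms by (auto simp: Gcoset_def Delta_def Gamma_def image_image intro!: image_cong)

lemma coset_act_closed:
  assumes "D \<in> Delta k" "x \<in> carrier (coset_module k)"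
  shows "coset_act D x \<in> carrier (coset_module k)"
proof -
  have "Poly_Mapping.keys (coset_act D x) \<subseteq>
      (\<Union>c\<in>Poly_Mapping.keys x. Poly_Mapping.keys (frag_of ((\<lambda>A. D * A) ` c)))"
    unfolding coset_act_def by (rule keys_frag_extend)
  also have "\<dots> \<subseteq> Gcoset k ` Delta k"
    using assms by (auto simp: coset_module_def free_Abelian_group_def image_Gcoset Delta_mult dest!: subsetD)
  finally show ?thesis by (simp add: coset_module_def free_Abelian_group_def)
qed

lemma coset_module_simps:
  "0 \<in> carrier (coset_module k)"
  "x \<in> carrier (coset_module k) \<Longrightarrow> y \<in> carrier (coset_module k) \<Longrightarrow> x + y \<in> carrier (coset_module k)"
  "x \<in> carrier (coset_module k) \<Longrightarrow> - x \<in> carrier (coset_module k)"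
  "monoid.mult (coset_module k) = (+)"
  using Poly_Mapping.keys_add[of x y] by (auto simp: coset_module_def free_Abelian_group_def)

lemma coset_act_add: "coset_act D (x + y) = coset_act D x + coset_act D y"
  by (simp add: coset_act_def frag_extend_add)

lemma coset_act_minus: "coset_act D (- x) = - coset_act D x"
  by (simp add: coset_act_def frag_extend_minus)

lemma hecke_carrier_iff:
  "f \<in> carrier (hecke k) \<longleftrightarrow>
    f \<in> extensional (carrier (coset_module k)) \<and>
    (\<forall>x \<in> carrier (coset_module k). f x \<in> carrier (coset_module k)) \<and>
    (\<forall>x \<in> carrier (coset_module k). \<forall>y \<in> carrier (coset_module k). f (x + y) = f x + f y) \<and>
    (\<forall>D \<in> Delta k. \<forall>x \<in> carrier (coset_module k). f (coset_act D x) = coset_act D (f x))"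
  by (auto simp: hecke_def hom_def Pi_iff coset_module_simps)

lemma hecke_simps:
  "monoid.mult (hecke k) = compose (carrier (coset_module k))"
  "monoid.one (hecke k) = (\<lambda>x \<in> carrier (coset_module k). x)"
  "ring.zero (hecke k) = (\<lambda>x \<in> carrier (coset_module k). 0)"
  "ring.add (hecke k) = (\<lambda>f g. \<lambda>x \<in> carrier (coset_module k). f x + g x)"
  by (simp_all add: hecke_def)

lemma hecke_eqI:
  assumes "f \<in> extensional (carrier (coset_module k))" "g \<in> extensional (carrier (coset_module k))"
    and "\<And>x. x \<in> carrier (coset_module k) \<Longrightarrow> f x = g x"
  shows "f = g"
  using assms by (rule extensionalityI)

lemma ring_hecke: "Ring.ring (hecke k :: 'p::prime_card hecke_elt ring)"
proof (rule ringI)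
  let ?C = "carrier (coset_module k :: ('p padic_int mat set \<Rightarrow>\<^sub>0 int) monoid)"
  note c = hecke_carrier_iff hecke_simps coset_module_simps coset_act_closed
  have z: "coset_act D 0 = 0" for D :: "'p padic_int mat" by (simp add: coset_act_def)
  have e: "f \<in> extensional ?C" if "f \<in> carrier (hecke k)" for f
    using that by (simp add: hecke_carrier_iff)
  have add: "f \<oplus>\<^bsub>hecke k\<^esub> g \<in> carrier (hecke k)"
    if "f \<in> carrier (hecke k)" "g \<in> carrier (hecke k)" for f g :: "'p hecke_elt"
    using that by (simp add: c coset_act_add)
  show "abelian_group (hecke k :: 'p hecke_elt ring)"
  proof (rule abelian_groupI)
    fix f :: "'p hecke_elt"
    assume f: "f \<in> carrier (hecke k)"
    let ?g = "\<lambda>x \<in> ?C. - f x"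
    have "?g \<in> carrier (hecke k)"
      using f by (simp add: c coset_act_minus)
    moreover have "?g \<oplus>\<^bsub>hecke k\<^esub> f = \<zero>\<^bsub>hecke k\<^esub>"
      by (rule hecke_eqI[of _ k]) (simp_all add: hecke_simps)
    ultimately show "\<exists>g \<in> carrier (hecke k). g \<oplus>\<^bsub>hecke k\<^esub> f = \<zero>\<^bsub>hecke k\<^esub>" by blast
    show "\<zero>\<^bsub>hecke k\<^esub> \<oplus>\<^bsub>hecke k\<^esub> f = f"
      by (rule hecke_eqI[of _ k]) (simp_all add: hecke_simps e f)
  next
    show "\<zero>\<^bsub>hecke k\<^esub> \<in> carrier (hecke k :: 'p hecke_elt ring)"
      by (simp add: c z)
  next
    fix f g h :: "'p hecke_elt"
    show "f \<oplus>\<^bsub>hecke k\<^esub> g = g \<oplus>\<^bsub>hecke k\<^esub> f"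
      by (rule hecke_eqI[of _ k]) (simp_all add: hecke_simps add.commute)
    show "f \<oplus>\<^bsub>hecke k\<^esub> g \<oplus>\<^bsub>hecke k\<^esub> h = f \<oplus>\<^bsub>hecke k\<^esub> (g \<oplus>\<^bsub>hecke k\<^esub> h)"
      by (rule hecke_eqI[of _ k]) (simp_all add: hecke_simps add.assoc)
  qed (rule add)
  show "Group.monoid (hecke k :: 'p hecke_elt ring)"
  proof (rule monoidI)
    fix f g h :: "'p hecke_elt"
    assume f: "f \<in> carrier (hecke k)" and g: "g \<in> carrier (hecke k)" and h: "h \<in> carrier (hecke k)"
    show "f \<otimes>\<^bsub>hecke k\<^esub> g \<in> carrier (hecke k)"
      using f g by (simp add: c compose_def)
    show "f \<otimes>\<^bsub>hecke k\<^esub> g \<otimes>\<^bsub>hecke k\<^esub> h = f \<otimes>\<^bsub>hecke k\<^esub> (g \<otimes>\<^bsub>hecke k\<^esub> h)"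
      using h by (intro hecke_eqI[of _ k]) (simp_all add: c compose_def)
  next
    show "\<one>\<^bsub>hecke k\<^esub> \<in> carrier (hecke k :: 'p hecke_elt ring)"
      by (simp add: c)
  next
    fix f :: "'p hecke_elt"
    assume f: "f \<in> carrier (hecke k)"
    show "\<one>\<^bsub>hecke k\<^esub> \<otimes>\<^bsub>hecke k\<^esub> f = f" "f \<otimes>\<^bsub>hecke k\<^esub> \<one>\<^bsub>hecke k\<^esub> = f"
      using f by (intro hecke_eqI[of _ k]; simp add: c compose_def)+
  qed
  fix f g h :: "'p hecke_elt"
  assume f: "f \<in> carrier (hecke k)" and g: "g \<in> carrier (hecke k)" and h: "h \<in> carrier (hecke k)"
  show "(f \<oplus>\<^bsub>hecke k\<^esub> g) \<otimes>\<^bsub>hecke k\<^esub> h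
      = f \<otimes>\<^bsub>hecke k\<^esub> h \<oplus>\<^bsub>hecke k\<^esub> g \<otimes>\<^bsub>hecke k\<^esub> h"
    using f g h by (intro hecke_eqI[of _ k]) (simp_all add: c compose_def)
  show "h \<otimes>\<^bsub>hecke k\<^esub> (f \<oplus>\<^bsub>hecke k\<^esub> g)
      = h \<otimes>\<^bsub>hecke k\<^esub> f \<oplus>\<^bsub>hecke k\<^esub> h \<otimes>\<^bsub>hecke k\<^esub> g"
    using f g h by (intro hecke_eqI[of _ k]) (simp_all add: c compose_def)
qed

definition hecke_basis :: "nat \<Rightarrow> nat monoid \<Rightarrow> 'p::prime_card hecke_elt" where
  "hecke_basis k M = (THE f. f \<in> carrier (hecke k) \<and>
     f (frag_of (Gamma k)) =
       (\<Sum>c \<in> {Gcoset k A | A. A \<in> Delta k \<and>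
          (Lambda k)\<lparr>carrier := kernel (Lambda k) (Lambda k) (mat_act A)\<rparr> \<cong> M}. frag_of c))"


section \<open>The integers \<open>a n \<mu> M N\<close> and the map \<open>\<omega>\<close>\<close>

definition split_surjection ::
    "('a, 'c) monoid_scheme \<Rightarrow> ('b, 'd) monoid_scheme \<Rightarrow> ('a \<Rightarrow> 'b) \<Rightarrow> bool" where
  "split_surjection G H f \<longleftrightarrow>
    f \<in> hom G H \<and> f ` carrier G = carrier H \<and> (\<exists>s \<in> hom H G. \<forall>y \<in> carrier H. f (s y) = y)"

definition I_set :: "nat \<Rightarrow> ('p::prime_card prufer vec \<Rightarrow> 'p prufer)
    \<Rightarrow> nat monoid \<Rightarrow> nat monoid \<Rightarrow> 'p prufer vec set set" where
  "I_set n \<mu> M N = {H \<in> subgroups_iso (n + 1) M.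
     (Lambda (n + 1))\<lparr>carrier := H \<inter> kernel (Lambda (n + 1)) prufer_group \<mu>\<rparr> \<cong> N}"

text \<open>The quotient of the two cardinalities, which is an integer.\<close>

definition a_int :: "nat \<Rightarrow> ('p::prime_card prufer vec \<Rightarrow> 'p prufer)
    \<Rightarrow> nat monoid \<Rightarrow> nat monoid \<Rightarrow> int" where
  "a_int n \<mu> M N = (THE a. a * int (card (subgroups_iso n N :: 'p prufer vec set set))
                            = int (card (I_set n \<mu> M N)))"

text \<open>The sum over isomorphism classes has only finitely many nonzero terms, but its index set is
  infinite, so it is restricted to the classes with nonzero coefficient.\<close>

definition is_omega :: "nat \<Rightarrow> ('p::prime_card prufer vec \<Rightarrow> 'p prufer)
    \<Rightarrow> ('p hecke_elt \<Rightarrow> 'p hecke_elt) \<Rightarrow> bool" where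
  "is_omega n \<mu> w \<longleftrightarrow>
     w \<in> hom (add_monoid (hecke (n + 1))) (add_monoid (hecke n)) \<and>
     w \<in> extensional (carrier (hecke (n + 1))) \<and>
     (\<forall>M \<in> ab_pgroups CARD('p) (n + 1).
        w (hecke_basis (n + 1) M) =
          (\<Oplus>\<^bsub>hecke n\<^esub> C \<in> {C \<in> iso_classes CARD('p) n. a_int n \<mu> M (class_rep C) \<noteq> 0}.
             [a_int n \<mu> M (class_rep C)] \<cdot>\<^bsub>hecke n\<^esub> hecke_basis n (class_rep C)))"

end

(* A coset A Gamma is encoded by the finite subgroup ker(A^T) of Lambda^k; this is a bijection from
   the cosets to the finite subgroups, under which D acts by pulling back along D^T, and the
   Gamma-orbits are the isomorphism classes, because isomorphic finite subgroups of Lambda^k are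
   conjugate under Gamma (split off a cyclic subgroup of maximal order and induct on k).
   After a change of coordinates mu is the first coordinate. Intersecting a finite subgroup with the
   kernel of mu then gives a map psi from cosets of rank n + 1 to cosets of rank n, and omega is
   determined by omega(T)(Gamma_n) = psi_* (T (Gamma_(n+1))). If A is block upper triangular with
   lower right block D, then psi(A c) = D psi(c). Every coset has such a representative A, so psi_*
   intertwines T with omega(T), and multiplicativity follows. Counting fibres of psi identifies the
   coefficients of omega with the integers a_n(M,N), and ordering the groups by cardinality makes
   omega unitriangular on the groups of rank at most n, whence surjectivity. *)

theory Submission
  imports Defs "Jordan_Normal_Form.Determinant"
begin

section \<open>The p-adic integers as a discrete valuation ring, and the Pruefer group\<close>

text \<open>Operators come before basis elements: an operator in \<open>hecke k\<close> is the same
  thing as a \<open>Gamma k\<close>-invariant element of the coset module, namely its value on the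
  coset \<open>Gamma k\<close>. So \<open>omega\<close> can be built, and shown to respect products,
  before any isomorphism class or cardinality is mentioned; the numbers \<open>a_int\<close> are
  only compared with its coefficients afterwards. Two obstacles shape the rest. The basis is indexed
  by the kernel of A, while a coset determines only the kernel of the transpose of A. These two
  groups are isomorphic because A equals a symmetric matrix up to factors from
  \<open>Gamma k\<close> on both sides. Secondly, \<open>a_int\<close> is a quotient by the number
  of subgroups isomorphic to N, so each abstract p-group of p-rank at most n must be embedded in
  Lambda^n; for this a partial isomorphism is extended one element at a time, with the number of
  p-th roots in Lambda^n deciding that there is room.\<close>

lemma CARD_pos: "0 < int CARD('p::prime_card)" "1 < int CARD('p)" "prime (int CARD('p))"
  using prime_card[where 'a='p] prime_gt_1_nat[OF prime_card[where 'a='p]] by auto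

section \<open>Divisibility by powers of p and units in the p-adic integers\<close>

definition unif :: "'p::prime_card padic_int" where
  "unif = of_nat CARD('p)"

lemmas Rep_padic_int_simps = zero_padic_int.rep_eq one_padic_int.rep_eq plus_padic_int.rep_eq
  minus_padic_int.rep_eq uminus_padic_int.rep_eq times_padic_int.rep_eq

lemma padic_int_eqI: "(\<And>n. Rep_padic_int x n = Rep_padic_int y n) \<Longrightarrow> x = y"
  by (simp add: ext flip: Rep_padic_int_inject)

lemma Rep_of_nat: "Rep_padic_int (of_nat i :: 'p::prime_card padic_int) n = int i mod int CARD('p) ^ n"
  by (induction i) (simp_all add: Rep_padic_int_simps mod_simps add.commute)

lemma Rep_unif_power: "Rep_padic_int (unif ^ m :: 'p::prime_card padic_int) n = int CARD('p) ^ m mod int CARD('p) ^ n"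
proof -
  have "unif ^ m = (of_nat (CARD('p) ^ m) :: 'p padic_int)" by (simp add: unif_def)
  then show ?thesis by (simp only: Rep_of_nat) simp
qed

lemma Rep_bounds: "0 \<le> Rep_padic_int (a :: 'p::prime_card padic_int) n" "Rep_padic_int a n < int CARD('p) ^ n"
  using CARD_pos(1)[where 'p='p] by (metis padic_int_reduced pos_mod_sign zero_less_power)
     (metis CARD_pos(1)[where 'p='p] padic_int_reduced pos_mod_bound zero_less_power)

text \<open>Division by p^m costs m places of precision: the entry of the quotient at n is the entry
  of \<open>a\<close> at n + m divided by p^m, and coherence makes this division exact.\<close>

lemma unif_power_dvd_iff: "unif ^ m dvd (a :: 'p::prime_card padic_int) \<longleftrightarrow> Rep_padic_int a m = 0"
proof
  assume "unif ^ m dvd a"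
  then obtain b where "a = unif ^ m * b" by (elim dvdE)
  then show "Rep_padic_int a m = 0" by (simp add: times_padic_int.rep_eq Rep_unif_power)
next
  let ?q = "int CARD('p)"
  assume 0: "Rep_padic_int a m = 0"
  have qpos: "?q > 0" by (rule CARD_pos)
  define b where "b n = Rep_padic_int a (n + m) div ?q ^ m" for n
  have b0: "?q ^ m * b n = Rep_padic_int a (n + m)" for n
    using padic_int_coherent_add[of a m n] 0 by (auto simp: b_def add.commute intro!: dvd_mult_div_cancel)
  have "b n = b (Suc n) mod ?q ^ n" for n
  proof -
    have "?q ^ m * b n = (?q ^ m * b (Suc n)) mod ?q ^ (n + m)"
      unfolding b0 using padic_int_coherent[of a "n + m"] by simp
    also have "\<dots> = ?q ^ m * (b (Suc n) mod ?q ^ n)"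
      by (simp add: power_add mult.commute[of "?q ^ n"] mod_mult_mult1)
    finally show ?thesis using qpos by simp
  qed
  then have Rb: "Rep_padic_int (Abs_padic_int b :: 'p padic_int) = b"
    by (intro Abs_padic_int_inverse) blast
  have "a = unif ^ m * Abs_padic_int b"
  proof (rule padic_int_eqI)
    fix n
    have "Rep_padic_int (unif ^ m * Abs_padic_int b :: 'p padic_int) n = (?q ^ m * b n) mod ?q ^ n"
      by (simp add: times_padic_int.rep_eq Rep_unif_power Rb mod_simps)
    also have "\<dots> = Rep_padic_int a n"
      unfolding b0 by (rule padic_int_coherent_add)
    finally show "Rep_padic_int a n = Rep_padic_int (unif ^ m * Abs_padic_int b :: 'p padic_int) n" by simp
  qed
  then show "unif ^ m dvd a" by (rule dvdI)
qed

lemma unif_nonzero [simp]: "unif \<noteq> (0 :: 'p::prime_card padic_int)"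
proof
  assume "unif = (0 :: 'p padic_int)"
  then have "unif ^ 2 dvd (unif :: 'p padic_int)" by simp
  then have "(int CARD('p) mod int CARD('p) ^ 2) = 0"
    using Rep_unif_power[of 1 2, where 'p='p] by (simp add: unif_power_dvd_iff)
  moreover have "int CARD('p) < int CARD('p) ^ 2"
    using CARD_pos(2)[where 'p='p] by (simp add: power2_eq_square)
  ultimately show False using CARD_pos(1)[where 'p='p] by simp
qed

text \<open>Density of the natural numbers. It reduces scaling on p^m-torsion to taking natural
  multiples, which every additive map respects.\<close>

lemma padic_int_mod_unif_power:
  fixes a :: "'p::prime_card padic_int"
  shows "unif ^ m dvd a - of_nat (nat (Rep_padic_int a m))"
  using Rep_bounds(1)[of a m]
  by (simp only: unif_power_dvd_iff Rep_padic_int_simps Rep_of_nat) simp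

text \<open>If p does not divide \<open>a\<close>, no entry of positive index is divisible by p, and
  Bezout inverts each entry modulo p^n. An inverse modulo p^n is unique, so the reduced inverses
  form a coherent sequence.\<close>

lemma padic_int_unit_iff:
  fixes a :: "'p::prime_card padic_int"
  shows "a dvd 1 \<longleftrightarrow> \<not> unif dvd a"
proof
  assume "a dvd 1"
  show "\<not> unif dvd a"
  proof
    assume "unif dvd a"
    then have "unif ^ 1 dvd (1 :: 'p padic_int)" using \<open>a dvd 1\<close> dvd_trans by (simp, blast)
    then show False using CARD_pos(2)[where 'p='p] by (simp only: unif_power_dvd_iff) (simp add: Rep_padic_int_simps)
  qed
next
  let ?q = "int CARD('p)"
  assume "\<not> unif dvd a"
  then have a1: "Rep_padic_int a 1 \<noteq> 0" using unif_power_dvd_iff[of 1 a] by simp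
  have cop: "coprime (Rep_padic_int a n) (?q ^ n)" for n
  proof (cases n)
    case (Suc j)
    have "Rep_padic_int a n mod ?q = Rep_padic_int a 1"
      using padic_int_coherent_add[of a 1 j] Suc by simp
    then have "\<not> ?q dvd Rep_padic_int a n" using a1 by auto
    then show ?thesis using CARD_pos(3)[where 'p='p]
      by (metis coprime_commute coprime_power_right_iff prime_imp_coprime)
  qed simp
  have "\<exists>b. (Rep_padic_int a n * b) mod ?q ^ n = 1 mod ?q ^ n \<and> b mod ?q ^ n = b" for n
  proof -
    obtain x y where "x * Rep_padic_int a n + y * ?q ^ n = 1"
      using bezout_int[of "Rep_padic_int a n" "?q ^ n"] cop[of n] by (auto simp: coprime_iff_gcd_eq_1)
    then have "(Rep_padic_int a n * x) mod ?q ^ n = 1 mod ?q ^ n"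
      by (metis mod_mult_self1 mult.commute)
    then show ?thesis by (intro exI[of _ "x mod ?q ^ n"]) (simp add: mod_simps)
  qed
  then obtain b where b: "\<And>n. (Rep_padic_int a n * b n) mod ?q ^ n = 1 mod ?q ^ n"
    "\<And>n. b n mod ?q ^ n = b n" by metis
  have "b n = b (Suc n) mod ?q ^ n" for n
  proof -
    have "(Rep_padic_int a n * b (Suc n)) mod ?q ^ n = ((Rep_padic_int a (Suc n) mod ?q ^ n) * b (Suc n)) mod ?q ^ n"
      by (simp only: padic_int_coherent)
    also have "\<dots> = ((Rep_padic_int a (Suc n) * b (Suc n)) mod ?q ^ Suc n) mod ?q ^ n"
      by (simp only: mod_power_Suc_mod mod_mult_left_eq)
    also have "\<dots> = 1 mod ?q ^ n" unfolding b(1) mod_power_Suc_mod ..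
    also have "\<dots> = (Rep_padic_int a n * b n) mod ?q ^ n" by (rule b(1)[symmetric])
    finally have "?q ^ n dvd Rep_padic_int a n * b (Suc n) - Rep_padic_int a n * b n"
      by (rule mod_eq_dvd_iff[THEN iffD1])
    then have "?q ^ n dvd b (Suc n) - b n"
      using cop[of n] by (simp add: right_diff_distrib[symmetric] coprime_commute coprime_dvd_mult_right_iff)
    then have "b (Suc n) mod ?q ^ n = b n mod ?q ^ n" by (simp add: mod_eq_dvd_iff)
    then show ?thesis using b(2) by simp
  qed
  then have Rb: "Rep_padic_int (Abs_padic_int b :: 'p padic_int) = b"
    by (intro Abs_padic_int_inverse) blast
  have "1 = a * Abs_padic_int b"
    by (rule padic_int_eqI) (simp add: Rep_padic_int_simps Rb b)
  then show "a dvd 1" by (rule dvdI)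
qed

lemma padic_int_factor:
  fixes a :: "'p::prime_card padic_int"
  assumes "a \<noteq> 0"
  obtains j u where "a = unif ^ j * u" "u dvd 1"
proof -
  obtain m0 where "Rep_padic_int a m0 \<noteq> 0"
    using assms by (metis padic_int_eqI zero_padic_int.rep_eq)
  then have "\<exists>m. \<not> unif ^ m dvd a" by (auto simp: unif_power_dvd_iff)
  then obtain m where m: "\<not> unif ^ m dvd a" "\<And>l. l < m \<Longrightarrow> unif ^ l dvd a"
    using exists_least_iff[of "\<lambda>m. \<not> unif ^ m dvd a"] by blast
  then obtain j where j: "m = Suc j" by (cases m) auto
  then obtain u where u: "a = unif ^ j * u" using m(2)[of j] by (auto elim: dvdE)
  have "\<not> unif dvd u" using m(1) unfolding j u by (auto simp: mult_dvd_mono)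
  then show ?thesis using that u by (simp add: padic_int_unit_iff)
qed

lemma unit_add_nonunit:
  fixes a b :: "'p::prime_card padic_int"
  assumes "\<not> a dvd 1" "b dvd 1"
  shows "a + b dvd 1"
  using assms by (simp add: padic_int_unit_iff dvd_add_right_iff)

lemma inj_of_padic_int: "of_padic_int a = of_padic_int b \<longleftrightarrow> a = b"
  by (simp add: of_padic_int_def eq_fract)

interpretation of_padic_int_hom: inj_comm_ring_hom "of_padic_int :: 'p::prime_card padic_int \<Rightarrow> 'p padic"
  by unfold_locales (simp_all add: of_padic_int_add of_padic_int_mult of_padic_int_0 inj_of_padic_int[of _ 0, unfolded of_padic_int_0],
    simp add: of_padic_int_def One_fract_def)

section \<open>Elements of Q_p/Z_p as fractions a / p^m\<close>

definition pf :: "nat \<Rightarrow> 'p::prime_card padic_int \<Rightarrow> 'p prufer" where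
  "pf m a = abs_prufer (Fract a (unif ^ m))"

lemma pf_eq_iff: "pf m a = pf m b \<longleftrightarrow> unif ^ m dvd (a - b)"
proof -
  have "Fract a (unif ^ m) - Fract b (unif ^ m) = Fract (a - b) (unif ^ m)"
    by (simp add: eq_fract algebra_simps)
  moreover have "Fract (a - b) (unif ^ m) \<in> range of_padic_int \<longleftrightarrow> unif ^ m dvd (a - b)"
    by (auto simp: of_padic_int_def eq_fract image_iff dvd_def mult.commute)
  ultimately show ?thesis by (simp add: pf_def prufer.abs_eq_iff)
qed

lemma pf_zero [simp]: "pf m 0 = 0"
proof -
  have "Fract 0 (unif ^ m) = (0 :: 'a padic)" by (simp add: Zero_fract_def eq_fract)
  then show ?thesis by (simp add: pf_def zero_prufer_def)
qed

lemma pf_eq_0_iff: "pf m a = 0 \<longleftrightarrow> unif ^ m dvd a"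
  using pf_eq_iff[of m a 0] by simp

lemma pf_add: "pf m a + pf m b = pf m (a + b)"
proof -
  have "Fract a (unif ^ m) + Fract b (unif ^ m) = Fract (a + b) (unif ^ m)"
    by (simp add: eq_fract algebra_simps)
  then show ?thesis by (simp add: pf_def plus_prufer.abs_eq)
qed

lemma scale_pf: "padic_scale b (pf m a) = pf m (b * a)"
  by (simp add: pf_def padic_scale.abs_eq of_padic_int_def)

lemma pf_shift: "pf (m + j) (unif ^ j * a) = pf m a"
proof -
  have "Fract (unif ^ j * a) (unif ^ (m + j)) = Fract a (unif ^ m)"
    by (simp add: eq_fract power_add algebra_simps)
  then show ?thesis by (simp add: pf_def)
qed

text \<open>The unit part of a denominator can be moved into the numerator.\<close>

lemma prufer_cases:
  obtains m a where "x = pf m a"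
proof -
  obtain y where y: "x = abs_prufer y" by (metis Quotient3_abs_rep Quotient3_prufer)
  obtain a b where ab: "y = Fract a b" "b \<noteq> 0" by (cases y) auto
  obtain j u where j: "b = unif ^ j * u" "u dvd 1" using padic_int_factor[OF ab(2)] by blast
  obtain v where v: "1 = u * v" using j(2) by (elim dvdE)
  have "Fract a b = Fract (a * v) (unif ^ j)"
    using ab(2) j v by (simp add: eq_fract algebra_simps) 
  then show ?thesis using that y ab(1) by (simp add: pf_def)
qed

lemma padic_scale_add_left: "padic_scale (a + b) x = padic_scale a x + padic_scale b x"
  by (cases x rule: prufer_cases) (simp add: scale_pf pf_add distrib_right)

lemma padic_scale_mult: "padic_scale (a * b) x = padic_scale a (padic_scale b x)"
  by (cases x rule: prufer_cases) (simp add: scale_pf mult.assoc)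

lemma padic_scale_one [simp]: "padic_scale 1 x = x"
  by (cases x rule: prufer_cases) (simp add: scale_pf)

lemma padic_scale_zero_left [simp]: "padic_scale 0 x = 0"
  by (cases x rule: prufer_cases) (simp add: scale_pf)

lemma prufer_cases2:
  obtains m a b where "x = pf m a" "y = pf m b"
proof -
  obtain m a where "x = pf m a" by (cases x rule: prufer_cases)
  moreover obtain l b where "y = pf l b" by (cases y rule: prufer_cases)
  ultimately show ?thesis
    using that[of "m + l" "unif ^ l * a" "unif ^ m * b"] pf_shift[of m l a] pf_shift[of l m b]
    by (simp add: add.commute)
qed

lemma padic_scale_add_right: "padic_scale a (x + y) = padic_scale a x + padic_scale a y"
  by (cases x y rule: prufer_cases2) (simp add: scale_pf pf_add distrib_left)

lemma padic_scale_zero_right [simp]: "padic_scale a 0 = 0"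
  using scale_pf[of a 0 0] by simp

lemma padic_scale_sum_right: "padic_scale a (sum f S) = (\<Sum>i\<in>S. padic_scale a (f i))"
  by (induction S rule: infinite_finite_induct) (simp_all add: padic_scale_add_right)

lemma padic_scale_sum_left: "padic_scale (sum f S) x = (\<Sum>i\<in>S. padic_scale (f i) x)"
  by (induction S rule: infinite_finite_induct) (simp_all add: padic_scale_add_left)

lemma pf_mod: "pf m a = pf m (of_nat (nat (Rep_padic_int a m)))"
  by (simp add: pf_eq_iff padic_int_mod_unif_power)

lemma prufer_torsionE:
  assumes "padic_scale (unif ^ m) x = 0"
  obtains a where "x = pf m a"
proof -
  obtain l a where x: "x = pf l a" by (cases x rule: prufer_cases)
  then have "unif ^ l dvd unif ^ m * a" using assms by (simp add: scale_pf pf_eq_0_iff)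
  then obtain b where b: "unif ^ m * a = unif ^ l * b" by (elim dvdE)
  have "x = pf (l + m) (unif ^ m * a)" by (simp add: x pf_shift)
  also have "\<dots> = pf m b" unfolding b using pf_shift[of m l b] by (simp add: add.commute)
  finally show ?thesis by (rule that)
qed

lemma prufer_torsion_bij:
  "bij_betw (\<lambda>i. pf m (of_nat i)) {..<CARD('p) ^ m} {x :: 'p::prime_card prufer. padic_scale (unif ^ m) x = 0}"
proof (rule bij_betw_imageI)
  show "inj_on (\<lambda>i. pf m (of_nat i) :: 'p prufer) {..<CARD('p) ^ m}"
  proof (rule inj_onI)
    fix i j assume ij: "i \<in> {..<CARD('p) ^ m}" "j \<in> {..<CARD('p) ^ m}" "pf m (of_nat i) = (pf m (of_nat j) :: 'p prufer)"
    then have "(int i - int j) mod int CARD('p) ^ m = 0"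
      by (simp add: pf_eq_iff unif_power_dvd_iff Rep_padic_int_simps Rep_of_nat mod_simps)
    then have "int i mod int CARD('p) ^ m = int j mod int CARD('p) ^ m"
      using mod_eq_dvd_iff by auto
    moreover have "int i < int CARD('p) ^ m" "int j < int CARD('p) ^ m"
      using ij by (metis lessThan_iff of_nat_less_iff of_nat_power)+
    ultimately show "i = j" by simp
  qed
  show "(\<lambda>i. pf m (of_nat i)) ` {..<CARD('p) ^ m} = {x :: 'p prufer. padic_scale (unif ^ m) x = 0}"
  proof (intro subset_antisym subsetI)
    fix x :: "'p prufer" assume "x \<in> {x. padic_scale (unif ^ m) x = 0}"
    then obtain a where a: "x = pf m a" using prufer_torsionE by blast
    have "nat (Rep_padic_int a m) < CARD('p) ^ m"
      using Rep_bounds[of a m] by (simp add: nat_less_iff)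
    then show "x \<in> (\<lambda>i. pf m (of_nat i)) ` {..<CARD('p) ^ m}"
      using a pf_mod[of m a] by blast
  qed (auto simp: scale_pf pf_eq_0_iff)
qed

lemma prufer_torsion_finite: "finite {x :: 'p::prime_card prufer. padic_scale (unif ^ m) x = 0}"
  and prufer_torsion_card: "card {x :: 'p::prime_card prufer. padic_scale (unif ^ m) x = 0} = CARD('p) ^ m"
  using bij_betw_finite[OF prufer_torsion_bij[of m, where 'p='p]]
    bij_betw_same_card[OF prufer_torsion_bij[of m, where 'p='p]] by simp_all

lemma prufer_divisible:
  assumes "b \<noteq> 0"
  obtains y where "padic_scale b y = x"
proof -
  obtain m a where x: "x = pf m a" by (cases x rule: prufer_cases)
  obtain j u where j: "b = unif ^ j * u" "u dvd 1" using padic_int_factor[OF assms] by blast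
  obtain v where v: "1 = u * v" using j(2) by (elim dvdE)
  have "padic_scale b (pf (m + j) (v * a)) = pf (m + j) (unif ^ j * ((u * v) * a))"
    unfolding scale_pf j by (simp add: algebra_simps)
  then have "padic_scale b (pf (m + j) (v * a)) = x"
    by (simp add: pf_shift x flip: v)
  then show ?thesis by (rule that)
qed

text \<open>The annihilator of the single element 1 / p^m is already generated by p^m.\<close>

lemma padic_scale_annihilates:
  assumes "\<And>x :: 'p::prime_card prufer. padic_scale (unif ^ m) x = 0 \<Longrightarrow> padic_scale b x = 0"
  shows "unif ^ m dvd b"
  using assms[of "pf m 1"] by (simp add: scale_pf pf_eq_0_iff)

text \<open>The endomorphism ring of Q_p/Z_p is Z_p. The image of 1 / p^m is p^m-torsion, hence x_m
  / p^m with x_m < p^m. Since p times 1 / p^(m+1) is 1 / p^m, the x_m are coherent, and they are the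
  entries of the scalar.\<close>

lemma prufer_endo_scale:
  fixes f :: "'p::prime_card prufer \<Rightarrow> 'p prufer"
  assumes add: "\<And>x y. f (x + y) = f x + f y"
  obtains a where "f = padic_scale a"
proof -
  let ?q = "int CARD('p)"
  have f0: "f 0 = 0" using add[of 0 0] by simp
  have nat: "f (pf m (of_nat k * b)) = padic_scale (of_nat k) (f (pf m b))" for m k b
    by (induction k) (simp_all add: f0 distrib_right add padic_scale_add_left flip: pf_add)
  have up: "unif ^ m = (of_nat (CARD('p) ^ m) :: 'p padic_int)" for m by (simp add: unif_def)
  have "\<exists>i. i < CARD('p) ^ m \<and> f (pf m 1) = pf m (of_nat i)" for m
  proof -
    have "padic_scale (unif ^ m) (f (pf m 1)) = f (pf m (unif ^ m * 1))"
      by (simp only: up nat)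
    also have "\<dots> = 0" using pf_eq_0_iff[of m "unif ^ m :: 'p padic_int"] f0 by simp
    finally show ?thesis using prufer_torsion_bij[of m, where 'p='p]
      by (auto simp: bij_betw_def image_iff set_eq_iff)
  qed
  then obtain x where x: "\<And>m. x m < CARD('p) ^ m" "\<And>m. f (pf m 1) = pf m (of_nat (x m))" by metis
  have "int (x m) = int (x (Suc m)) mod ?q ^ m" for m
  proof -
    have "pf m (of_nat (x m)) = f (pf (m + 1) (unif ^ 1 * 1))" by (simp only: pf_shift x)
    also have "\<dots> = padic_scale (unif ^ 1) (pf (m + 1) (of_nat (x (Suc m))))"
      unfolding up nat by (simp add: x)
    also have "\<dots> = pf m (of_nat (x (Suc m)))" unfolding scale_pf pf_shift ..
    finally have "(int (x m) - int (x (Suc m))) mod ?q ^ m = 0"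
      by (simp add: pf_eq_iff unif_power_dvd_iff Rep_padic_int_simps Rep_of_nat mod_simps)
    then have "int (x m) mod ?q ^ m = int (x (Suc m)) mod ?q ^ m"
      using mod_eq_dvd_iff by auto
    moreover have "int (x m) < ?q ^ m" using x(1)[of m] by (metis of_nat_less_iff of_nat_power)
    ultimately show ?thesis by simp
  qed
  then have Rx: "Rep_padic_int (Abs_padic_int (\<lambda>m. int (x m)) :: 'p padic_int) = (\<lambda>m. int (x m))"
    by (intro Abs_padic_int_inverse) blast
  let ?a = "Abs_padic_int (\<lambda>m. int (x m)) :: 'p padic_int"
  have "f y = padic_scale ?a y" for y
  proof -
    obtain m b where y: "y = pf m b" by (cases y rule: prufer_cases)
    let ?k = "nat (Rep_padic_int b m)"
    have yk: "y = pf m (of_nat ?k * 1)" using y pf_mod[of m b] by simp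
    have "f y = padic_scale (of_nat ?k) (pf m (of_nat (x m)))" unfolding yk nat x ..
    also have "\<dots> = padic_scale (of_nat ?k) (pf m ?a)" using pf_mod[of m ?a] by (simp add: Rx)
    also have "\<dots> = padic_scale ?a y" by (simp add: yk scale_pf mult.commute)
    finally show ?thesis .
  qed
  then show ?thesis by (intro that[of ?a]) blast
qed

section \<open>Matrices over the p-adic integers\<close>

lemma smult_smult_mat:
  fixes A :: "'a::semigroup_mult mat"
  shows "a \<cdot>\<^sub>m (b \<cdot>\<^sub>m A) = (a * b) \<cdot>\<^sub>m A"
  by (rule eq_matI) (auto simp: mult.assoc)

lemma one_smult_mat [simp]:
  fixes A :: "'a::monoid_mult mat"
  shows "1 \<cdot>\<^sub>m A = A"
  by (rule eq_matI) auto

text \<open>Cramer's rule: the adjugate divided by a unit determinant is the inverse.\<close>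

lemma invertible_mat_iff_det:
  fixes A :: "'a::comm_ring_1 mat"
  assumes A: "A \<in> carrier_mat k k"
  shows "invertible_mat A \<longleftrightarrow> det A dvd 1"
proof
  assume "invertible_mat A"
  then obtain B where B: "A * B = 1\<^sub>m k" "B * A = 1\<^sub>m (dim_row B)"
    using A by (auto simp: invertible_mat_def inverts_mat_def)
  have "B \<in> carrier_mat k k"
    using arg_cong[OF B(1), of dim_col] arg_cong[OF B(2), of dim_col] A by auto
  then have "det A * det B = 1" using det_mult[OF A, of B] B(1) by simp
  then show "det A dvd 1" by (metis dvdI)
next
  assume "det A dvd 1"
  then obtain c where c: "1 = det A * c" by (elim dvdE)
  note adj = adj_mat[OF A]
  have "A * (c \<cdot>\<^sub>m adj_mat A) = 1\<^sub>m k"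
    using A adj c by (simp add: mult_smult_distrib[of _ k k _ k] smult_smult_mat mult.commute[of c])
  moreover have "(c \<cdot>\<^sub>m adj_mat A) * A = 1\<^sub>m k"
    using A adj c by (simp add: mult_smult_assoc_mat[of _ k k _ k] smult_smult_mat mult.commute[of c])
  ultimately show "invertible_mat A"
    using A adj(1) by (auto simp: invertible_mat_def inverts_mat_def)
qed

section \<open>The group \<open>Gamma k\<close> and the monoid \<open>Delta k\<close>\<close>

lemma Gamma_iff: "A \<in> Gamma k \<longleftrightarrow> A \<in> carrier_mat k k \<and> det A dvd 1"
  using invertible_mat_iff_det by (auto simp: Gamma_def)

lemma Delta_iff: "A \<in> Delta k \<longleftrightarrow> A \<in> carrier_mat k k \<and> det A \<noteq> 0"
proof -
  have "invertible_mat (map_mat of_padic_int A :: 'a padic mat) \<longleftrightarrow> det A \<noteq> 0"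
    if "A \<in> carrier_mat k k" for A :: "'a padic_int mat"
  proof -
    have "invertible_mat (map_mat of_padic_int A :: 'a padic mat) \<longleftrightarrow> det (map_mat of_padic_int A :: 'a padic mat) dvd 1"
      by (rule invertible_mat_iff_det[of _ k]) (use that in auto)
    also have "\<dots> \<longleftrightarrow> of_padic_int (det A) \<noteq> (0 :: 'a padic)"
      unfolding of_padic_int_hom.hom_det dvd_field_iff by simp
    also have "\<dots> \<longleftrightarrow> det A \<noteq> 0" using inj_of_padic_int[of "det A" 0] by (simp only: of_padic_int_0)
    finally show ?thesis .
  qed
  then show ?thesis by (auto simp: Delta_def)
qed

lemma Gamma_Delta: "A \<in> Gamma k \<Longrightarrow> A \<in> Delta k"
  by (auto simp: Gamma_iff Delta_iff)

lemma Gamma_carrier: "A \<in> Gamma k \<Longrightarrow> A \<in> carrier_mat k k"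
  and Delta_carrier: "A \<in> Delta k \<Longrightarrow> A \<in> carrier_mat k k"
  by (auto simp: Gamma_iff Delta_iff)

lemma one_Gamma: "1\<^sub>m k \<in> Gamma k"
  by (simp add: Gamma_iff)

lemma Gamma_mult: "A \<in> Gamma k \<Longrightarrow> B \<in> Gamma k \<Longrightarrow> A * B \<in> Gamma k"
  by (auto simp: Gamma_iff det_mult)

lemma transpose_Gamma: "A \<in> Gamma k \<Longrightarrow> transpose_mat A \<in> Gamma k"
  and transpose_Delta: "A \<in> Delta k \<Longrightarrow> transpose_mat A \<in> Delta k"
  by (auto simp: Gamma_iff Delta_iff det_transpose)

lemma Gamma_inverse:
  assumes "g \<in> Gamma k"
  obtains h where "h \<in> Gamma k" "g * h = 1\<^sub>m k" "h * g = 1\<^sub>m k"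
proof -
  obtain h where h: "g * h = 1\<^sub>m k" "h * g = 1\<^sub>m (dim_row h)"
    using assms by (auto simp: Gamma_def invertible_mat_def inverts_mat_def)
  have hc: "h \<in> carrier_mat k k"
    using arg_cong[OF h(1), of dim_col] arg_cong[OF h(2), of dim_col] Gamma_carrier[OF assms] by auto
  then have "det g * det h = 1" using det_mult[OF Gamma_carrier[OF assms] hc] h(1) by simp
  then have "det h dvd 1" by (metis dvdI mult.commute)
  then show ?thesis using that[of h] h hc by (simp add: Gamma_iff)
qed

text \<open>The adjugate, rescaled by the inverse of the unit part of the determinant. It replaces
  the inverse over Q_p by an integral matrix, at the price of a power of p.\<close>

lemma Delta_quasi_inverse:
  assumes "A \<in> Delta k"
  obtains A' m where "A' \<in> carrier_mat k k" "A * A' = unif ^ m \<cdot>\<^sub>m 1\<^sub>m k" "A' * A = unif ^ m \<cdot>\<^sub>m 1\<^sub>m k"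
proof -
  have A: "A \<in> carrier_mat k k" and d: "det A \<noteq> 0" using assms by (auto simp: Delta_iff)
  obtain m u where u: "det A = unif ^ m * u" "u dvd 1" using padic_int_factor[OF d] .
  then obtain v where v: "1 = u * v" by (elim dvdE)
  have vd: "v * det A = unif ^ m" using u v by (metis mult.assoc mult.commute mult_1)
  note adj = adj_mat[OF A]
  have "A * (v \<cdot>\<^sub>m adj_mat A) = unif ^ m \<cdot>\<^sub>m 1\<^sub>m k"
    using A adj vd by (simp add: mult_smult_distrib[of _ k k _ k] smult_smult_mat)
  moreover have "(v \<cdot>\<^sub>m adj_mat A) * A = unif ^ m \<cdot>\<^sub>m 1\<^sub>m k"
    using A adj vd by (simp add: mult_smult_assoc_mat[of _ k k _ k] smult_smult_mat)
  ultimately show ?thesis using that[of "v \<cdot>\<^sub>m adj_mat A" m] adj(1) by simp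
qed

lemma smult_mat_cancel:
  fixes X Y :: "'a::idom mat"
  assumes "c \<cdot>\<^sub>m X = c \<cdot>\<^sub>m Y" "c \<noteq> 0" "X \<in> carrier_mat k l" "Y \<in> carrier_mat k l"
  shows "X = Y"
proof (rule eq_matI)
  fix i j assume "i < dim_row Y" "j < dim_col Y"
  then show "X $$ (i, j) = Y $$ (i, j)"
    using assms(2-) arg_cong[OF assms(1), of "\<lambda>M. M $$ (i, j)"] by simp
qed (use assms in auto)

lemma Delta_cancel_right:
  assumes "D \<in> Delta k" "X \<in> carrier_mat k k" "Y \<in> carrier_mat k k" "X * D = Y * D"
  shows "X = Y"
proof -
  obtain D' m where D': "D' \<in> carrier_mat k k" "D * D' = unif ^ m \<cdot>\<^sub>m 1\<^sub>m k"
    using Delta_quasi_inverse[OF assms(1)] by metis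
  have "Z * D * D' = unif ^ m \<cdot>\<^sub>m Z" if "Z \<in> carrier_mat k k" for Z
    using that D' assoc_mult_mat[OF that Delta_carrier[OF assms(1)] D'(1)]
    by (simp add: mult_smult_distrib[of _ k k _ k])
  then have "unif ^ m \<cdot>\<^sub>m X = unif ^ m \<cdot>\<^sub>m Y" using assms by metis
  then show ?thesis by (rule smult_mat_cancel[OF _ _ assms(2,3)]) simp
qed

section \<open>Primitive vectors and reduction of the first column\<close>

lemma vec_primitive_factor:
  fixes w :: "'p::prime_card padic_int vec"
  assumes "w \<in> carrier_vec k" "w \<noteq> 0\<^sub>v k"
  obtains j u where "w = unif ^ j \<cdot>\<^sub>v u" "u \<in> carrier_vec k" "\<exists>i<k. u $ i dvd 1"
proof -
  obtain i0 where i0: "i0 < k" "w $ i0 \<noteq> 0" using assms by (metis carrier_vecD eq_vecI index_zero_vec)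
  then obtain m0 where "Rep_padic_int (w $ i0) m0 \<noteq> 0"
    by (metis padic_int_eqI zero_padic_int.rep_eq)
  then have "\<exists>m. \<not> (\<forall>i<k. unif ^ m dvd w $ i)" using i0 unif_power_dvd_iff by blast
  then obtain m where m: "\<not> (\<forall>i<k. unif ^ m dvd w $ i)" "\<And>l. l < m \<Longrightarrow> \<forall>i<k. unif ^ l dvd w $ i"
    using exists_least_iff[of "\<lambda>m. \<not> (\<forall>i<k. unif ^ m dvd w $ i)"] by blast
  then obtain j where j: "m = Suc j" by (cases m) auto
  then have "\<forall>i<k. \<exists>c. w $ i = unif ^ j * c" using m(2)[of j] by (auto simp: dvd_def)
  then obtain c where c: "\<And>i. i < k \<Longrightarrow> w $ i = unif ^ j * c i" by metis
  have "w = unif ^ j \<cdot>\<^sub>v vec k c" using assms c by (intro eq_vecI) auto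
  moreover have "\<exists>i<k. vec k c $ i dvd 1"
  proof -
    obtain i where "i < k" "\<not> unif ^ m dvd w $ i" using m(1) by blast
    then have "\<not> unif dvd c i" using c[of i] by (auto simp: j mult_dvd_mono)
    then show ?thesis using \<open>i < k\<close> by (auto simp: padic_int_unit_iff)
  qed
  ultimately show ?thesis by (intro that) auto
qed

text \<open>If the entry at 0 is a unit, the identity matrix with its first column replaced is
  triangular with that entry as determinant. Otherwise the ring is local, so adding the unit entry
  at \<open>i\<close> to the entry at 0 makes it a unit; the elementary matrix \<open>e\<close>
  undoes this addition.\<close>

lemma primitive_completion:
  fixes u :: "'p::prime_card padic_int vec"
  assumes u: "u \<in> carrier_vec k" and i: "i < k" "u $ i dvd 1"
  obtains g where "g \<in> Gamma k" "col g 0 = u"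
proof -
  have base: "\<exists>g\<in>Gamma k. col g 0 = v" if v: "v \<in> carrier_vec k" "v $ 0 dvd 1" for v :: "'p padic_int vec"
  proof -
    define g where "g = mat k k (\<lambda>(r, c). if c = 0 then v $ r else if r = c then 1 else 0)"
    have "det g = prod_list (diag_mat g)"
      by (rule det_lower_triangular[of k]) (auto simp: g_def)
    also have "\<dots> = (\<Prod>r<k. g $$ (r, r))"
      by (simp add: prod_list_diag_prod g_def atLeast0LessThan)
    also have "\<dots> = (\<Prod>r<k. if r = 0 then v $ 0 else 1)"
      by (rule prod.cong) (auto simp: g_def)
    also have "\<dots> = v $ 0" using i by (simp add: prod.delta)
    finally have "g \<in> Gamma k" using v by (auto simp: Gamma_iff g_def)
    moreover have "col g 0 = v" using v i by (intro eq_vecI) (auto simp: g_def)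
    ultimately show ?thesis by blast
  qed
  show ?thesis
  proof (cases "u $ 0 dvd 1")
    case True
    then show ?thesis using base[OF u] that by blast
  next
    case False
    then have i0: "i \<noteq> 0" using i by metis
    define v where "v = vec k (\<lambda>r. if r = 0 then u $ 0 + u $ i else u $ r)"
    have "v $ 0 dvd 1" using unit_add_nonunit[OF False i(2)] i by (simp add: v_def)
    then obtain g where g: "g \<in> Gamma k" "col g 0 = v" using base[of v] by (auto simp: v_def)
    define e :: "'p padic_int mat" where "e = addrow_mat k (- 1) 0 i"
    have e: "e \<in> Gamma k"
      using i0 by (simp add: e_def Gamma_iff det_addrow_mat)
    have "col (e * g) 0 = e *\<^sub>v v" using g e Gamma_carrier i by (subst col_mult2[of _ k k _ k]) auto
    also have "e * g = addrow (- 1) 0 i g"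
      unfolding e_def using addrow_mat[OF Gamma_carrier[OF g(1)], of i] i by simp
    finally have "e *\<^sub>v v = col (addrow (- 1) 0 i g) 0" by simp
    also have "\<dots> = u"
    proof (rule eq_vecI)
      fix r assume r: "r < dim_vec u"
      have gv: "g $$ (s, 0) = v $ s" if "s < k" for s
        using g that i Gamma_carrier[OF g(1)] by (metis carrier_matD(1,2) gr_implies_not0 index_col neq0_conv)
      show "col (addrow (- 1) 0 i g) 0 $ r = u $ r"
        using r u i i0 g Gamma_carrier[OF g(1)] by (auto simp: gv v_def)
    qed (use g u Gamma_carrier in auto)
    finally have "col (e * g) 0 = u" using \<open>col (e * g) 0 = e *\<^sub>v v\<close> by simp
    then show ?thesis using that Gamma_mult[OF e g(1)] by blast
  qed
qed

text \<open>The first column of a quasi-inverse of A is sent by A to a multiple of the first basis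
  vector. So is the primitive vector \<open>u\<close> obtained by dividing that column by a power of
  p, and with \<open>u\<close> as first column of \<open>g\<close> the first column of A g is A
  u.\<close>

lemma Delta_column_reduction:
  fixes A :: "'p::prime_card padic_int mat"
  assumes A: "A \<in> Delta (Suc n)"
  obtains g where "g \<in> Gamma (Suc n)" "\<And>i. 0 < i \<Longrightarrow> i \<le> n \<Longrightarrow> (A * g) $$ (i, 0) = 0"
proof -
  note Ac = Delta_carrier[OF A]
  obtain A' m where A': "A' \<in> carrier_mat (Suc n) (Suc n)" "A * A' = unif ^ m \<cdot>\<^sub>m 1\<^sub>m (Suc n)"
    using Delta_quasi_inverse[OF A] by metis
  let ?w = "col A' 0"
  have Aw: "A *\<^sub>v ?w = col (unif ^ m \<cdot>\<^sub>m 1\<^sub>m (Suc n)) 0"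
    using A' Ac by (metis col_mult2 zero_less_Suc)
  have wc: "?w \<in> carrier_vec (Suc n)" using A'(1) by (intro carrier_vecI) simp
  have "?w \<noteq> 0\<^sub>v (Suc n)"
  proof
    assume "?w = 0\<^sub>v (Suc n)"
    then have "col (unif ^ m \<cdot>\<^sub>m 1\<^sub>m (Suc n)) 0 = (0\<^sub>v (Suc n) :: 'p padic_int vec)"
    proof -
      have "A *\<^sub>v 0\<^sub>v (Suc n) = 0\<^sub>v (Suc n)" using Ac by (intro eq_vecI) auto
      then show ?thesis using Aw unfolding \<open>?w = 0\<^sub>v (Suc n)\<close> by metis
    qed
    from arg_cong[OF this, of "\<lambda>v. v $ 0"] show False by (simp add: one_mat_def)
  qed
  then obtain j u where u: "?w = unif ^ j \<cdot>\<^sub>v u" "u \<in> carrier_vec (Suc n)" "\<exists>i<Suc n. u $ i dvd 1"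
    using vec_primitive_factor[OF wc] by metis
  then obtain g where g: "g \<in> Gamma (Suc n)" "col g 0 = u"
    using primitive_completion by metis
  have "(A * g) $$ (i, 0) = 0" if i: "0 < i" "i \<le> n" for i
  proof -
    have "unif ^ j * (A *\<^sub>v u) $ i = (A *\<^sub>v ?w) $ i"
      unfolding u(1) using Ac u(2) i by (simp add: mult_mat_vec[of _ "Suc n" "Suc n"])
    also have "\<dots> = 0" unfolding Aw using i by simp
    finally have "(A *\<^sub>v u) $ i = 0" by simp
    then show ?thesis using i Ac g Gamma_carrier[OF g(1)] by auto
  qed
  then show ?thesis using that g by blast
qed

section \<open>Block diagonal matrices diag(a, D)\<close>

definition dsum :: "'a::zero \<Rightarrow> 'a mat \<Rightarrow> 'a mat" where
  "dsum a D = mat (Suc (dim_row D)) (Suc (dim_col D))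
     (\<lambda>(i, j). if i = 0 \<and> j = 0 then a else if i = 0 \<or> j = 0 then 0 else D $$ (i - 1, j - 1))"

lemma det_first_column:
  fixes A :: "'a::comm_ring_1 mat"
  assumes A: "A \<in> carrier_mat (Suc n) (Suc n)" and 0: "\<And>i. 0 < i \<Longrightarrow> i \<le> n \<Longrightarrow> A $$ (i, 0) = 0"
  shows "det A = A $$ (0, 0) * det (mat_delete A 0 0)"
proof -
  have "det A = (\<Sum>i<Suc n. A $$ (i, 0) * cofactor A i 0)"
    by (rule laplace_expansion_column[OF A]) simp
  also have "\<dots> = A $$ (0, 0) * cofactor A 0 0 + (\<Sum>i<n. A $$ (Suc i, 0) * cofactor A (Suc i) 0)"
    by (rule sum.lessThan_Suc_shift)
  also have "(\<Sum>i<n. A $$ (Suc i, 0) * cofactor A (Suc i) 0) = 0"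
    by (rule sum.neutral) (auto simp: 0)
  finally show ?thesis by (simp add: cofactor_def)
qed

lemma dsum_carrier: "D \<in> carrier_mat n n \<Longrightarrow> dsum a D \<in> carrier_mat (Suc n) (Suc n)"
  by (auto simp: dsum_def)

lemma mat_delete_dsum: "mat_delete (dsum a D) 0 0 = D"
  by (rule eq_matI) (auto simp: dsum_def mat_delete_def insert_index_def)

lemma det_dsum: 
  fixes D :: "'a::comm_ring_1 mat"
  assumes "D \<in> carrier_mat n n" shows "det (dsum a D) = a * det D"
  by (subst det_first_column[OF dsum_carrier[OF assms]])
     (use assms in \<open>auto simp: mat_delete_dsum\<close>, auto simp: dsum_def)

lemma transpose_dsum: "transpose_mat (dsum a D) = dsum a (transpose_mat D)"
  by (rule eq_matI) (auto simp: dsum_def)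


section \<open>The action of matrices on powers of the Pruefer group\<close>

lemma mat_act_carrier [simp]: "A \<in> carrier_mat k l \<Longrightarrow> mat_act A v \<in> carrier_vec k"
  by (auto simp: mat_act_def)

lemma mat_act_mult:
  assumes "A \<in> carrier_mat a b" "B \<in> carrier_mat b c" "v \<in> carrier_vec c"
  shows "mat_act (A * B) v = mat_act A (mat_act B v)"
proof (rule eq_vecI)
  fix i assume "i < dim_vec (mat_act A (mat_act B v))"
  then have i: "i < a" using assms by (simp add: mat_act_def)
  have "mat_act (A * B) v $ i = (\<Sum>j<c. padic_scale (\<Sum>l<b. A $$ (i, l) * B $$ (l, j)) (v $ j))"
    using assms i by (auto simp: mat_act_def scalar_prod_def atLeast0LessThan intro!: sum.cong)
  also have "\<dots> = (\<Sum>j<c. \<Sum>l<b. padic_scale (A $$ (i, l)) (padic_scale (B $$ (l, j)) (v $ j)))"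
    by (simp add: padic_scale_sum_left padic_scale_mult)
  also have "\<dots> = (\<Sum>l<b. \<Sum>j<c. padic_scale (A $$ (i, l)) (padic_scale (B $$ (l, j)) (v $ j)))"
    by (rule sum.swap)
  also have "\<dots> = mat_act A (mat_act B v) $ i"
    using assms i by (simp add: mat_act_def padic_scale_sum_right)
  finally show "mat_act (A * B) v $ i = mat_act A (mat_act B v) $ i" .
qed (use assms in \<open>auto simp: mat_act_def\<close>)

lemma mat_act_add:
  assumes "v \<in> carrier_vec k" "w \<in> carrier_vec k"
  shows "mat_act A (v + w) = mat_act A v + mat_act A w"
  by (rule eq_vecI) (use assms in \<open>auto simp: mat_act_def padic_scale_add_right sum.distrib\<close>)

lemma mat_act_zero [simp]: "A \<in> carrier_mat k l \<Longrightarrow> mat_act A (0\<^sub>v l) = 0\<^sub>v k"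
  by (rule eq_vecI) (auto simp: mat_act_def)

lemma mat_act_smult_one:
  assumes "v \<in> carrier_vec k" "i < k"
  shows "mat_act (c \<cdot>\<^sub>m 1\<^sub>m k) v $ i = padic_scale c (v $ i)"
proof -
  have "mat_act (c \<cdot>\<^sub>m 1\<^sub>m k) v $ i = (\<Sum>j<k. padic_scale (c * (if i = j then 1 else 0)) (v $ j))"
    using assms by (simp add: mat_act_def)
  also have "\<dots> = (\<Sum>j<k. if j = i then padic_scale c (v $ j) else 0)"
    by (rule sum.cong) auto
  finally show ?thesis using assms by simp
qed

lemma mat_act_one [simp]: "v \<in> carrier_vec k \<Longrightarrow> mat_act (1\<^sub>m k) v = v"
  by (rule eq_vecI) (use mat_act_smult_one[of v k _ 1] in \<open>auto simp: mat_act_def\<close>)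

text \<open>Off the diagonal the first row of the transpose vanishes, so the transpose preserves the
  kernel of the first coordinate and acts there through the lower right block.\<close>

lemma mat_act_vCons_0:
  assumes A: "A \<in> carrier_mat (Suc n) (Suc n)" and 0: "\<And>i. 0 < i \<Longrightarrow> i \<le> n \<Longrightarrow> A $$ (i, 0) = 0"
    and x: "x \<in> carrier_vec n"
  shows "mat_act (transpose_mat A) (vCons 0 x) = vCons 0 (mat_act (transpose_mat (mat_delete A 0 0)) x)"
proof (rule eq_vecI)
  fix i assume "i < dim_vec (vCons 0 (mat_act (transpose_mat (mat_delete A 0 0)) x))"
  then have i: "i < Suc n" using A by (simp add: mat_act_def)
  show "mat_act (transpose_mat A) (vCons 0 x) $ i = vCons 0 (mat_act (transpose_mat (mat_delete A 0 0)) x) $ i"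
    using A 0 x i by (cases i) (auto simp: mat_act_def sum.lessThan_Suc_shift mat_delete_def insert_index_def simp del: sum.lessThan_Suc)
qed (use A in \<open>auto simp: mat_act_def\<close>)

lemma mat_act_dsum:
  assumes D: "D \<in> carrier_mat n n" and x: "x \<in> carrier_vec n"
  shows "mat_act (dsum a D) (vCons c x) = vCons (padic_scale a c) (mat_act D x)"
proof (rule eq_vecI)
  fix i assume "i < dim_vec (vCons (padic_scale a c) (mat_act D x))"
  then have i: "i < Suc n" using D by (simp add: mat_act_def)
  show "mat_act (dsum a D) (vCons c x) $ i = vCons (padic_scale a c) (mat_act D x) $ i"
    using D x i by (cases i) (auto simp: mat_act_def sum.lessThan_Suc_shift dsum_def simp del: sum.lessThan_Suc)
qed (use D in \<open>auto simp: mat_act_def dsum_def\<close>)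

section \<open>Torsion subgroups of Lambda^k\<close>

definition torsion :: "nat \<Rightarrow> nat \<Rightarrow> 'p::prime_card prufer vec set" where
  "torsion m k = {v \<in> carrier_vec k. \<forall>i<k. padic_scale (unif ^ m) (v $ i) = 0}"

lemma torsion_iff_mat_act:
  "v \<in> carrier_vec k \<Longrightarrow> v \<in> torsion m k \<longleftrightarrow> mat_act (unif ^ m \<cdot>\<^sub>m 1\<^sub>m k) v = 0\<^sub>v k"
proof -
  assume v: "v \<in> carrier_vec k"
  have "v \<in> torsion m k \<longleftrightarrow> (\<forall>i<k. mat_act (unif ^ m \<cdot>\<^sub>m 1\<^sub>m k) v $ i = 0)"
    using v by (auto simp: torsion_def mat_act_smult_one)
  also have "\<dots> \<longleftrightarrow> mat_act (unif ^ m \<cdot>\<^sub>m 1\<^sub>m k) v = 0\<^sub>v k"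
  proof
    assume "\<forall>i<k. mat_act (unif ^ m \<cdot>\<^sub>m 1\<^sub>m k) v $ i = 0"
    then show "mat_act (unif ^ m \<cdot>\<^sub>m 1\<^sub>m k) v = 0\<^sub>v k" by (intro eq_vecI) (auto simp: mat_act_def)
  qed simp
  finally show ?thesis .
qed


lemma torsion_Suc:
  "torsion m (Suc k) = (\<lambda>(c, x). vCons c x) ` ({c. padic_scale (unif ^ m) c = 0} \<times> torsion m k)"
proof (intro subset_antisym subsetI)
  fix v :: "'a prufer vec" assume v: "v \<in> torsion m (Suc k)"
  then obtain c x where "v = vCons c x" by (cases v) (auto simp: torsion_def)
  then show "v \<in> (\<lambda>(c, x). vCons c x) ` ({c. padic_scale (unif ^ m) c = 0} \<times> torsion m k)"
    using v by (auto simp: torsion_def All_less_Suc2)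
qed (auto simp: torsion_def All_less_Suc2)

lemma torsion_finite_card:
  "finite (torsion m k :: 'p::prime_card prufer vec set) \<and> card (torsion m k :: 'p prufer vec set) = CARD('p) ^ (m * k)"
proof (induction k)
  case 0
  have "torsion m 0 = {0\<^sub>v 0 :: 'p prufer vec}" by (auto simp: torsion_def)
  then show ?case by simp
next
  case (Suc k)
  have "inj_on (\<lambda>(c, x). vCons c x) ({c :: 'p prufer. padic_scale (unif ^ m) c = 0} \<times> torsion m k)"
    by (auto simp: inj_on_def)
  then show ?case unfolding torsion_Suc
    using Suc prufer_torsion_finite[of m, where 'p='p]
    by (simp add: card_image card_cartesian_product prufer_torsion_card power_add)
qed

lemma mat_act_diff:
  assumes "v \<in> carrier_vec k" "w \<in> carrier_vec k"
  shows "mat_act A (v - w) = mat_act A v - mat_act A w"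
proof -
  have s: "padic_scale a (x - y) = padic_scale a x - padic_scale a y" for a and x y :: "'a prufer"
    using padic_scale_add_right[of a "x - y" y] by (simp add: eq_diff_eq)
  show ?thesis by (rule eq_vecI) (use assms in \<open>auto simp: mat_act_def s sum_subtractf\<close>)
qed

lemma torsion_mono: "m \<le> l \<Longrightarrow> torsion m k \<subseteq> torsion l k"
proof (rule subsetI)
  fix v :: "'a prufer vec" assume "m \<le> l" "v \<in> torsion m k"
  moreover have "unif ^ l = (unif ^ (l - m) * unif ^ m :: 'a padic_int)"
    using \<open>m \<le> l\<close> by (simp flip: power_add)
  ultimately show "v \<in> torsion l k" by (simp add: torsion_def padic_scale_mult)
qed

lemma torsion_exhaust:
  assumes "v \<in> carrier_vec k"
  obtains m where "v \<in> torsion m k"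
  using assms
proof (induction k arbitrary: v thesis)
  case 0
  then show ?case by (auto simp: torsion_def)
next
  case (Suc k)
  obtain c x where v: "v = vCons c x" "x \<in> carrier_vec k" using Suc.prems(2) by (cases v) auto
  obtain m where m: "x \<in> torsion m k" using Suc.IH v(2) by blast
  obtain l a where c: "c = pf l a" by (cases c rule: prufer_cases)
  have "padic_scale (unif ^ (l + m)) c = 0" by (simp add: c scale_pf pf_eq_0_iff power_add)
  moreover have "x \<in> torsion (l + m) k" using m torsion_mono[of m "l + m" k] by auto
  ultimately have "v \<in> torsion (l + m) (Suc k)" by (auto simp: torsion_Suc v)
  then show ?case by (rule Suc.prems)
qed

section \<open>Preimages of finite subgroups\<close>

definition pull :: "nat \<Rightarrow> 'p::prime_card padic_int mat \<Rightarrow> 'p prufer vec set \<Rightarrow> 'p prufer vec set" where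
  "pull k A H = {v \<in> carrier_vec k. mat_act A v \<in> H}"

abbreviation kern :: "nat \<Rightarrow> 'p::prime_card padic_int mat \<Rightarrow> 'p prufer vec set" where
  "kern k A \<equiv> pull k A {0\<^sub>v k}"

text \<open>Preimages reverse products, and so does transposition; in \<open>phi_lmul\<close> the
  two reversals cancel and leave a left action.\<close>

lemma pull_mult:
  assumes "A \<in> carrier_mat k k" "B \<in> carrier_mat k k"
  shows "pull k (A * B) H = pull k B (pull k A H)"
  using assms by (auto simp: pull_def mat_act_mult[of _ k k _ k])

lemma pull_one: "H \<subseteq> carrier_vec k \<Longrightarrow> pull k (1\<^sub>m k) H = H"
  by (auto simp: pull_def)

definition fsub :: "nat \<Rightarrow> 'p::prime_card prufer vec set \<Rightarrow> bool" where
  "fsub k H \<longleftrightarrow> finite H \<and> H \<subseteq> carrier_vec k \<and> 0\<^sub>v k \<in> H \<and> (\<forall>x\<in>H. \<forall>y\<in>H. x - y \<in> H)"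

lemma fsub_uminus: "fsub k H \<Longrightarrow> x \<in> H \<Longrightarrow> - x \<in> H"
proof -
  assume H: "fsub k H" "x \<in> H"
  then have "0\<^sub>v k - x \<in> H" and "x \<in> carrier_vec k" by (auto simp: fsub_def)
  moreover have "0\<^sub>v k - x = - x" using \<open>x \<in> carrier_vec k\<close> by auto
  ultimately show ?thesis by simp
qed

lemma fsub_add: "fsub k H \<Longrightarrow> x \<in> H \<Longrightarrow> y \<in> H \<Longrightarrow> x + y \<in> H"
proof -
  assume H: "fsub k H" "x \<in> H" "y \<in> H"
  then have "x - (- y) \<in> H" using fsub_uminus[OF H(1,3)] by (auto simp: fsub_def)
  moreover have "x \<in> carrier_vec k" "y \<in> carrier_vec k" using H by (auto simp: fsub_def)
  then have "x - (- y) = x + y" by (intro eq_vecI) auto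
  ultimately show ?thesis by simp
qed

lemma fsub_torsion_bound:
  assumes "fsub k H"
  obtains m where "H \<subseteq> torsion m k"
proof -
  have "\<forall>v\<in>H. \<exists>m. v \<in> torsion m k" using assms torsion_exhaust by (metis fsub_def subsetD)
  then obtain f where f: "\<And>v. v \<in> H \<Longrightarrow> v \<in> torsion (f v) k" by metis
  have "finite (f ` H)" using assms by (simp add: fsub_def)
  then have "v \<in> torsion (Max (f ` H)) k" if "v \<in> H" for v
    using f[OF that] torsion_mono[of "f v" "Max (f ` H)" k] that by auto
  then show ?thesis using that by blast
qed

text \<open>If A' A = p^l, then p^(l+m) v = A' (p^m A v). This bound is what makes preimages of
  finite subgroups finite.\<close>

lemma pull_torsion:
  assumes A: "A \<in> Delta k"
  obtains l where "\<And>m. pull k A (torsion m k) \<subseteq> torsion (l + m) k"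
proof -
  obtain A' l where A': "A' \<in> carrier_mat k k" "A' * A = unif ^ l \<cdot>\<^sub>m 1\<^sub>m k"
    using Delta_quasi_inverse[OF A] by metis
  note Ac = Delta_carrier[OF A]
  have "pull k A (torsion m k) \<subseteq> torsion (l + m) k" for m
  proof
    fix v assume "v \<in> pull k A (torsion m k)"
    then have v: "v \<in> carrier_vec k" "mat_act A v \<in> torsion m k" by (auto simp: pull_def)
    have "unif ^ (l + m) \<cdot>\<^sub>m 1\<^sub>m k = (unif ^ m \<cdot>\<^sub>m A') * A"
      using A' Ac by (simp add: mult_smult_assoc_mat[of _ k k _ k] smult_smult_mat power_add mult.commute)
    then have "mat_act (unif ^ (l + m) \<cdot>\<^sub>m 1\<^sub>m k) v = mat_act (unif ^ m \<cdot>\<^sub>m A') (mat_act A v)"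
      using A' Ac v by (simp add: mat_act_mult[of _ k k _ k])
    also have "unif ^ m \<cdot>\<^sub>m A' = A' * (unif ^ m \<cdot>\<^sub>m 1\<^sub>m k)"
      using A' by (simp add: mult_smult_distrib[of _ k k _ k])
    also have "mat_act \<dots> (mat_act A v) = mat_act A' (0\<^sub>v k)"
      using A' Ac v torsion_iff_mat_act[of "mat_act A v" k m] by (simp add: mat_act_mult[of _ k k _ k])
    also have "\<dots> = 0\<^sub>v k" using A' by simp
    finally show "v \<in> torsion (l + m) k" using v by (simp add: torsion_iff_mat_act)
  qed
  then show ?thesis by (rule that)
qed

lemma fsub_pull:
  assumes A: "A \<in> Delta k" and H: "fsub k H"
  shows "fsub k (pull k A H)"
proof -
  obtain m where "H \<subseteq> torsion m k" using fsub_torsion_bound[OF H] .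
  moreover obtain l where "pull k A (torsion m k) \<subseteq> torsion (l + m) k" using pull_torsion[OF A] by metis
  ultimately have "pull k A H \<subseteq> torsion (l + m) k" by (auto simp: pull_def)
  then have "finite (pull k A H)" using torsion_finite_card finite_subset by blast
  then show ?thesis using H Delta_carrier[OF A]
    by (auto simp: fsub_def pull_def mat_act_diff[of _ k])
qed

lemma fsub_zero: "fsub k {0\<^sub>v k}"
  by (auto simp: fsub_def)

lemma mat_act_of_nat_0: "v \<in> carrier_vec k \<Longrightarrow> mat_act (of_nat 0 \<cdot>\<^sub>m 1\<^sub>m k) v = 0\<^sub>v k"
  by (intro eq_vecI) (simp_all add: mat_act_smult_one del: index_smult_mat, simp add: mat_act_def)

lemma mat_act_of_nat_Suc:
  assumes "v \<in> carrier_vec k"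
  shows "mat_act (of_nat (Suc n) \<cdot>\<^sub>m 1\<^sub>m k) v = v + mat_act (of_nat n \<cdot>\<^sub>m 1\<^sub>m k) v"
proof (rule eq_vecI)
  have c: "mat_act (of_nat n \<cdot>\<^sub>m 1\<^sub>m k) v \<in> carrier_vec k" by (auto simp: mat_act_def)
  fix i assume "i < dim_vec (v + mat_act (of_nat n \<cdot>\<^sub>m 1\<^sub>m k) v)"
  then have i: "i < k" using c by simp
  then have "mat_act (of_nat (Suc n) \<cdot>\<^sub>m 1\<^sub>m k) v $ i = padic_scale (of_nat (Suc n)) (v $ i)"
    using assms by (simp only: mat_act_smult_one)
  also have "\<dots> = (v + mat_act (of_nat n \<cdot>\<^sub>m 1\<^sub>m k) v) $ i"
    using i c assms by (simp add: mat_act_smult_one padic_scale_add_left)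
  finally show "mat_act (of_nat (Suc n) \<cdot>\<^sub>m 1\<^sub>m k) v $ i = (v + mat_act (of_nat n \<cdot>\<^sub>m 1\<^sub>m k) v) $ i" .
qed (auto simp: mat_act_def)

section \<open>Finite subgroups of powers of the Pruefer group\<close>

lemma carrier_vec_0: "x \<in> carrier_vec 0 \<Longrightarrow> x = 0\<^sub>v 0"
  by (metis carrier_vecD dim_vec_vCons nat.distinct(1) vec_cases zero_vec_zero)

lemma vCons_add: "dim_vec v = dim_vec w \<Longrightarrow> vCons a v + vCons b w = vCons (a + b) (v + w)"
  and vCons_diff: "dim_vec v = dim_vec w \<Longrightarrow> vCons a v - vCons b w = vCons (a - b) (v - w)"
  by (rule eq_vecI; auto simp: vec_index_vCons)+

lemma mat_act_vCons_zero:
  assumes "A \<in> carrier_mat (Suc k) (Suc k)"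
  shows "mat_act A (vCons c (0\<^sub>v k)) = vec (Suc k) (\<lambda>i. padic_scale (A $$ (i, 0)) c)"
  by (rule eq_vecI)
     (use assms in \<open>auto simp: mat_act_def sum.lessThan_Suc_shift simp del: sum.lessThan_Suc\<close>)

text \<open>Write v = a / p^e. By minimality of \<open>e\<close> some entry of \<open>a\<close> is a
  unit, so \<open>a\<close> is the first column of a matrix in \<open>Gamma (Suc k)\<close>. For e =
  0 minimality says nothing, but then both vectors are zero.\<close>

lemma torsion_vec_normal_form:
  assumes v: "v \<in> torsion e (Suc k)" and min: "\<And>m. v \<in> torsion m (Suc k) \<Longrightarrow> e \<le> m"
  obtains g where "g \<in> Gamma (Suc k)" "mat_act g (vCons (pf e 1) (0\<^sub>v k)) = v"
proof (cases e)
  case 0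
  have "v = 0\<^sub>v (Suc k)" using v by (intro eq_vecI) (auto simp: torsion_def 0)
  moreover have "vCons (pf e 1) (0\<^sub>v k) = 0\<^sub>v (Suc k)"
    using pf_eq_0_iff[of 0 1] by (simp add: 0 zero_vec_Suc)
  ultimately have "mat_act (1\<^sub>m (Suc k)) (vCons (pf e 1) (0\<^sub>v k)) = v" by simp
  then show ?thesis using that one_Gamma by blast
next
  case (Suc d)
  have "\<forall>i<Suc k. \<exists>a. v $ i = pf e a" using v prufer_torsionE by (auto simp: torsion_def) blast
  then obtain a where a: "\<And>i. i < Suc k \<Longrightarrow> v $ i = pf e (a i)" by metis
  have "\<exists>i<Suc k. \<not> unif dvd a i"
  proof (rule ccontr)
    assume "\<not> ?thesis"
    then have "v \<in> torsion d (Suc k)"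
      using v a by (auto simp: torsion_def Suc scale_pf pf_eq_0_iff mult.commute intro: mult_dvd_mono)
    then show False using min[of d] Suc by simp
  qed
  then obtain i where i: "i < Suc k" "vec (Suc k) a $ i dvd 1" by (auto simp: padic_int_unit_iff)
  obtain g where g: "g \<in> Gamma (Suc k)" "col g 0 = vec (Suc k) a"
    using primitive_completion[OF _ i] by auto
  have "g $$ (j, 0) = a j" if "j < Suc k" for j
  proof -
    have "col g 0 $ j = a j" unfolding g(2) using that by simp
    then show ?thesis using that Gamma_carrier[OF g(1)] by auto
  qed
  then have "mat_act g (vCons (pf e 1) (0\<^sub>v k)) = v"
    unfolding mat_act_vCons_zero[OF Gamma_carrier[OF g(1)]]
    using v a by (intro eq_vecI) (auto simp: scale_pf torsion_def)
  then show ?thesis using that g by blast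
qed

section \<open>Splitting off a cyclic subgroup of maximal order\<close>

definition psum :: "nat \<Rightarrow> 'p::prime_card prufer vec set \<Rightarrow> 'p prufer vec set" where
  "psum e H = (\<lambda>(c, x). vCons c x) ` ({c. padic_scale (unif ^ e) c = 0} \<times> H)"

text \<open>Models the intersection with V when \<mu> is the first coordinate, with the vanishing
  coordinate dropped so that the result lies in Lambda^n.\<close>

definition slice :: "nat \<Rightarrow> 'p::prime_card prufer vec set \<Rightarrow> 'p prufer vec set" where
  "slice n H = {x \<in> carrier_vec n. vCons 0 x \<in> H}"

lemma slice_fsub:
  assumes H: "fsub (Suc n) H" shows "fsub n (slice n H)"
proof -
  have "inj (vCons (0 :: 'a prufer))" by (auto simp: inj_on_def)
  then have "finite (vCons 0 -` H)" using H by (auto simp: fsub_def intro: finite_vimageI)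
  then have "finite (slice n H)" by (rule rev_finite_subset) (auto simp: slice_def)
  show ?thesis unfolding fsub_def
  proof (intro conjI ballI)
    show "0\<^sub>v n \<in> slice n H" using H by (auto simp: slice_def fsub_def zero_vec_Suc)
    fix x y assume "x \<in> slice n H" "y \<in> slice n H"
    then have "vCons 0 x - vCons 0 y \<in> H" "x \<in> carrier_vec n" "y \<in> carrier_vec n"
      using H by (auto simp: slice_def fsub_def)
    then show "x - y \<in> slice n H" by (auto simp: slice_def vCons_diff)
  qed (use \<open>finite (slice n H)\<close> in \<open>auto simp: slice_def\<close>)
qed

text \<open>H has exponent p^e, so the first coordinate of each of its elements is a multiple of 1 /
  p^e. Subtracting that multiple of the given generator leaves an element of H with first coordinate
  0.\<close>

lemma fsub_split:
  assumes H: "fsub (Suc k) H" "H \<subseteq> torsion e (Suc k)" and v: "vCons (pf e 1) (0\<^sub>v k) \<in> H"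
  obtains H' where "fsub k H'" "H = psum e H'"
proof -
  let ?H' = "slice k H"
  have "vCons (pf e (of_nat i)) (0\<^sub>v k) \<in> H" for i
  proof (induction i)
    case 0
    then show ?case using H by (simp add: fsub_def zero_vec_Suc)
  next
    case (Suc i)
    then show ?case using fsub_add[OF H(1) v Suc] by (simp add: vCons_add pf_add)
  qed
  then have line: "vCons c (0\<^sub>v k) \<in> H" if "padic_scale (unif ^ e) c = 0" for c
    using that prufer_torsionE pf_mod by metis
  have "fsub k ?H'" by (rule slice_fsub[OF H(1)])
  moreover have "H = psum e ?H'"
  proof (intro subset_antisym subsetI)
    fix v assume vH: "v \<in> H"
    then have "v \<in> torsion e (Suc k)" using H by blast
    then obtain c x where cx: "v = vCons c x" "padic_scale (unif ^ e) c = 0" "x \<in> torsion e k"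
      by (auto simp: torsion_Suc)
    then have x: "x \<in> carrier_vec k" by (simp add: torsion_def)
    have "v - vCons c (0\<^sub>v k) \<in> H" using H(1) vH line[OF cx(2)] by (auto simp: fsub_def)
    moreover have "v - vCons c (0\<^sub>v k) = vCons 0 x" using x by (auto simp: cx vCons_diff)
    ultimately show "v \<in> psum e ?H'" using cx x by (auto simp: psum_def slice_def)
  next
    fix v assume "v \<in> psum e ?H'"
    then obtain c x where cx: "v = vCons c x" "padic_scale (unif ^ e) c = 0" "x \<in> ?H'"
      by (auto simp: psum_def)
    then have "x \<in> carrier_vec k" by (simp add: slice_def)
    then have "vCons c (0\<^sub>v k) + vCons 0 x = v" by (simp add: cx vCons_add)
    moreover have "vCons 0 x \<in> H" using cx by (simp add: slice_def)
    ultimately show "v \<in> H" using fsub_add[OF H(1) line[OF cx(2)]] by metis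
  qed
  ultimately show ?thesis by (rule that)
qed

lemma fsub_max_order:
  assumes H: "fsub k H"
  obtains v e where "v \<in> H" "H \<subseteq> torsion e k" "\<And>m. v \<in> torsion m k \<Longrightarrow> e \<le> m"
proof -
  have "\<exists>e. H \<subseteq> torsion e k" using fsub_torsion_bound[OF H] by metis
  then obtain e where e: "H \<subseteq> torsion e k" "\<And>l. l < e \<Longrightarrow> \<not> H \<subseteq> torsion l k"
    using exists_least_iff[of "\<lambda>e. H \<subseteq> torsion e k"] by blast
  show ?thesis
  proof (cases e)
    case 0
    then show ?thesis using that[of "0\<^sub>v k" 0] e H by (auto simp: fsub_def)
  next
    case (Suc d)
    then obtain v where v: "v \<in> H" "v \<notin> torsion d k" using e(2)[of d] by auto
    have "e \<le> m" if "v \<in> torsion m k" for m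
      using torsion_mono[of m d k] that v Suc by (metis not_less_eq_eq subsetD)
    then show ?thesis using that v e(1) by blast
  qed
qed

lemma pull_Gamma_inverse:
  assumes "g * h = 1\<^sub>m k" "g \<in> carrier_mat k k" "h \<in> carrier_mat k k" "H \<subseteq> carrier_vec k"
  shows "pull k h (pull k g H) = H"
  using assms by (simp add: pull_mult[symmetric] pull_one)

text \<open>The matrix moves an element of maximal order to the first axis, where
  \<open>fsub_split\<close> applies. That \<open>g\<close> sends the standard generator back to
  \<open>v\<close> is recorded because \<open>fsub_homogeneous\<close> has to match the generators
  of two subgroups.\<close>

lemma fsub_normal_form:
  assumes H: "fsub (Suc k) H" and v: "v \<in> H" "H \<subseteq> torsion e (Suc k)" "\<And>m. v \<in> torsion m (Suc k) \<Longrightarrow> e \<le> m"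
  obtains g H' where "g \<in> Gamma (Suc k)" "fsub k H'" "pull (Suc k) g H = psum e H'"
    "mat_act g (vCons (pf e 1) (0\<^sub>v k)) = v"
proof -
  have "v \<in> torsion e (Suc k)" using v by blast
  then obtain g where g: "g \<in> Gamma (Suc k)" "mat_act g (vCons (pf e 1) (0\<^sub>v k)) = v"
    using torsion_vec_normal_form v(3) by blast
  have fs: "fsub (Suc k) (pull (Suc k) g H)" by (rule fsub_pull[OF Gamma_Delta[OF g(1)] H])
  have "pull (Suc k) g H \<subseteq> torsion e (Suc k)"
  proof
    fix x assume "x \<in> pull (Suc k) g H"
    then have x: "x \<in> carrier_vec (Suc k)" "mat_act g x \<in> torsion e (Suc k)" using v by (auto simp: pull_def)
    obtain h where h: "h \<in> Gamma (Suc k)" "g * h = 1\<^sub>m (Suc k)" "h * g = 1\<^sub>m (Suc k)"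
      using Gamma_inverse[OF g(1)] .
    note c = Gamma_carrier[OF h(1)] Gamma_carrier[OF g(1)]
    let ?P = "unif ^ e \<cdot>\<^sub>m 1\<^sub>m (Suc k) :: 'a padic_int mat"
    \<comment> \<open>The scalar p^e commutes with \<open>h\<close> and \<open>g\<close>, so
      invertible matrices do not change the exponent.\<close>
    have "mat_act ?P x = mat_act (?P * (h * g)) x" by (simp add: h)
    also have "?P * (h * g) = h * ?P * g"
      using c by (simp add: mult_smult_distrib[of _ "Suc k" "Suc k" _ "Suc k"] mult_smult_assoc_mat[of _ "Suc k" "Suc k" _ "Suc k"])
    also have "mat_act \<dots> x = mat_act h (mat_act ?P (mat_act g x))"
      using c x(1) by (simp add: mat_act_mult[of _ "Suc k" "Suc k" _ "Suc k"])
    also have "mat_act ?P (mat_act g x) = 0\<^sub>v (Suc k)"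
      using x(2) c torsion_iff_mat_act[of "mat_act g x" "Suc k" e] by simp
    also have "mat_act h \<dots> = 0\<^sub>v (Suc k)" using c by simp
    finally show "x \<in> torsion e (Suc k)" using torsion_iff_mat_act[OF x(1)] by simp
  qed
  moreover have "vCons (pf e 1) (0\<^sub>v k) \<in> pull (Suc k) g H" using g v by (simp add: pull_def)
  ultimately obtain H' where "fsub k H'" "pull (Suc k) g H = psum e H'"
    using fsub_split[OF fs] by metis
  then show ?thesis using that g by blast
qed

lemma pull_dsum_psum:
  assumes "g \<in> carrier_mat k k" "H \<subseteq> carrier_vec k"
  shows "pull (Suc k) (dsum 1 g) (psum e H) = psum e (pull k g H)"
proof (intro subset_antisym subsetI)
  fix v assume "v \<in> pull (Suc k) (dsum 1 g) (psum e H)"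
  then have "v \<in> carrier_vec (Suc k)" and vH: "mat_act (dsum 1 g) v \<in> psum e H" by (auto simp: pull_def)
  then obtain c x where v: "v = vCons c x" "x \<in> carrier_vec k" by (cases v) auto
  then show "v \<in> psum e (pull k g H)"
    using vH mat_act_dsum[OF assms(1) v(2), of 1 c] by (auto simp: psum_def pull_def)
next
  fix v assume "v \<in> psum e (pull k g H)"
  then obtain c x where v: "v = vCons c x" "padic_scale (unif ^ e) c = 0" "x \<in> carrier_vec k" "mat_act g x \<in> H"
    by (auto simp: psum_def pull_def)
  then show "v \<in> pull (Suc k) (dsum 1 g) (psum e H)"
    using mat_act_dsum[OF assms(1) v(3), of 1 c] by (auto simp: psum_def pull_def)
qed

lemma pull_dsum_zero:
  assumes "D \<in> carrier_mat k k"
  shows "kern (Suc k) (dsum (unif ^ e) D) = psum e (kern k D)"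
proof (intro subset_antisym subsetI)
  fix v assume "v \<in> kern (Suc k) (dsum (unif ^ e) D)"
  then have "v \<in> carrier_vec (Suc k)" and vH: "mat_act (dsum (unif ^ e) D) v = 0\<^sub>v (Suc k)" by (auto simp: pull_def)
  then obtain c x where v: "v = vCons c x" "x \<in> carrier_vec k" by (cases v) auto
  then show "v \<in> psum e (kern k D)"
    using vH mat_act_dsum[OF assms v(2), of "unif ^ e" c] by (auto simp: psum_def pull_def zero_vec_Suc)
next
  fix v assume "v \<in> psum e (kern k D)"
  then obtain c x where v: "v = vCons c x" "padic_scale (unif ^ e) c = 0" "x \<in> carrier_vec k" "mat_act D x = 0\<^sub>v k"
    by (auto simp: psum_def pull_def)
  then show "v \<in> kern (Suc k) (dsum (unif ^ e) D)"
    using mat_act_dsum[OF assms v(3), of "unif ^ e" c] by (auto simp: pull_def zero_vec_Suc)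
qed

lemma dsum_Gamma: "g \<in> Gamma k \<Longrightarrow> dsum 1 g \<in> Gamma (Suc k)"
  by (auto simp: Gamma_iff det_dsum dsum_carrier)

lemma dsum_Delta: "a \<noteq> 0 \<Longrightarrow> D \<in> Delta k \<Longrightarrow> dsum a D \<in> Delta (Suc k)"
  by (auto simp: Delta_iff det_dsum dsum_carrier)

lemma card_psum:
  fixes H :: "'p::prime_card prufer vec set"
  shows "card (psum e H) = CARD('p) ^ e * card H"
proof -
  have "inj_on (\<lambda>(c, x). vCons c x) ({c :: 'p prufer. padic_scale (unif ^ e) c = 0} \<times> H)"
    by (auto simp: inj_on_def)
  then show ?thesis
    by (simp add: psum_def card_image card_cartesian_product prufer_torsion_card)
qed

lemma pull_image:
  assumes "g * h = 1\<^sub>m k" "h * g = 1\<^sub>m k" "g \<in> carrier_mat k k" "h \<in> carrier_mat k k" "H \<subseteq> carrier_vec k"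
  shows "bij_betw (mat_act g) (pull k g H) H"
proof (rule bij_betwI[where g = "mat_act h"])
  show "mat_act g \<in> pull k g H \<rightarrow> H" by (auto simp: pull_def)
  have inv: "mat_act g (mat_act h x) = x" "mat_act h (mat_act g x) = x" if "x \<in> carrier_vec k" for x
    using that assms by (simp_all add: mat_act_mult[of _ k k _ k, symmetric])
  show "mat_act h \<in> H \<rightarrow> pull k g H" using assms inv by (auto simp: pull_def subset_iff)
  show "\<And>x. x \<in> pull k g H \<Longrightarrow> mat_act h (mat_act g x) = x" using inv by (auto simp: pull_def)
  show "\<And>y. y \<in> H \<Longrightarrow> mat_act g (mat_act h y) = y" using inv assms by auto
qed

text \<open>The matrix D built by this induction is diagonal with powers of p as entries, as in the
  elementary divisor theorem. Its symmetry is the property that \<open>kernel_transpose\<close>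
  exploits.\<close>

lemma fsub_symmetric_kernel:
  fixes H :: "'p::prime_card prufer vec set"
  assumes "fsub k H"
  shows "\<exists>g\<in>Gamma k. \<exists>D\<in>Delta k. transpose_mat D = D \<and> pull k g H = kern k D \<and> (\<exists>e. card H = CARD('p) ^ e)"
  using assms
proof (induction k arbitrary: H)
  case 0
  have "H = {0\<^sub>v 0}" using 0 carrier_vec_0 by (auto simp: fsub_def simp del: zero_vec_zero)
  moreover have "pull 0 (1\<^sub>m 0) H = kern 0 (1\<^sub>m 0)" using calculation by simp
  moreover have "card H = CARD('p) ^ 0" using calculation by simp
  ultimately show ?case
    using one_Gamma[of 0] Gamma_Delta[OF one_Gamma[of 0]] by (metis transpose_one)
next
  case (Suc k)
  obtain v e where v: "v \<in> H" "H \<subseteq> torsion e (Suc k)" "\<And>m. v \<in> torsion m (Suc k) \<Longrightarrow> e \<le> m"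
    using fsub_max_order[OF Suc.prems] by metis
  obtain g H' where g: "g \<in> Gamma (Suc k)" "fsub k H'" "pull (Suc k) g H = psum e H'"
    using fsub_normal_form[OF Suc.prems v] by metis
  obtain g' D c where IH: "g' \<in> Gamma k" "D \<in> Delta k" "transpose_mat D = D" "pull k g' H' = kern k D"
    "card H' = CARD('p) ^ c"
    using Suc.IH[OF g(2)] by metis
  have cg: "g \<in> carrier_mat (Suc k) (Suc k)" "dsum 1 g' \<in> carrier_mat (Suc k) (Suc k)"
    using g IH dsum_Gamma Gamma_carrier by blast+
  have "pull (Suc k) (g * dsum 1 g') H = kern (Suc k) (dsum (unif ^ e) D)"
    using g IH pull_mult[OF cg] pull_dsum_psum[of g' k H' e] pull_dsum_zero[of D k e]
    by (auto simp: fsub_def Gamma_carrier Delta_carrier)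
  moreover have "card H = CARD('p) ^ (e + c)"
  proof -
    obtain h where h: "h \<in> Gamma (Suc k)" "g * h = 1\<^sub>m (Suc k)" "h * g = 1\<^sub>m (Suc k)"
      using Gamma_inverse[OF g(1)] .
    have "card H = card (pull (Suc k) g H)"
      using pull_image[OF h(2,3) cg(1) Gamma_carrier[OF h(1)], of H] Suc.prems
      by (auto simp: fsub_def dest: bij_betw_same_card)
    then show ?thesis by (simp add: g card_psum IH power_add)
  qed
  moreover have "transpose_mat (dsum (unif ^ e) D) = dsum (unif ^ e) D" by (simp add: transpose_dsum IH)
  ultimately show ?case
    using Gamma_mult[OF g(1) dsum_Gamma[OF IH(1)]] dsum_Delta[OF _ IH(2), of "unif ^ e"] by auto
qed

section \<open>Isomorphic finite subgroups are conjugate\<close>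

definition add_iso :: "'a::plus set \<Rightarrow> 'b::plus set \<Rightarrow> bool" where
  "add_iso H K \<longleftrightarrow> (\<exists>f. bij_betw f H K \<and> (\<forall>x\<in>H. \<forall>y\<in>H. f (x + y) = f x + f y))"

lemma additive_zero:
  fixes H K :: "'p::prime_card prufer vec set"
  assumes "fsub k H" "fsub l K" "f \<in> H \<rightarrow> K" "\<forall>x\<in>H. \<forall>y\<in>H. f (x + y) = f x + f y"
  shows "f (0\<^sub>v k) = 0\<^sub>v l"
proof -
  have "f (0\<^sub>v k) = f (0\<^sub>v k) + f (0\<^sub>v k)"
    using assms by (metis fsub_def right_zero_vec zero_carrier_vec)
  moreover have "f (0\<^sub>v k) \<in> carrier_vec l" using assms by (auto simp: fsub_def)
  ultimately show ?thesis
    by (intro eq_vecI) (metis add_cancel_left_left carrier_vecD index_add_vec(1) index_zero_vec, auto)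
qed

lemma additive_of_nat:
  fixes H K :: "'p::prime_card prufer vec set"
  assumes H: "fsub k H" and K: "fsub l K" and f: "f \<in> H \<rightarrow> K" "\<forall>x\<in>H. \<forall>y\<in>H. f (x + y) = f x + f y" and x: "x \<in> H"
  shows "mat_act (of_nat n \<cdot>\<^sub>m 1\<^sub>m k) x \<in> H \<and> f (mat_act (of_nat n \<cdot>\<^sub>m 1\<^sub>m k) x) = mat_act (of_nat n \<cdot>\<^sub>m 1\<^sub>m l) (f x)"
proof (induction n)
  case 0
  have "x \<in> carrier_vec k" "f x \<in> carrier_vec l" "0\<^sub>v k \<in> H" using H K f(1) x by (auto simp: fsub_def)
  then show ?case using additive_zero[OF H K f] by (simp only: mat_act_of_nat_0)
next
  case (Suc n)
  have "x \<in> carrier_vec k" "f x \<in> carrier_vec l" using H K f(1) x by (auto simp: fsub_def)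
  then show ?case
    unfolding mat_act_of_nat_Suc[OF \<open>x \<in> carrier_vec k\<close>] mat_act_of_nat_Suc[OF \<open>f x \<in> carrier_vec l\<close>]
    using Suc fsub_add[OF H x] f(2) x by auto
qed

lemma additive_torsion_iff:
  fixes H K :: "'p::prime_card prufer vec set"
  assumes H: "fsub k H" and K: "fsub l K" and f: "bij_betw f H K" "\<forall>x\<in>H. \<forall>y\<in>H. f (x + y) = f x + f y" and x: "x \<in> H"
  shows "x \<in> torsion m k \<longleftrightarrow> f x \<in> torsion m l"
proof -
  have Pi: "f \<in> H \<rightarrow> K" using f(1) by (auto simp: bij_betw_def)
  then have c: "x \<in> carrier_vec k" "f x \<in> carrier_vec l" using x H K by (auto simp: fsub_def)
  have u: "unif ^ m = (of_nat (CARD('p) ^ m) :: 'p padic_int)" by (simp add: unif_def)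
  note n = additive_of_nat[OF H K Pi f(2) x, of "CARD('p) ^ m"]
  have "x \<in> torsion m k \<longleftrightarrow> mat_act (of_nat (CARD('p) ^ m) \<cdot>\<^sub>m 1\<^sub>m k) x = 0\<^sub>v k"
    using torsion_iff_mat_act[OF c(1)] u by simp
  also have "\<dots> \<longleftrightarrow> f (mat_act (of_nat (CARD('p) ^ m) \<cdot>\<^sub>m 1\<^sub>m k) x) = f (0\<^sub>v k)"
  proof -
    have "0\<^sub>v k \<in> H" "inj_on f H" using H f(1) by (simp_all add: fsub_def bij_betw_def)
    then show ?thesis using n inj_on_eq_iff[of f H] by metis
  qed
  also have "\<dots> \<longleftrightarrow> f x \<in> torsion m l"
    using n additive_zero[OF H K Pi f(2)] torsion_iff_mat_act[OF c(2)] u by simp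
  finally show ?thesis .
qed

lemma bij_betw_additive_inv:
  assumes f: "bij_betw f H K" "\<forall>x\<in>H. \<forall>y\<in>H. f (x + y) = f x + f y" and H: "\<forall>x\<in>H. \<forall>y\<in>H. x + y \<in> H"
  shows "\<forall>x\<in>K. \<forall>y\<in>K. inv_into H f (x + y) = inv_into H f x + inv_into H f y"
proof (intro ballI)
  fix x y assume xy: "x \<in> K" "y \<in> K"
  have i: "inv_into H f z \<in> H" "f (inv_into H f z) = z" if "z \<in> K" for z
    using f(1) that by (auto simp: bij_betw_def inv_into_into f_inv_into_f)
  have "f (inv_into H f x + inv_into H f y) = x + y" using xy i f(2) by simp
  moreover have "inv_into H f x + inv_into H f y \<in> H" using H i xy by blast
  ultimately show "inv_into H f (x + y) = inv_into H f x + inv_into H f y"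
    using f(1) by (metis bij_betw_inv_into_left)
qed

text \<open>A complement of a cyclic summand generated by \<open>vCons c 0\<close> is only unique up to shearing,
  so the isomorphism is projected to the last coordinates.\<close>

lemma psum_cancel:
  fixes H K :: "'p::prime_card prufer vec set"
  assumes H: "fsub k H" and K: "fsub k K" and F: "bij_betw F (psum e H) (psum e K)"
    "\<forall>x\<in>psum e H. \<forall>y\<in>psum e H. F (x + y) = F x + F y"
    and fix1: "F (vCons (pf e 1) (0\<^sub>v k)) = vCons (pf e 1) (0\<^sub>v k)"
  shows "add_iso H K"
proof -
  have mem: "vCons c x \<in> psum e L \<longleftrightarrow> padic_scale (unif ^ e) c = 0 \<and> x \<in> L" for c x L
    by (auto simp: psum_def)
  have H0: "0\<^sub>v k \<in> H" and Hc: "H \<subseteq> carrier_vec k" and Kc: "K \<subseteq> carrier_vec k" using H K by (auto simp: fsub_def)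
  have t1: "padic_scale (unif ^ e) (pf e a) = 0" for a :: "'p padic_int" by (simp add: scale_pf pf_eq_0_iff)
  have FK: "F v \<in> psum e K" if "v \<in> psum e H" for v using F(1) that by (auto simp: bij_betw_def)
  have z: "F (vCons 0 (0\<^sub>v k)) = vCons 0 (0\<^sub>v k)"
  proof -
    have m0: "vCons 0 (0\<^sub>v k) \<in> psum e H" using H0 by (simp add: mem)
    have "F (vCons 0 (0\<^sub>v k) + vCons 0 (0\<^sub>v k)) = F (vCons 0 (0\<^sub>v k)) + F (vCons 0 (0\<^sub>v k))"
      using F(2) m0 by blast
    moreover obtain a y where ay: "F (vCons 0 (0\<^sub>v k)) = vCons a y" "y \<in> carrier_vec k"
      using FK[OF m0] Kc by (auto simp: psum_def)
    ultimately have "a = a + a" "y = y + y" by (simp_all add: vCons_add)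
    then have "a = 0" "y = 0\<^sub>v k"
      using ay(2) by (simp, intro eq_vecI) (metis add_cancel_left_left carrier_vecD index_add_vec(1) index_zero_vec, auto)
    then show ?thesis using ay by simp
  qed
  have "F (vCons (pf e (of_nat i)) (0\<^sub>v k)) = vCons (pf e (of_nat i)) (0\<^sub>v k)" for i
  proof (induction i)
    case (Suc i)
    have "F (vCons (pf e 1) (0\<^sub>v k) + vCons (pf e (of_nat i)) (0\<^sub>v k)) =
        F (vCons (pf e 1) (0\<^sub>v k)) + F (vCons (pf e (of_nat i)) (0\<^sub>v k))"
      using F(2) H0 by (simp add: mem t1)
    then show ?case using fix1 Suc by (simp add: vCons_add pf_add)
  qed (simp add: z)
  then have line: "F (vCons c (0\<^sub>v k)) = vCons c (0\<^sub>v k)" if "padic_scale (unif ^ e) c = 0" for c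
    using that prufer_torsionE pf_mod by metis
  have "\<exists>d y. F (vCons 0 x) = vCons d y \<and> padic_scale (unif ^ e) d = 0 \<and> y \<in> K" if "x \<in> H" for x
    using FK[of "vCons 0 x"] that by (auto simp: mem) (auto simp: psum_def)
  then obtain d f where df: "\<And>x. x \<in> H \<Longrightarrow> F (vCons 0 x) = vCons (d x) (f x)"
    "\<And>x. x \<in> H \<Longrightarrow> padic_scale (unif ^ e) (d x) = 0" "\<And>x. x \<in> H \<Longrightarrow> f x \<in> K"
    by metis
  \<comment> \<open>Since F fixes the cyclic summand pointwise, it is block triangular:
    \<open>f\<close> on the complement, combined with a translation by \<open>d x\<close> in the
    first coordinate.\<close>
  have shear: "F (vCons c x) = vCons (c + d x) (f x)" if "padic_scale (unif ^ e) c = 0" "x \<in> H" for c x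
  proof -
    have xc: "x \<in> carrier_vec k" "f x \<in> carrier_vec k" using that df(3) Hc Kc by auto
    have "F (vCons c (0\<^sub>v k) + vCons 0 x) = F (vCons c (0\<^sub>v k)) + F (vCons 0 x)"
      using F(2) H0 that by (simp add: mem)
    then show ?thesis using xc that by (simp add: vCons_add line df)
  qed
  have Hadd: "x + y \<in> H" if "x \<in> H" "y \<in> H" for x y using fsub_add[OF H] that by blast
  have "inj_on f H"
  proof (rule inj_onI)
    fix x y assume xy: "x \<in> H" "y \<in> H" "f x = f y"
    \<comment> \<open>If \<open>f x = f y\<close>, the images of (0, x) and (0, y) differ only in
      the first coordinate. Shifting the preimage of the second by \<open>d x - d y\<close> removes
      the difference, and injectivity of F applies.\<close>
    have t: "padic_scale (unif ^ e) (d x - d y) = 0"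
      using df(2) xy padic_scale_add_right[of "unif ^ e" "d x - d y" "d y"] by simp
    have eq: "F (vCons (d x - d y) y) = F (vCons 0 x)" using shear[OF t xy(2)] df(1)[OF xy(1)] xy(3) by simp
    have "vCons (d x - d y) y \<in> psum e H" "vCons 0 x \<in> psum e H" using t xy by (simp_all only: mem padic_scale_zero_right)
    then have "vCons (d x - d y) y = vCons 0 x"
      by (rule inj_onD[OF bij_betw_imp_inj_on[OF F(1)] eq])
    then show "x = y" by simp
  qed
  moreover have "f ` H = K"
  proof (intro subset_antisym subsetI)
    fix y assume "y \<in> K"
    then have "vCons 0 y \<in> F ` psum e H" using F(1) by (auto simp: bij_betw_def mem)
    then obtain c x where "padic_scale (unif ^ e) c = 0" "x \<in> H" "F (vCons c x) = vCons 0 y"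
      by (auto simp: psum_def)
    then show "y \<in> f ` H" using shear[of c x] by auto
  qed (use df in auto)
  moreover have "\<forall>x\<in>H. \<forall>y\<in>H. f (x + y) = f x + f y"
  proof (intro ballI)
    fix x y assume xy: "x \<in> H" "y \<in> H"
    then have c: "x \<in> carrier_vec k" "y \<in> carrier_vec k" "f x \<in> carrier_vec k" "f y \<in> carrier_vec k"
      using Hc Kc df(3) by auto
    have "F (vCons 0 x + vCons 0 y) = F (vCons 0 x) + F (vCons 0 y)"
      using F(2) xy by (simp add: mem)
    then show "f (x + y) = f x + f y" using c xy df(1) Hadd by (simp add: vCons_add)
  qed
  ultimately show ?thesis unfolding add_iso_def bij_betw_def by blast
qed

text \<open>An isomorphism preserves orders, so \<open>v\<close> and \<open>f v\<close> both have
  maximal order p^e. Both are moved to the same vector on the first axis; the transported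
  isomorphism \<open>?F\<close> fixes it, which is the hypothesis that lets
  \<open>psum_cancel\<close> remove the first summand.\<close>

lemma fsub_homogeneous:
  fixes H K :: "'p::prime_card prufer vec set"
  assumes "fsub k H" "fsub k K" "add_iso H K"
  obtains g where "g \<in> Gamma k" "pull k g K = H"
proof -
  have "\<exists>g\<in>Gamma k. pull k g K = H" using assms
  proof (induction k arbitrary: H K)
    case 0
    have "H = {0\<^sub>v 0}" "K = {0\<^sub>v 0}" using 0 carrier_vec_0 by (auto simp: fsub_def simp del: zero_vec_zero)
    moreover have "pull 0 (1\<^sub>m 0) K = K" using 0 by (intro pull_one) (simp add: fsub_def)
    ultimately show ?case using one_Gamma[of 0] by metis
  next
    case (Suc k)
    note H = Suc.prems(1) and K = Suc.prems(2)
    obtain f where f: "bij_betw f H K" "\<forall>x\<in>H. \<forall>y\<in>H. f (x + y) = f x + f y"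
      using Suc.prems(3) by (auto simp: add_iso_def)
    obtain v e where v: "v \<in> H" "H \<subseteq> torsion e (Suc k)" "\<And>m. v \<in> torsion m (Suc k) \<Longrightarrow> e \<le> m"
      using fsub_max_order[OF H] by metis
    note tor = additive_torsion_iff[OF H K f]
    have w: "f v \<in> K" "K \<subseteq> torsion e (Suc k)" "\<And>m. f v \<in> torsion m (Suc k) \<Longrightarrow> e \<le> m"
      using v tor f(1) by (auto simp: bij_betw_def)
    obtain g1 H' where g1: "g1 \<in> Gamma (Suc k)" "fsub k H'" "pull (Suc k) g1 H = psum e H'"
      "mat_act g1 (vCons (pf e 1) (0\<^sub>v k)) = v" using fsub_normal_form[OF H v] by metis
    obtain g2 K' where g2: "g2 \<in> Gamma (Suc k)" "fsub k K'" "pull (Suc k) g2 K = psum e K'"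
      "mat_act g2 (vCons (pf e 1) (0\<^sub>v k)) = f v" using fsub_normal_form[OF K w] by metis
    obtain h1 where h1: "h1 \<in> Gamma (Suc k)" "g1 * h1 = 1\<^sub>m (Suc k)" "h1 * g1 = 1\<^sub>m (Suc k)"
      using Gamma_inverse[OF g1(1)] .
    obtain h2 where h2: "h2 \<in> Gamma (Suc k)" "g2 * h2 = 1\<^sub>m (Suc k)" "h2 * g2 = 1\<^sub>m (Suc k)"
      using Gamma_inverse[OF g2(1)] .
    note c = Gamma_carrier[OF g1(1)] Gamma_carrier[OF g2(1)] Gamma_carrier[OF h1(1)] Gamma_carrier[OF h2(1)]
    have Hc: "H \<subseteq> carrier_vec (Suc k)" "K \<subseteq> carrier_vec (Suc k)" using H K by (auto simp: fsub_def)
    let ?F = "mat_act h2 \<circ> f \<circ> mat_act g1"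
    have b1: "bij_betw (mat_act g1) (psum e H') H"
      using pull_image[OF h1(2,3) c(1,3) Hc(1)] g1 by simp
    have Kh: "pull (Suc k) h2 (psum e K') = K"
      unfolding g2(3)[symmetric] by (rule pull_Gamma_inverse[OF h2(2) c(2,4) Hc(2)])
    have "psum e K' \<subseteq> carrier_vec (Suc k)" using g2(3) by (auto simp: pull_def)
    then have b2: "bij_betw (mat_act h2) K (psum e K')"
      using pull_image[OF h2(3,2) c(4,2)] Kh by metis
    have F1: "bij_betw ?F (psum e H') (psum e K')"
      using bij_betw_trans[OF bij_betw_trans[OF b1 f(1)] b2] by (simp add: comp_assoc)
    have F2: "\<forall>x\<in>psum e H'. \<forall>y\<in>psum e H'. ?F (x + y) = ?F x + ?F y"
    proof (intro ballI)
      fix x y assume xy: "x \<in> psum e H'" "y \<in> psum e H'"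
      then have xc: "x \<in> carrier_vec (Suc k)" "y \<in> carrier_vec (Suc k)" "mat_act g1 x \<in> H" "mat_act g1 y \<in> H"
        using g1(3) by (auto simp: pull_def)
      then have "f (mat_act g1 (x + y)) = f (mat_act g1 x) + f (mat_act g1 y)"
        using f(2) by (simp add: mat_act_add[of _ "Suc k"])
      moreover have "f (mat_act g1 x) \<in> carrier_vec (Suc k)" "f (mat_act g1 y) \<in> carrier_vec (Suc k)"
        using xc f(1) Hc by (auto simp: bij_betw_def)
      ultimately show "?F (x + y) = ?F x + ?F y" by (simp add: mat_act_add[of _ "Suc k"])
    qed
    have F3: "?F (vCons (pf e 1) (0\<^sub>v k)) = vCons (pf e 1) (0\<^sub>v k)"
      using c h2 by (simp add: g1(4) g2(4)[symmetric] mat_act_mult[of _ "Suc k" "Suc k" _ "Suc k", symmetric] del: g2(4))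
    have "add_iso H' K'" by (rule psum_cancel[OF g1(2) g2(2) F1 F2 F3])
    then obtain g where g: "g \<in> Gamma k" "pull k g K' = H'" using Suc.IH[OF g1(2) g2(2)] by metis
    have dg: "dsum 1 g \<in> Gamma (Suc k)" by (rule dsum_Gamma[OF g(1)])
    have "pull (Suc k) (dsum 1 g) (psum e K') = psum e H'"
      using pull_dsum_psum[OF Gamma_carrier[OF g(1)], of K' e] g2(2) g(2) by (simp add: fsub_def)
    then have "pull (Suc k) (g2 * dsum 1 g * h1) K = pull (Suc k) h1 (pull (Suc k) g1 H)"
      using c Gamma_carrier[OF dg] by (simp add: pull_mult g1 g2)
    also have "\<dots> = H" by (rule pull_Gamma_inverse[OF h1(2) c(1,3) Hc(1)])
    finally show ?case using Gamma_mult[OF Gamma_mult[OF g2(1) dg] h1(1)] by blast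
  qed
  then show ?thesis using that by blast
qed

section \<open>Kernels of isogenies\<close>

lemma mat_act_single:
  assumes "A \<in> carrier_mat k k" "i < k" "j < k"
  shows "mat_act A (vec k (\<lambda>l. if l = j then x else 0)) $ i = padic_scale (A $$ (i, j)) x"
proof -
  have "mat_act A (vec k (\<lambda>l. if l = j then x else 0)) $ i = (\<Sum>l<k. padic_scale (A $$ (i, l)) (if l = j then x else 0))"
    using assms by (simp add: mat_act_def)
  also have "\<dots> = (\<Sum>l<k. if l = j then padic_scale (A $$ (i, l)) x else 0)"
    by (rule sum.cong) auto
  finally show ?thesis using assms by simp
qed

text \<open>C is B times the inverse of A over Q_p, that is B A' / p^m. It is integral because A'
  carries p^m-torsion into the kernel of A, hence into that of B, so every entry of B A' kills all
  p^m-torsion.\<close>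

lemma kernel_factor:
  assumes A: "A \<in> Delta k" and B: "B \<in> carrier_mat k k" and sub: "kern k A \<subseteq> kern k B"
  obtains C where "C \<in> carrier_mat k k" "B = C * A"
proof -
  note Ac = Delta_carrier[OF A]
  obtain A' m where A': "A' \<in> carrier_mat k k" "A * A' = unif ^ m \<cdot>\<^sub>m 1\<^sub>m k" "A' * A = unif ^ m \<cdot>\<^sub>m 1\<^sub>m k"
    using Delta_quasi_inverse[OF A] .
  have "unif ^ m dvd (B * A') $$ (i, j)" if ij: "i < k" "j < k" for i j
  proof (rule padic_scale_annihilates)
    fix x :: "'a prufer" assume x: "padic_scale (unif ^ m) x = 0"
    let ?v = "vec k (\<lambda>l. if l = j then x else 0)"
    have "?v \<in> torsion m k" using x by (auto simp: torsion_def)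
    then have "mat_act A (mat_act A' ?v) = 0\<^sub>v k"
      using Ac A' torsion_iff_mat_act[of ?v k m] by (simp add: mat_act_mult[of _ k k _ k, symmetric])
    then have "mat_act A' ?v \<in> kern k A" using A' by (simp add: pull_def)
    then have "mat_act B (mat_act A' ?v) = 0\<^sub>v k" using sub by (auto simp: pull_def)
    then have "mat_act (B * A') ?v = 0\<^sub>v k" using A' B by (simp add: mat_act_mult[of _ k k _ k])
    then show "padic_scale ((B * A') $$ (i, j)) x = 0"
      using mat_act_single[of "B * A'" k i j x] ij A' B by (metis index_zero_vec(1) mult_carrier_mat)
  qed
  then have "\<forall>i j. \<exists>c. i < k \<and> j < k \<longrightarrow> (B * A') $$ (i, j) = unif ^ m * c" by (meson dvdE)
  then obtain c where c: "\<And>i j. i < k \<Longrightarrow> j < k \<Longrightarrow> (B * A') $$ (i, j) = unif ^ m * c i j" by metis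
  define C where "C = mat k k (\<lambda>(i, j). c i j)"
  have Cc: "C \<in> carrier_mat k k" by (simp add: C_def)
  have BA: "B * A' = unif ^ m \<cdot>\<^sub>m C"
    using c A' B by (intro eq_matI) (auto simp: C_def simp del: index_mult_mat(1))
  have "unif ^ m \<cdot>\<^sub>m B = B * (A' * A)" using A' B by (simp add: mult_smult_distrib[of _ k k _ k])
  also have "\<dots> = (B * A') * A" by (rule assoc_mult_mat[OF B A'(1) Ac, symmetric])
  also have "\<dots> = unif ^ m \<cdot>\<^sub>m (C * A)" unfolding BA using Cc Ac by (simp add: mult_smult_assoc_mat[of _ k k _ k])
  finally have "B = C * A" by (rule smult_mat_cancel[of _ _ _ k k]) (use B Cc Ac in auto)
  then show ?thesis using that Cc by blast
qed

text \<open>Each matrix factors through the other, and cancelling A shows that the two factors are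
  inverse to each other.\<close>

lemma kernel_eq_Gamma:
  assumes A: "A \<in> Delta k" and B: "B \<in> Delta k" and eq: "kern k A = kern k B"
  obtains g where "g \<in> Gamma k" "B = g * A"
proof -
  obtain C where C: "C \<in> carrier_mat k k" "B = C * A"
    using kernel_factor[OF A Delta_carrier[OF B]] eq by blast
  obtain C' where C': "C' \<in> carrier_mat k k" "A = C' * B"
    using kernel_factor[OF B Delta_carrier[OF A]] eq by blast
  have "1\<^sub>m k * A = C' * C * A"
    using C C' Delta_carrier[OF A] assoc_mult_mat[OF C'(1) C(1) Delta_carrier[OF A]] by simp
  then have "C' * C = 1\<^sub>m k"
    by (intro Delta_cancel_right[OF A mult_carrier_mat[OF C'(1) C(1)] one_carrier_mat, OF sym])
  then have "det C' * det C = 1" using det_mult[OF C'(1) C(1)] by simp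
  then have "det C dvd 1" by (metis dvd_triv_right)
  then have "C \<in> Gamma k" using C(1) by (simp add: Gamma_iff)
  then show ?thesis using that C by blast
qed

section \<open>The kernel of a matrix and the kernel of its transpose\<close>

lemma add_iso_trans:
  assumes "add_iso H K" "add_iso K L"
  shows "add_iso H L"
proof -
  obtain f where f: "bij_betw f H K" "\<forall>x\<in>H. \<forall>y\<in>H. f (x + y) = f x + f y" using assms by (auto simp: add_iso_def)
  obtain g where g: "bij_betw g K L" "\<forall>x\<in>K. \<forall>y\<in>K. g (x + y) = g x + g y" using assms by (auto simp: add_iso_def)
  have "f x \<in> K" if "x \<in> H" for x using f(1) that by (auto simp: bij_betw_def)
  then show ?thesis unfolding add_iso_def
    using f g bij_betw_trans[OF f(1) g(1)] by (intro exI[of _ "g \<circ> f"]) auto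
qed

lemma add_iso_sym:
  assumes "fsub k H" "add_iso H K"
  shows "add_iso K H"
proof -
  obtain f where f: "bij_betw f H K" "\<forall>x\<in>H. \<forall>y\<in>H. f (x + y) = f x + f y" using assms by (auto simp: add_iso_def)
  show ?thesis unfolding add_iso_def
    using bij_betw_inv_into[OF f(1)] bij_betw_additive_inv[OF f] fsub_add[OF assms(1)] by blast
qed

lemma add_iso_pull:
  assumes g: "g \<in> Gamma k" and H: "H \<subseteq> carrier_vec k"
  shows "add_iso (pull k g H) H"
proof -
  obtain h where h: "h \<in> Gamma k" "g * h = 1\<^sub>m k" "h * g = 1\<^sub>m k" using Gamma_inverse[OF g] .
  have "bij_betw (mat_act g) (pull k g H) H"
    by (rule pull_image[OF h(2,3) Gamma_carrier[OF g] Gamma_carrier[OF h(1)] H])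
  then show ?thesis unfolding add_iso_def
    by (intro exI[of _ "mat_act g"]) (auto simp: pull_def mat_act_add[of _ k])
qed

lemma pull_Gamma_zero:
  assumes g: "g \<in> Gamma k" shows "kern k g = {0\<^sub>v k}"
proof -
  obtain h where h: "h \<in> Gamma k" "g * h = 1\<^sub>m k" "h * g = 1\<^sub>m k" using Gamma_inverse[OF g] .
  have "v = 0\<^sub>v k" if "v \<in> carrier_vec k" "mat_act g v = 0\<^sub>v k" for v
  proof -
    have "mat_act (h * g) v = mat_act h (mat_act g v)"
      using that(1) h(1) g by (intro mat_act_mult[of _ k k _ k]) (simp_all add: Gamma_carrier)
    then have "v = mat_act h (mat_act g v)" using that(1) h by simp
    then show ?thesis using that(2) Gamma_carrier[OF h(1)] by simp
  qed
  then show ?thesis using Gamma_carrier[OF g] by (auto simp: pull_def)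
qed

text \<open>The normal form of the kernel gives A g = c D with D symmetric and \<open>g\<close>,
  \<open>c\<close> invertible. Transposing yields g^T A^T = D c^T, so the kernels of A and of A^T
  are both isomorphic to the kernel of D.\<close>

lemma kernel_transpose:
  fixes A :: "'p::prime_card padic_int mat"
  assumes A: "A \<in> Delta k"
  shows "add_iso (kern k A) (kern k (transpose_mat A))"
proof -
  let ?H = "kern k A"
  note Ac = Delta_carrier[OF A]
  have H: "fsub k ?H" by (rule fsub_pull[OF A fsub_zero])
  have Hc: "?H \<subseteq> carrier_vec k" using H by (simp add: fsub_def)
  obtain g D where g: "g \<in> Gamma k" "D \<in> Delta k" "transpose_mat D = D" "pull k g ?H = kern k D"
    using fsub_symmetric_kernel[OF H] by metis
  note gc = Gamma_carrier[OF g(1)] and Dc = Delta_carrier[OF g(2)]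
  have "kern k D = kern k (A * g)" using g(4) pull_mult[OF Ac gc] by simp
  then obtain c where c: "c \<in> Gamma k" "A * g = c * D"
    using kernel_eq_Gamma[OF g(2) Delta_mult[OF A Gamma_Delta[OF g(1)]]] by metis
  note cc = Gamma_carrier[OF c(1)]
  have "transpose_mat g * transpose_mat A = D * transpose_mat c"
    using arg_cong[OF c(2), of transpose_mat] transpose_mult[OF Ac gc] transpose_mult[OF cc Dc] g(3) by simp
  then have "pull k (transpose_mat A) (kern k (transpose_mat g)) = pull k (transpose_mat c) (kern k D)"
    using pull_mult[of "transpose_mat g" k "transpose_mat A"] pull_mult[of D k "transpose_mat c"] gc Ac cc Dc
    by (metis transpose_carrier_mat)
  then have eq: "kern k (transpose_mat A) = pull k (transpose_mat c) (pull k g ?H)"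
    using pull_Gamma_zero[OF transpose_Gamma[OF g(1)]] g(4) by simp
  have gH: "pull k g ?H \<subseteq> carrier_vec k" by (auto simp: pull_def)
  have "add_iso (kern k (transpose_mat A)) ?H"
    unfolding eq by (rule add_iso_trans[OF add_iso_pull[OF transpose_Gamma[OF c(1)] gH] add_iso_pull[OF g(1) Hc]])
  then show ?thesis by (rule add_iso_sym[OF fsub_pull[OF transpose_Delta[OF A] fsub_zero]])
qed

lemma fsub_is_kernel:
  assumes "fsub k H"
  obtains A where "A \<in> Delta k" "kern k A = H"
proof -
  obtain g D where g: "g \<in> Gamma k" "D \<in> Delta k" "pull k g H = kern k D"
    using fsub_symmetric_kernel[OF assms] by metis
  obtain h where h: "h \<in> Gamma k" "g * h = 1\<^sub>m k" "h * g = 1\<^sub>m k" using Gamma_inverse[OF g(1)] .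
  have "kern k (D * h) = pull k h (pull k g H)"
    using pull_mult[of D k h] g(3) Delta_carrier[OF g(2)] Gamma_carrier[OF h(1)] by simp
  also have "\<dots> = H"
    using assms by (intro pull_Gamma_inverse[OF h(2)]) (auto simp: g h Gamma_carrier fsub_def)
  finally show ?thesis using that Delta_mult[OF g(2) Gamma_Delta[OF h(1)]] by blast
qed

section \<open>Finite abelian p-groups as subgroups\<close>

lemma Lambda_simps [simp]:
  "carrier (Lambda k) = carrier_vec k" "x \<otimes>\<^bsub>Lambda k\<^esub> y = x + y" "\<one>\<^bsub>Lambda k\<^esub> = 0\<^sub>v k"
  by (simp_all add: Lambda_def monoid_vec_simps)

lemma comm_group_Lambda: "comm_group (Lambda k :: 'p::prime_card prufer vec monoid)"
proof (rule comm_groupI)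
  fix x :: "'p prufer vec" assume "x \<in> carrier (Lambda k)"
  then show "\<exists>y\<in>carrier (Lambda k). y \<otimes>\<^bsub>Lambda k\<^esub> x = \<one>\<^bsub>Lambda k\<^esub>"
    by (intro bexI[of _ "- x"]) auto
qed (auto simp: assoc_add_vec[of _ k] intro: comm_add_vec)

lemma group_Lambda: "group (Lambda k)"
  using comm_group_Lambda by (rule comm_group.axioms(2))

lemma inv_Lambda: "x \<in> carrier_vec k \<Longrightarrow> inv\<^bsub>Lambda k\<^esub> x = - x"
  by (rule group.inv_equality[OF group_Lambda]) auto

lemma fsub_iff: "fsub k H \<longleftrightarrow> finite H \<and> subgroup H (Lambda k)"
proof
  assume H: "fsub k H"
  show "finite H \<and> subgroup H (Lambda k)"
  proof (intro conjI subgroup.intro)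
    show "inv\<^bsub>Lambda k\<^esub> x \<in> H" if "x \<in> H" for x
      using H that fsub_uminus[OF H that] inv_Lambda[of x k] by (auto simp: fsub_def)
  qed (use H fsub_add[OF H] in \<open>auto simp: fsub_def\<close>)
next
  assume "finite H \<and> subgroup H (Lambda k)"
  then have f: "finite H" and H: "subgroup H (Lambda k)" by auto
  have Hc: "H \<subseteq> carrier_vec k" using subgroup.subset[OF H] by simp
  have "x - y \<in> H" if "x \<in> H" "y \<in> H" for x y
  proof -
    have "x + (- y) \<in> H"
      using subgroup.m_closed[OF H that(1) subgroup.m_inv_closed[OF H that(2)]] inv_Lambda[of y k] that Hc by auto
    moreover have "x + (- y) = x - y" using that Hc by (intro eq_vecI) auto
    ultimately show ?thesis by simp
  qed
  then show "fsub k H" using f Hc subgroup.one_closed[OF H] by (auto simp: fsub_def)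
qed

lemma pow_Lambda:
  assumes "x \<in> carrier_vec k"
  shows "x [^]\<^bsub>Lambda k\<^esub> n = mat_act (of_nat n \<cdot>\<^sub>m 1\<^sub>m k) x"
proof (induction n)
  case 0
  then show ?case using mat_act_of_nat_0[OF assms] by simp
next
  case (Suc n)
  have "mat_act (of_nat n \<cdot>\<^sub>m 1\<^sub>m k) x \<in> carrier_vec k" by (auto simp: mat_act_def)
  then have "mat_act (of_nat n \<cdot>\<^sub>m 1\<^sub>m k) x + x = x + mat_act (of_nat n \<cdot>\<^sub>m 1\<^sub>m k) x"
    using assms by (rule comm_add_vec)
  then show ?case using Suc assms mat_act_of_nat_Suc[OF assms, of n] by (simp del: of_nat_Suc)
qed

lemma torsion_iff_pow:
  fixes x :: "'p::prime_card prufer vec"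
  assumes "x \<in> carrier_vec k"
  shows "x \<in> torsion m k \<longleftrightarrow> x [^]\<^bsub>Lambda k\<^esub> (CARD('p) ^ m) = \<one>\<^bsub>Lambda k\<^esub>"
  using torsion_iff_mat_act[OF assms, of m] by (simp add: pow_Lambda[OF assms] unif_def)

lemma add_iso_iff: "(Lambda k)\<lparr>carrier := H\<rparr> \<cong> (Lambda l)\<lparr>carrier := K\<rparr> \<longleftrightarrow> add_iso H K"
  by (auto simp: is_iso_def iso_def hom_def add_iso_def bij_betw_def)

section \<open>Embedding abstract p-groups by counting roots\<close>

lemma (in group) subgroup_coprime_pow:
  assumes A: "subgroup A G" and x: "x \<in> carrier G" and p: "prime p" "x [^] (p::nat) \<in> A" and i: "x [^] (i::nat) \<in> A" "\<not> p dvd i"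
  shows "x \<in> A"
proof -
  have "coprime p i" using p i by (simp add: prime_imp_coprime)
  then obtain u v where uv: "int p * u + int i * v = 1"
    using bezout_int[of "int p" "int i"] by (auto simp: mult.commute coprime_int_iff coprime_iff_gcd_eq_1)
  have "x = x [^] (int p * u + int i * v)" using x by (simp add: uv int_pow_1)
  also have "\<dots> = (x [^] int p) [^] u \<otimes> (x [^] int i) [^] v"
    using x by (simp add: int_pow_mult int_pow_pow)
  also have "\<dots> \<in> A"
    using p(2) i(1) A subgroup_int_pow_closed[OF A] by (simp add: int_pow_int subgroup.m_closed)
  finally show ?thesis .
qed

lemma (in comm_group) subgroup_adjoin:
  assumes S: "subgroup S G" and z: "z \<in> carrier G" and p: "z [^] (p::nat) \<in> S" "0 < p"
  shows "subgroup {s \<otimes> z [^] (i::nat) | s i. s \<in> S} G"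
proof (rule subgroupI)
  have Sc: "s \<in> carrier G" if "s \<in> S" for s using subgroup.mem_carrier[OF S that] .
  let ?K = "{s \<otimes> z [^] (i::nat) | s i. s \<in> S}"
  show "?K \<subseteq> carrier G" using Sc z by auto
  show "?K \<noteq> {}" using subgroup.one_closed[OF S] by blast
  fix a assume "a \<in> ?K"
  then obtain s and i :: nat where a: "a = s \<otimes> z [^] i" "s \<in> S" by blast
  have zp: "z [^] (p * i) \<in> S"
    using S p(1) z by (induction i) (simp_all add: subgroup.one_closed subgroup.m_closed nat_pow_mult[symmetric])
  have "i \<le> p * i" using p by simp
  then have spl: "z [^] (p * i) = z [^] i \<otimes> z [^] (p * i - i)" using z by (simp add: nat_pow_mult)
  \<comment> \<open>Only natural exponents are available, so the inverse of \<open>z [^] i\<close>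
    is \<open>z [^] (p * i - i)\<close> up to the inverse of \<open>z [^] (p * i)\<close>, which
    lies in S.\<close>
  have "inv a = (inv s \<otimes> inv (z [^] (p * i))) \<otimes> z [^] (p * i - i)"
  proof -
    have ac: "((b \<otimes> c) \<otimes> d) \<otimes> (s \<otimes> f) = (b \<otimes> s) \<otimes> (c \<otimes> (f \<otimes> d))"
      if "b \<in> carrier G" "c \<in> carrier G" "d \<in> carrier G" "s \<in> carrier G" "f \<in> carrier G" for b c d s f
      using that by (simp add: m_ac)
    have "((inv s \<otimes> inv (z [^] (p * i))) \<otimes> z [^] (p * i - i)) \<otimes> a
        = (inv s \<otimes> s) \<otimes> (inv (z [^] (p * i)) \<otimes> (z [^] i \<otimes> z [^] (p * i - i)))"
      unfolding a(1) by (rule ac) (use Sc[OF a(2)] z in auto)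
    also have "\<dots> = \<one>" using Sc[OF a(2)] z unfolding spl[symmetric] by simp
    finally show ?thesis using a Sc z by (intro inv_equality) auto
  qed
  moreover have "inv s \<otimes> inv (z [^] (p * i)) \<in> S"
    using S a zp by (simp add: subgroup.m_closed subgroup.m_inv_closed)
  ultimately show "inv a \<in> ?K" by blast
  fix b assume "b \<in> ?K"
  then obtain t and j :: nat where b: "b = t \<otimes> z [^] j" "t \<in> S" by blast
  have "a \<otimes> b = (s \<otimes> t) \<otimes> z [^] (i + j)"
    using a b Sc z by (simp add: nat_pow_mult[symmetric] m_ac)
  moreover have "s \<otimes> t \<in> S" using S a b by (simp add: subgroup.m_closed)
  ultimately show "a \<otimes> b \<in> ?K" by blast
qed

text \<open>The graph of an isomorphism from a subgroup of G to a subgroup of L. Kept as a subgroup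
  of the product, it is extended by adjoining a single pair.\<close>

definition graph_iso :: "('a, 'c) monoid_scheme \<Rightarrow> ('b, 'd) monoid_scheme \<Rightarrow> ('a \<times> 'b) set \<Rightarrow> bool" where
  "graph_iso G L S \<longleftrightarrow> subgroup S (G \<times>\<times> L) \<and>
    (\<forall>w. (\<one>\<^bsub>G\<^esub>, w) \<in> S \<longrightarrow> w = \<one>\<^bsub>L\<^esub>) \<and> (\<forall>g. (g, \<one>\<^bsub>L\<^esub>) \<in> S \<longrightarrow> g = \<one>\<^bsub>G\<^esub>)"

lemma graph_iso_inj:
  assumes G: "group G" and L: "group L" and S: "graph_iso G L S"
  shows "inj_on fst S" "inj_on snd S"
proof -
  interpret G: group G by (rule G)
  interpret L: group L by (rule L)
  interpret P: group "G \<times>\<times> L" by (rule DirProd_group[OF G L])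
  have sub: "subgroup S (G \<times>\<times> L)" using S by (simp add: graph_iso_def)
  have c: "fst s \<in> carrier G" "snd s \<in> carrier L" if "s \<in> S" for s
    using subgroup.mem_carrier[OF sub that] by (auto simp: DirProd_def)
  have d: "(fst s \<otimes>\<^bsub>G\<^esub> inv\<^bsub>G\<^esub> fst t, snd s \<otimes>\<^bsub>L\<^esub> inv\<^bsub>L\<^esub> snd t) \<in> S" if "s \<in> S" "t \<in> S" for s t
  proof -
    have "s \<otimes>\<^bsub>G \<times>\<times> L\<^esub> inv\<^bsub>G \<times>\<times> L\<^esub> t \<in> S"
      using subgroup.m_closed[OF sub that(1) subgroup.m_inv_closed[OF sub that(2)]] .
    then show ?thesis using inv_DirProd[OF G L c[OF that(2)]] by (cases s; cases t) simp
  qed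
  show "inj_on fst S"
  proof (rule inj_onI)
    fix s t assume st: "s \<in> S" "t \<in> S" "fst s = fst t"
    then have "(\<one>\<^bsub>G\<^esub>, snd s \<otimes>\<^bsub>L\<^esub> inv\<^bsub>L\<^esub> snd t) \<in> S"
      using d[OF st(1,2)] c(1)[OF st(2)] by simp
    then have "snd s \<otimes>\<^bsub>L\<^esub> inv\<^bsub>L\<^esub> snd t = \<one>\<^bsub>L\<^esub>" using S unfolding graph_iso_def by blast
    then have "snd s = snd t" using c st(1,2) L.inv_solve_right[of "\<one>\<^bsub>L\<^esub>" "snd s" "snd t"] by simp
    then show "s = t" using st(3) by (simp add: prod_eq_iff)
  qed
  show "inj_on snd S"
  proof (rule inj_onI)
    fix s t assume st: "s \<in> S" "t \<in> S" "snd s = snd t"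
    then have "(fst s \<otimes>\<^bsub>G\<^esub> inv\<^bsub>G\<^esub> fst t, \<one>\<^bsub>L\<^esub>) \<in> S"
      using d[OF st(1,2)] c(2)[OF st(2)] by simp
    then have "fst s \<otimes>\<^bsub>G\<^esub> inv\<^bsub>G\<^esub> fst t = \<one>\<^bsub>G\<^esub>" using S unfolding graph_iso_def by blast
    then have "fst s = fst t" using c st(1,2) G.inv_solve_right[of "\<one>\<^bsub>G\<^esub>" "fst s" "fst t"] by simp
    then show "s = t" using st(3) by (simp add: prod_eq_iff)
  qed
qed


lemma (in group) subgroup_nat_pow_closed:
  assumes "subgroup H G" "x \<in> H" shows "x [^] (i::nat) \<in> H"
  using assms by (induction i) (simp_all add: subgroup.one_closed subgroup.m_closed)

text \<open>A maximal isomorphism between subgroups of \<open>G\<close> and \<open>L\<close> is defined on all of \<open>G\<close>: if \<open>x\<close> is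
  outside its domain but \<open>x [^] p\<close> is not, then \<open>L\<close> has more \<open>p\<close>-th roots of the image of
  \<open>x [^] p\<close> than can be hit already.\<close>

lemma embedding_of_p_torsion_bound:
  fixes G :: "('a, 'c) monoid_scheme" and L :: "('b, 'd) monoid_scheme"
  assumes G: "comm_group G" "finite (carrier G)" "card (carrier G) = p ^ e" and p: "prime p" and L: "comm_group L"
    and roots: "\<And>w. w \<in> carrier L \<Longrightarrow> card {x \<in> carrier G. x [^]\<^bsub>G\<^esub> p = \<one>\<^bsub>G\<^esub>} \<le> card {v \<in> carrier L. v [^]\<^bsub>L\<^esub> p = w}"
  obtains H where "subgroup H L" "G \<cong> L\<lparr>carrier := H\<rparr>"
proof -
  let ?P = "G \<times>\<times> L"
  interpret G: comm_group G by (rule G)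
  interpret L: comm_group L by (rule L)
  have gG: "group G" and gL: "group L" by unfold_locales
  interpret P: comm_group "?P"
    by (rule group.group_comm_groupI[OF DirProd_group[OF gG gL]]) (auto simp: DirProd_def G.m_comm L.m_comm)
  have carP: "carrier (?P) = carrier G \<times> carrier L" by simp
  have powP: "(a, b) [^]\<^bsub>?P\<^esub> (i::nat) = (a [^]\<^bsub>G\<^esub> i, b [^]\<^bsub>L\<^esub> i)" for a b i
    by (induction i) simp_all
  note inj = graph_iso_inj[OF gG gL]
  have bnd: "card S \<le> card (carrier G)" "finite S" if "graph_iso G L S" for S
  proof -
    have "fst ` S \<subseteq> carrier G" using that subgroup.subset by (fastforce simp: graph_iso_def)
    then show "card S \<le> card (carrier G)" "finite S"
      using inj(1)[OF that] G(2) by (auto intro: card_inj_on_le inj_on_finite)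
  qed
  have "graph_iso G L {(\<one>\<^bsub>G\<^esub>, \<one>\<^bsub>L\<^esub>)}"
    using P.triv_subgroup by (auto simp: graph_iso_def)
  then obtain S where S: "graph_iso G L S" and max: "\<And>T. graph_iso G L T \<Longrightarrow> card T \<le> card S"
    using ex_has_greatest_nat[of "graph_iso G L" _ card "Suc (card (carrier G))"] bnd(1)
    by (metis less_Suc_eq_le)
  have sub: "subgroup S (?P)" using S by (simp add: graph_iso_def)
  have Sc: "S \<subseteq> carrier G \<times> carrier L" using subgroup.subset[OF sub] by simp
  have hom1: "group_hom (?P) G fst" and hom2: "group_hom (?P) L snd"
    by unfold_locales (auto simp: hom_def)
  have sub1: "subgroup (fst ` S) G" and sub2: "subgroup (snd ` S) L"
    using group_hom.subgroup_img_is_subgroup[OF hom1 sub] group_hom.subgroup_img_is_subgroup[OF hom2 sub] .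
  have "fst ` S = carrier G"
  proof (rule ccontr)
    assume "fst ` S \<noteq> carrier G"
    then obtain y where y: "y \<in> carrier G" "y \<notin> fst ` S" using Sc by auto
    have "y [^]\<^bsub>G\<^esub> (p ^ e) = \<one>\<^bsub>G\<^esub>" using G.pow_order_eq_1[OF y(1)] G by (simp add: Coset.order_def)
    then have "y [^]\<^bsub>G\<^esub> (p ^ e) \<in> fst ` S" using subgroup.one_closed[OF sub1] by simp
    then obtain m where m: "y [^]\<^bsub>G\<^esub> (p ^ m) \<in> fst ` S" "\<And>l. l < m \<Longrightarrow> y [^]\<^bsub>G\<^esub> (p ^ l) \<notin> fst ` S"
      using exists_least_iff[of "\<lambda>m. y [^]\<^bsub>G\<^esub> (p ^ m) \<in> fst ` S"] by blast
    then obtain l where l: "m = Suc l" using y by (cases m) auto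
    \<comment> \<open>The last p-power iterate of \<open>y\<close> outside the domain; its own p-th
      power lies inside.\<close>
    define x where "x = y [^]\<^bsub>G\<^esub> (p ^ l)"
    have x: "x \<in> carrier G" "x \<notin> fst ` S" "x [^]\<^bsub>G\<^esub> p \<in> fst ` S"
      using m(1) m(2)[of l] y unfolding x_def l by (simp_all add: G.nat_pow_pow mult.commute)
    then obtain w where w: "(x [^]\<^bsub>G\<^esub> p, w) \<in> S" by auto
    then have wL: "w \<in> carrier L" using Sc by auto
    let ?R = "{v \<in> carrier L. v [^]\<^bsub>L\<^esub> p = w}" and ?T = "{x \<in> carrier G. x [^]\<^bsub>G\<^esub> p = \<one>\<^bsub>G\<^esub>}"
    have "\<not> ?R \<subseteq> snd ` S"
    proof
      assume R: "?R \<subseteq> snd ` S"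
      then have "\<forall>v\<in>?R. \<exists>h. (h, v) \<in> S" by force
      then obtain h where h: "\<And>v. v \<in> ?R \<Longrightarrow> (h v, v) \<in> S" by metis
      have hc: "h v \<in> carrier G" if "v \<in> ?R" for v using h[OF that] Sc by auto
      have hp: "h v [^]\<^bsub>G\<^esub> p = x [^]\<^bsub>G\<^esub> p" if "v \<in> ?R" for v
      proof -
        have "(h v, v) [^]\<^bsub>?P\<^esub> p \<in> S" by (rule P.subgroup_nat_pow_closed[OF sub h[OF that]])
        then have "(h v [^]\<^bsub>G\<^esub> p, w) \<in> S" using that by (simp add: powP)
        then show ?thesis using inj_onD[OF inj(2)[OF S] _ _ w] by fastforce
      qed
      \<comment> \<open>If every p-th root \<open>v\<close> of \<open>w\<close> were already hit, by
        \<open>h v\<close> say, then \<open>h v\<close> and \<open>x\<close> would have the same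
        p-th power. Their quotient is p-torsion and never trivial, since \<open>x\<close> is outside
        the domain. So the roots inject into the nontrivial p-torsion of G, against the assumed
        bound.\<close>
      let ?f = "\<lambda>v. inv\<^bsub>G\<^esub> x \<otimes>\<^bsub>G\<^esub> h v"
      have "inj_on ?f ?R"
      proof (rule inj_onI)
        fix v v' assume v: "v \<in> ?R" "v' \<in> ?R" "?f v = ?f v'"
        then have "h v = h v'" using hc x by simp
        then show "v = v'" using inj_onD[OF inj(1)[OF S] _ h[OF v(1)] h[OF v(2)]] by simp
      qed
      moreover have "?f ` ?R \<subseteq> ?T - {\<one>\<^bsub>G\<^esub>}"
      proof
        fix y assume "y \<in> ?f ` ?R"
        then obtain v where v: "v \<in> ?R" "y = ?f v" by blast
        have "y [^]\<^bsub>G\<^esub> p = inv\<^bsub>G\<^esub> (x [^]\<^bsub>G\<^esub> p) \<otimes>\<^bsub>G\<^esub> (x [^]\<^bsub>G\<^esub> p)"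
          using v hc[OF v(1)] hp[OF v(1)] x by (simp add: G.pow_mult_distrib[OF G.m_comm] G.nat_pow_inv)
        then have "y \<in> ?T" using v hc[OF v(1)] x by simp
        moreover have "y \<noteq> \<one>\<^bsub>G\<^esub>"
        proof
          assume "y = \<one>\<^bsub>G\<^esub>"
          then have "h v = x" using v(2) hc[OF v(1)] x(1) G.inv_solve_left'[of "\<one>\<^bsub>G\<^esub>" x "h v"] \<open>y = \<one>\<^bsub>G\<^esub>\<close> by simp
          then show False using h[OF v(1)] x by force
        qed
        ultimately show "y \<in> ?T - {\<one>\<^bsub>G\<^esub>}" by blast
      qed
      ultimately have "card ?R \<le> card (?T - {\<one>\<^bsub>G\<^esub>})" using G(2) by (intro card_inj_on_le) auto
      moreover have "card (?T - {\<one>\<^bsub>G\<^esub>}) < card ?T" using G(2) by (intro card_Diff1_less) auto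
      ultimately show False using roots[OF wL] by simp
    qed
    then obtain v where v: "v \<in> carrier L" "v [^]\<^bsub>L\<^esub> p = w" "v \<notin> snd ` S" by blast
    let ?z = "(x, v)"
    let ?K = "{s \<otimes>\<^bsub>?P\<^esub> ?z [^]\<^bsub>?P\<^esub> (i::nat) | s i. s \<in> S}"
    have z: "?z \<in> carrier (?P)" "?z [^]\<^bsub>?P\<^esub> p \<in> S" using x v w by (simp_all add: powP)
    have Ksub: "subgroup ?K (?P)"
      using P.subgroup_adjoin[OF sub z] prime_gt_0_nat[OF p] .
    have zS: "?z [^]\<^bsub>?P\<^esub> i \<in> S" if d: "p dvd i" for i
    proof -
      obtain q where "i = p * q" using d by (elim dvdE)
      then show ?thesis using P.subgroup_nat_pow_closed[OF sub z(2), of q] z(1) P.nat_pow_pow by metis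
    qed
    \<comment> \<open>For the enlarged subgroup to be a graph again, a relation with trivial first
      component may involve \<open>x\<close> only with exponent divisible by p; any other exponent
      would put \<open>x\<close> into the domain by Bezout. The same holds for \<open>v\<close> and
      the image in \<open>dvd2\<close>.\<close>
    have dvd1: "p dvd i" if "g \<otimes>\<^bsub>G\<^esub> x [^]\<^bsub>G\<^esub> i = \<one>\<^bsub>G\<^esub>" "g \<in> fst ` S" for g i
    proof (rule ccontr)
      assume "\<not> p dvd i"
      have gc: "g \<in> carrier G" using that Sc by auto
      have "x [^]\<^bsub>G\<^esub> i = inv\<^bsub>G\<^esub> g" using G.inv_equality[of "x [^]\<^bsub>G\<^esub> i" g] that(1) gc x(1) by (simp add: G.m_comm)
      then have "x [^]\<^bsub>G\<^esub> i \<in> fst ` S" using subgroup.m_inv_closed[OF sub1 that(2)] by simp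
      then show False using G.subgroup_coprime_pow[OF sub1 x(1) p x(3)] \<open>\<not> p dvd i\<close> x(2) by blast
    qed
    have dvd2: "p dvd i" if "g \<otimes>\<^bsub>L\<^esub> v [^]\<^bsub>L\<^esub> i = \<one>\<^bsub>L\<^esub>" "g \<in> snd ` S" for g i
    proof (rule ccontr)
      assume "\<not> p dvd i"
      have gc: "g \<in> carrier L" using that Sc by auto
      have "v [^]\<^bsub>L\<^esub> i = inv\<^bsub>L\<^esub> g" using L.inv_equality[of "v [^]\<^bsub>L\<^esub> i" g] that(1) gc v(1) by (simp add: L.m_comm)
      then have "v [^]\<^bsub>L\<^esub> i \<in> snd ` S" using subgroup.m_inv_closed[OF sub2 that(2)] by simp
      moreover have "v [^]\<^bsub>L\<^esub> p \<in> snd ` S" using w v by force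
      ultimately show False using L.subgroup_coprime_pow[OF sub2 v(1) p] \<open>\<not> p dvd i\<close> v(3) by blast
    qed
    have "graph_iso G L ?K"
      unfolding graph_iso_def
    proof (intro conjI allI impI)
      fix w' assume "(\<one>\<^bsub>G\<^esub>, w') \<in> ?K"
      then obtain a b i where s: "(a, b) \<in> S" "(\<one>\<^bsub>G\<^esub>, w') = (a, b) \<otimes>\<^bsub>?P\<^esub> ?z [^]\<^bsub>?P\<^esub> (i::nat)" by auto
      then have "a \<otimes>\<^bsub>G\<^esub> x [^]\<^bsub>G\<^esub> i = \<one>\<^bsub>G\<^esub>" by (simp add: powP)
      then have "p dvd i" using dvd1 s(1) by force
      then have "(\<one>\<^bsub>G\<^esub>, w') \<in> S" using s subgroup.m_closed[OF sub s(1) zS] by metis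
      then show "w' = \<one>\<^bsub>L\<^esub>" using S unfolding graph_iso_def by blast
    next
      fix g assume "(g, \<one>\<^bsub>L\<^esub>) \<in> ?K"
      then obtain a b i where s: "(a, b) \<in> S" "(g, \<one>\<^bsub>L\<^esub>) = (a, b) \<otimes>\<^bsub>?P\<^esub> ?z [^]\<^bsub>?P\<^esub> (i::nat)" by auto
      then have "b \<otimes>\<^bsub>L\<^esub> v [^]\<^bsub>L\<^esub> i = \<one>\<^bsub>L\<^esub>" by (simp add: powP)
      then have "p dvd i" using dvd2 s(1) by force
      then have "(g, \<one>\<^bsub>L\<^esub>) \<in> S" using s subgroup.m_closed[OF sub s(1) zS] by metis
      then show "g = \<one>\<^bsub>G\<^esub>" using S unfolding graph_iso_def by blast
    qed (rule Ksub)
    moreover have "S \<subset> ?K"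
    proof -
      have "s = s \<otimes>\<^bsub>?P\<^esub> ?z [^]\<^bsub>?P\<^esub> (0::nat)" if "s \<in> S" for s
        using subgroup.mem_carrier[OF sub that] by (metis P.nat_pow_0 P.r_one)
      then have "S \<subseteq> ?K" by blast
      moreover have "?z = \<one>\<^bsub>?P\<^esub> \<otimes>\<^bsub>?P\<^esub> ?z [^]\<^bsub>?P\<^esub> (1::nat)" using z x v by (simp add: powP)
      then have "?z \<in> ?K" using subgroup.one_closed[OF sub] by blast
      moreover have "?z \<notin> S" using x(2) by force
      ultimately show ?thesis by blast
    qed
    ultimately have "card S < card ?K" using bnd by (intro psubset_card_mono)
    then show False using max[OF \<open>graph_iso G L ?K\<close>] by simp
  qed
  then have "fst \<in> iso ((?P)\<lparr>carrier := S\<rparr>) G" and "snd \<in> iso ((?P)\<lparr>carrier := S\<rparr>) (L\<lparr>carrier := snd ` S\<rparr>)"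
    using inj[OF S] Sc by (auto simp: iso_def hom_def bij_betw_def)
  then have 1: "(?P)\<lparr>carrier := S\<rparr> \<cong> G" and 2: "(?P)\<lparr>carrier := S\<rparr> \<cong> L\<lparr>carrier := snd ` S\<rparr>"
    by (auto simp: is_iso_def)
  have "G \<cong> (?P)\<lparr>carrier := S\<rparr>" by (rule group.iso_sym[OF P.subgroup_imp_group[OF sub] 1])
  then show ?thesis using that sub2 iso_trans[OF _ 2] by blast
qed

text \<open>One root exists by divisibility, and the roots form a coset of the p-torsion.\<close>

lemma Lambda_roots_card:
  fixes w :: "'p::prime_card prufer vec"
  assumes w: "w \<in> carrier_vec n"
  shows "card {v \<in> carrier_vec n. v [^]\<^bsub>Lambda n\<^esub> CARD('p) = w} = CARD('p) ^ n"
proof -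
  let ?P = "of_nat CARD('p) \<cdot>\<^sub>m 1\<^sub>m n :: 'p padic_int mat"
  have u: "unif = (of_nat CARD('p) :: 'p padic_int)" by (simp add: unif_def)
  have "\<forall>i. \<exists>y. padic_scale unif y = w $ i" using prufer_divisible[OF unif_nonzero] by metis
  then obtain y where y: "\<And>i. padic_scale unif (y i) = w $ i" by metis
  define v0 where "v0 = vec n y"
  have v0: "v0 \<in> carrier_vec n" by (simp add: v0_def)
  have act: "mat_act ?P v0 = w"
  proof (rule eq_vecI)
    fix i assume "i < dim_vec w"
    then have i: "i < n" using w by simp
    show "mat_act ?P v0 $ i = w $ i"
      unfolding mat_act_smult_one[OF v0 i] using i y[of i] by (simp add: v0_def flip: u)
  qed (use w in \<open>auto simp: mat_act_def\<close>)
  have tor: "v \<in> torsion 1 n \<longleftrightarrow> mat_act ?P v = 0\<^sub>v n" if "v \<in> carrier_vec n" for v :: "'p prufer vec"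
    using torsion_iff_mat_act[OF that, of 1] by (simp add: u)
  have "bij_betw (\<lambda>v. v + v0) (torsion 1 n) {v \<in> carrier_vec n. v [^]\<^bsub>Lambda n\<^esub> CARD('p) = w}"
  proof (rule bij_betwI[where g = "\<lambda>v. v - v0"])
    show "(\<lambda>v. v + v0) \<in> torsion 1 n \<rightarrow> {v \<in> carrier_vec n. v [^]\<^bsub>Lambda n\<^esub> CARD('p) = w}"
    proof
      fix v :: "'p prufer vec" assume v: "v \<in> torsion 1 n"
      then have "v \<in> carrier_vec n" by (simp add: torsion_def)
      then show "v + v0 \<in> {v \<in> carrier_vec n. v [^]\<^bsub>Lambda n\<^esub> CARD('p) = w}"
        using v tor v0 w act by (simp add: pow_Lambda mat_act_add[of _ n])
    qed
    show "(\<lambda>v. v - v0) \<in> {v \<in> carrier_vec n. v [^]\<^bsub>Lambda n\<^esub> CARD('p) = w} \<rightarrow> torsion 1 n"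
    proof
      fix v assume v: "v \<in> {v \<in> carrier_vec n. v [^]\<^bsub>Lambda n\<^esub> CARD('p) = w}"
      then have "mat_act ?P (v - v0) = 0\<^sub>v n"
        using v0 act w by (auto simp: pow_Lambda mat_act_diff[of _ n])
      then show "v - v0 \<in> torsion 1 n" using v v0 tor by simp
    qed
    show "v + v0 - v0 = v" if "v \<in> torsion 1 n" for v
      using that v0 by (intro eq_vecI) (auto simp: torsion_def)
    show "v - v0 + v0 = v" if "v \<in> {v \<in> carrier_vec n. v [^]\<^bsub>Lambda n\<^esub> CARD('p) = w}" for v
      using that v0 by (intro eq_vecI) auto
  qed
  then show ?thesis
    using torsion_finite_card[of 1 n, where 'p='p] by (simp add: bij_betw_same_card[symmetric])
qed

text \<open>The p-torsion is a subgroup, so by Lagrange its order is a power of p; the exponent is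
  then unique, and the definite description in \<open>p_rank\<close> denotes it.\<close>

lemma card_p_torsion:
  assumes M: "comm_group M" "finite (carrier M)" "card (carrier M) = p ^ e" and p: "prime p"
  shows "card {x \<in> carrier M. x [^]\<^bsub>M\<^esub> p = \<one>\<^bsub>M\<^esub>} = p ^ p_rank p M"
proof -
  interpret comm_group M by (rule M)
  let ?T = "{x \<in> carrier M. x [^]\<^bsub>M\<^esub> p = \<one>\<^bsub>M\<^esub>}"
  have "subgroup ?T M"
    by (rule subgroupI) (auto simp: nat_pow_inv pow_mult_distrib m_comm intro!: exI[of _ "\<one>\<^bsub>M\<^esub>"])
  then have eq: "card (rcosets\<^bsub>M\<^esub> ?T) * card ?T = p ^ e" using lagrange[of ?T] M(3) by (simp add: Coset.order_def)
  have "card ?T dvd p ^ e" unfolding eq[symmetric] by (rule dvd_triv_right)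
  then obtain r where r: "card ?T = p ^ r" using divides_primepow_nat[OF p] by blast
  have "p_rank p M = r" unfolding p_rank_def r
    by (rule the_equality) (use power_inject_exp[OF prime_gt_1_nat[OF p], of r] in simp_all)
  then show ?thesis by (simp only: r)
qed

lemma ab_pgroups_iff:
  assumes p: "prime p"
  shows "M \<in> ab_pgroups p k \<longleftrightarrow> comm_group M \<and> finite (carrier M) \<and> (\<exists>e. card (carrier M) = p ^ e) \<and>
    card {x \<in> carrier M. x [^]\<^bsub>M\<^esub> p = \<one>\<^bsub>M\<^esub>} \<le> p ^ k"
proof -
  have "p_rank p M \<le> k \<longleftrightarrow> card {x \<in> carrier M. x [^]\<^bsub>M\<^esub> p = \<one>\<^bsub>M\<^esub>} \<le> p ^ k"
    if "comm_group M" "finite (carrier M)" "card (carrier M) = p ^ e" for e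
    unfolding card_p_torsion[OF that p] using prime_gt_1_nat[OF p] by simp
  then show ?thesis unfolding ab_pgroups_def by blast
qed

lemma prime_CARD: "prime CARD('p::prime_card)"
  by (rule prime_card)

lemma iso_card_p_torsion:
  assumes G: "group G" and H: "group H" and iso: "G \<cong> H"
  shows "card {x \<in> carrier G. x [^]\<^bsub>G\<^esub> (p::nat) = \<one>\<^bsub>G\<^esub>} = card {x \<in> carrier H. x [^]\<^bsub>H\<^esub> p = \<one>\<^bsub>H\<^esub>}"
proof -
  obtain f where f: "f \<in> hom G H" "bij_betw f (carrier G) (carrier H)" using iso by (auto simp: is_iso_def iso_def)
  have f1: "f \<one>\<^bsub>G\<^esub> = \<one>\<^bsub>H\<^esub>" by (rule hom_one[OF f(1) G H])
  have e: "f x [^]\<^bsub>H\<^esub> p = \<one>\<^bsub>H\<^esub> \<longleftrightarrow> x [^]\<^bsub>G\<^esub> p = \<one>\<^bsub>G\<^esub>" if "x \<in> carrier G" for x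
  proof -
    have "f x [^]\<^bsub>H\<^esub> p = f (x [^]\<^bsub>G\<^esub> p)" by (rule hom_nat_pow[OF f(1) that G H, symmetric])
    moreover have "x [^]\<^bsub>G\<^esub> p \<in> carrier G" "\<one>\<^bsub>G\<^esub> \<in> carrier G"
      using that G by (simp_all add: group.is_monoid monoid.nat_pow_closed monoid.one_closed)
    ultimately show ?thesis using f(2) f1 by (metis bij_betw_imp_inj_on inj_on_eq_iff)
  qed
  have "f ` carrier G = carrier H" using f(2) by (simp add: bij_betw_def)
  then have "{x \<in> carrier H. x [^]\<^bsub>H\<^esub> p = \<one>\<^bsub>H\<^esub>} = f ` {x \<in> carrier G. f x [^]\<^bsub>H\<^esub> p = \<one>\<^bsub>H\<^esub>}"
    by auto
  also have "{x \<in> carrier G. f x [^]\<^bsub>H\<^esub> p = \<one>\<^bsub>H\<^esub>} = {x \<in> carrier G. x [^]\<^bsub>G\<^esub> p = \<one>\<^bsub>G\<^esub>}"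
    using e by (intro Collect_cong conj_cong refl)
  finally have "f ` {x \<in> carrier G. x [^]\<^bsub>G\<^esub> p = \<one>\<^bsub>G\<^esub>} = {x \<in> carrier H. x [^]\<^bsub>H\<^esub> p = \<one>\<^bsub>H\<^esub>}"
    by (rule sym)
  moreover have "inj_on f {x \<in> carrier G. x [^]\<^bsub>G\<^esub> p = \<one>\<^bsub>G\<^esub>}"
    using f(2) by (auto simp: bij_betw_def inj_on_def)
  then have "card (f ` {x \<in> carrier G. x [^]\<^bsub>G\<^esub> p = \<one>\<^bsub>G\<^esub>}) = card {x \<in> carrier G. x [^]\<^bsub>G\<^esub> p = \<one>\<^bsub>G\<^esub>}"
    by (rule card_image)
  ultimately show ?thesis by (simp only:)
qed

section \<open>Finite subgroups of Lambda^k and groups on the natural numbers\<close>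

lemma group_fsub: "fsub k H \<Longrightarrow> group ((Lambda k)\<lparr>carrier := H\<rparr>)"
  by (simp add: fsub_iff group.subgroup_imp_group[OF group_Lambda])

lemma subgroups_iso_iff:
  assumes "M \<in> ab_pgroups q k"
  shows "H \<in> subgroups_iso l M \<longleftrightarrow> fsub l H \<and> (Lambda l)\<lparr>carrier := H\<rparr> \<cong> M"
  using assms iso_finite[of "(Lambda l)\<lparr>carrier := H\<rparr>" M]
  by (auto simp: subgroups_iso_def fsub_iff ab_pgroups_def)

text \<open>The structure of H is transported along a numbering of its elements. The rank bound
  holds because the p-torsion of H lies in that of Lambda^k, which has p^k elements.\<close>

lemma fsub_ab_pgroup:
  fixes H :: "'p::prime_card prufer vec set"
  assumes H: "fsub k H"
  obtains M where "M \<in> ab_pgroups CARD('p) k" "H \<in> subgroups_iso k M"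
proof -
  let ?G = "(Lambda k)\<lparr>carrier := H\<rparr>"
  have fin: "finite H" and sub: "subgroup H (Lambda k)" using H by (auto simp: fsub_iff)
  have Hc: "H \<subseteq> carrier_vec k" using H by (simp add: fsub_def)
  have cG: "comm_group ?G"
    using Hc by (intro group.group_comm_groupI[OF group_fsub[OF H]]) (auto intro: comm_add_vec)
  obtain h where h: "bij_betw h H {..<card H}" using ex_bij_betw_finite_nat[OF fin] by (auto simp: atLeast0LessThan)
  let ?i = "inv_into H h"
  define M where "M = \<lparr>carrier = {..<card H}, monoid.mult = (\<lambda>a b. h (?i a + ?i b)), one = h (0\<^sub>v k)\<rparr>"
  have i: "?i (h x) = x" if "x \<in> H" for x using h that by (simp add: bij_betw_inv_into_left)
  have "h \<in> iso ?G M"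
    using h i by (auto simp: iso_def hom_def M_def bij_betw_def)
  then have "comm_group (M\<lparr>one := h \<one>\<^bsub>?G\<^esub>\<rparr>)" by (rule comm_group.iso_imp_img_comm_group[OF cG])
  moreover have "M\<lparr>one := h \<one>\<^bsub>?G\<^esub>\<rparr> = M" by (simp add: M_def)
  ultimately have cM: "comm_group M" by simp
  have iso: "?G \<cong> M" using \<open>h \<in> iso ?G M\<close> by (auto simp: is_iso_def)
  have "card {x \<in> carrier M. x [^]\<^bsub>M\<^esub> CARD('p) = \<one>\<^bsub>M\<^esub>} = card {x \<in> carrier ?G. x [^]\<^bsub>?G\<^esub> CARD('p) = \<one>\<^bsub>?G\<^esub>}"
    using iso_card_p_torsion[OF group_fsub[OF H] comm_group.axioms(2)[OF cM] iso] by metis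
  also have "\<dots> \<le> card (torsion 1 k :: 'p prufer vec set)"
  proof (rule card_mono)
    show "finite (torsion 1 k :: 'p prufer vec set)" using torsion_finite_card by blast
    show "{x \<in> carrier ?G. x [^]\<^bsub>?G\<^esub> CARD('p) = \<one>\<^bsub>?G\<^esub>} \<subseteq> torsion 1 k"
    proof
      fix x assume "x \<in> {x \<in> carrier ?G. x [^]\<^bsub>?G\<^esub> CARD('p) = \<one>\<^bsub>?G\<^esub>}"
      then have x: "x \<in> H" "x [^]\<^bsub>?G\<^esub> CARD('p) = 0\<^sub>v k" by auto
      moreover have "x [^]\<^bsub>?G\<^esub> CARD('p) = x [^]\<^bsub>Lambda k\<^esub> CARD('p)"
        by (rule monoid.nat_pow_consistent[OF group.is_monoid[OF group_Lambda], symmetric])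
      ultimately show "x \<in> torsion 1 k" using Hc torsion_iff_pow[of x k 1] by auto
    qed
  qed
  also have "\<dots> = CARD('p) ^ k" using torsion_finite_card[of 1 k, where 'p='p] by simp
  finally have "card {x \<in> carrier M. x [^]\<^bsub>M\<^esub> CARD('p) = \<one>\<^bsub>M\<^esub>} \<le> CARD('p) ^ k" .
  moreover have "\<exists>e. card (carrier M) = CARD('p) ^ e"
    using fsub_symmetric_kernel[OF H] by (auto simp: M_def)
  ultimately have "M \<in> ab_pgroups CARD('p) k"
    using cM by (simp add: ab_pgroups_iff[OF prime_CARD]) (simp add: M_def)
  then show ?thesis using that iso sub by (auto simp: subgroups_iso_def)
qed

text \<open>Every element of Lambda^k has p^k p-th roots, at least as many as M has elements of
  p-torsion, so the embedding criterion applies. This keeps the divisor in \<open>a_int\<close> from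
  being 0.\<close>

lemma subgroups_iso_nonempty:
  assumes M: "M \<in> ab_pgroups CARD('p::prime_card) k"
  obtains H :: "'p::prime_card prufer vec set" where "H \<in> subgroups_iso k M"
proof -
  have M': "comm_group M" "finite (carrier M)" "card {x \<in> carrier M. x [^]\<^bsub>M\<^esub> CARD('p) = \<one>\<^bsub>M\<^esub>} \<le> CARD('p) ^ k"
    using M by (simp_all add: ab_pgroups_iff[OF prime_CARD])
  obtain e where e: "card (carrier M) = CARD('p) ^ e" using M by (auto simp: ab_pgroups_def)
  obtain H where H: "subgroup H (Lambda k :: 'p prufer vec monoid)" "M \<cong> (Lambda k)\<lparr>carrier := H\<rparr>"
  proof (rule embedding_of_p_torsion_bound[OF M'(1,2) e prime_CARD comm_group_Lambda])
    fix w :: "'p prufer vec" assume "w \<in> carrier (Lambda k)"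
    then show "card {x \<in> carrier M. x [^]\<^bsub>M\<^esub> CARD('p) = \<one>\<^bsub>M\<^esub>} \<le> card {v \<in> carrier (Lambda k). v [^]\<^bsub>Lambda k\<^esub> CARD('p) = w}"
      using M'(3) Lambda_roots_card[of w k] by simp
  qed
  then have "(Lambda k)\<lparr>carrier := H\<rparr> \<cong> M" using group.iso_sym[OF comm_group.axioms(2)[OF M'(1)]] by blast
  then show ?thesis using that H by (auto simp: subgroups_iso_def)
qed

lemma subgroups_iso_add_iso:
  assumes M: "M \<in> ab_pgroups q k" and H: "H \<in> subgroups_iso l M"
  shows "K \<in> subgroups_iso m M \<longleftrightarrow> fsub m K \<and> add_iso H K"
proof -
  have fH: "fsub l H" and iH: "(Lambda l)\<lparr>carrier := H\<rparr> \<cong> M" using H subgroups_iso_iff[OF M] by auto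
  have "(Lambda m)\<lparr>carrier := K\<rparr> \<cong> M \<longleftrightarrow> add_iso H K" if K: "fsub m K"
  proof
    assume "(Lambda m)\<lparr>carrier := K\<rparr> \<cong> M"
    then have "M \<cong> (Lambda m)\<lparr>carrier := K\<rparr>" by (rule group.iso_sym[OF group_fsub[OF K]])
    then show "add_iso H K" using iso_trans[OF iH] add_iso_iff by blast
  next
    assume "add_iso H K"
    then have "add_iso K H" by (rule add_iso_sym[OF fH])
    then show "(Lambda m)\<lparr>carrier := K\<rparr> \<cong> M" using iso_trans iH add_iso_iff by blast
  qed
  then show ?thesis using subgroups_iso_iff[OF M] by blast
qed

text \<open>Isomorphisms preserve torsion, so all these subgroups lie in one finite torsion
  subgroup.\<close>

lemma subgroups_iso_finite:
  assumes M: "M \<in> ab_pgroups q k"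
  shows "finite (subgroups_iso l M :: 'p::prime_card prufer vec set set)"
proof (cases "subgroups_iso l M = ({} :: 'p prufer vec set set)")
  case False
  then obtain H :: "'p prufer vec set" where H: "H \<in> subgroups_iso l M" by blast
  then have fH: "fsub l H" using subgroups_iso_iff[OF M] by blast
  then obtain m where m: "H \<subseteq> torsion m l" using fsub_torsion_bound by blast
  have "subgroups_iso l M \<subseteq> Pow (torsion m l :: 'p prufer vec set)"
  proof
    fix K :: "'p prufer vec set" assume "K \<in> subgroups_iso l M"
    then have K: "fsub l K" "add_iso H K" using subgroups_iso_add_iso[OF M H] by blast+
    then obtain f where f: "bij_betw f H K" "\<forall>x\<in>H. \<forall>y\<in>H. f (x + y) = f x + f y" by (auto simp: add_iso_def)
    have "f x \<in> torsion m l" if "x \<in> H" for x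
      using additive_torsion_iff[OF fH K(1) f that] m that by blast
    then show "K \<in> Pow (torsion m l)" using f(1) by (auto simp: bij_betw_def)
  qed
  then show ?thesis using torsion_finite_card[of m l, where 'p='p] finite_subset by blast
qed simp

section \<open>Cosets and subgroups\<close>

definition cosets :: "nat \<Rightarrow> 'p::prime_card padic_int mat set set" where
  "cosets k = Gcoset k ` Delta k"

definition lmul :: "'p::prime_card padic_int mat \<Rightarrow> 'p padic_int mat set \<Rightarrow> 'p padic_int mat set" where
  "lmul D c = (\<lambda>A. D * A) ` c"

text \<open>The transpose makes \<open>phi\<close> well defined on the cosets \<open>A \<Gamma>\<close>: replacing \<open>A\<close> by \<open>A g\<close>
  changes the kernel of \<open>A\<close>, but not that of its transpose.\<close>

definition phi :: "nat \<Rightarrow> 'p::prime_card padic_int mat set \<Rightarrow> 'p prufer vec set" where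
  "phi k c = {v \<in> carrier_vec k. \<exists>A\<in>c. mat_act (transpose_mat A) v = 0\<^sub>v k}"

abbreviation cmod :: "nat \<Rightarrow> ('p::prime_card padic_int mat set \<Rightarrow>\<^sub>0 int) set" where
  "cmod k \<equiv> carrier (coset_module k)"

lemma carrier_coset_module: "cmod k = {x. Poly_Mapping.keys x \<subseteq> cosets k}"
  by (simp add: coset_module_def free_Abelian_group_def cosets_def)

lemma coset_act_frag_of [simp]: "coset_act D (frag_of c) = frag_of (lmul D c)"
  by (simp add: coset_act_def lmul_def)

lemma coset_act_0 [simp]: "coset_act D 0 = 0"
  and coset_act_diff: "coset_act D (x - y) = coset_act D x - coset_act D y"
  by (simp_all add: coset_act_def frag_extend_diff)

lemma lmul_Gcoset: "D \<in> Delta k \<Longrightarrow> A \<in> Delta k \<Longrightarrow> lmul D (Gcoset k A) = Gcoset k (D * A)"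
  unfolding lmul_def by (rule image_Gcoset)

lemma lmul_cosets: "D \<in> Delta k \<Longrightarrow> c \<in> cosets k \<Longrightarrow> lmul D c \<in> cosets k"
  by (auto simp: cosets_def lmul_Gcoset Delta_mult)

lemma lmul_mult:
  assumes "A \<in> Delta k" "B \<in> Delta k" "c \<in> cosets k"
  shows "lmul (A * B) c = lmul A (lmul B c)"
proof -
  obtain E where E: "c = Gcoset k E" "E \<in> Delta k" using assms(3) by (auto simp: cosets_def)
  then show ?thesis
    using assms assoc_mult_mat[OF Delta_carrier Delta_carrier Delta_carrier, of A k B E]
    by (simp add: lmul_Gcoset Delta_mult)
qed

lemma lmul_one:
  assumes "c \<in> cosets k" shows "lmul (1\<^sub>m k) c = c"
proof -
  obtain E where E: "c = Gcoset k E" "E \<in> Delta k" using assms by (auto simp: cosets_def)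
  then show ?thesis using lmul_Gcoset[OF Gamma_Delta[OF one_Gamma] E(2)] Delta_carrier[OF E(2)] by simp
qed

lemma Gcoset_Gamma:
  assumes A: "A \<in> Delta k" and g: "g \<in> Gamma k"
  shows "Gcoset k (A * g) = Gcoset k A"
proof -
  obtain h where h: "h \<in> Gamma k" "g * h = 1\<^sub>m k" "h * g = 1\<^sub>m k" using Gamma_inverse[OF g] .
  note c = Delta_carrier[OF A] Gamma_carrier[OF g] Gamma_carrier[OF h(1)]
  have "A * g * x \<in> Gcoset k A" if "x \<in> Gamma k" for x
    using that g assoc_mult_mat[OF c(1,2) Gamma_carrier[OF that]] Gamma_mult[OF g that] by (auto simp: Gcoset_def)
  moreover have "A * x \<in> Gcoset k (A * g)" if x: "x \<in> Gamma k" for x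
  proof -
    have hx: "h * x \<in> carrier_mat k k" using c(3) Gamma_carrier[OF x] by simp
    have "A * g * (h * x) = A * (g * (h * x))" by (rule assoc_mult_mat[OF c(1,2) hx])
    also have "g * (h * x) = g * h * x" by (rule assoc_mult_mat[OF c(2,3) Gamma_carrier[OF x], symmetric])
    also have "\<dots> = x" using h Gamma_carrier[OF x] by simp
    finally have "A * x = A * g * (h * x)" by (rule sym)
    then show ?thesis unfolding Gcoset_def by (rule image_eqI) (rule Gamma_mult[OF h(1) x])
  qed
  ultimately show ?thesis by (auto simp: Gcoset_def)
qed

lemma Gcoset_one: "Gcoset k (1\<^sub>m k) = Gamma k"
proof -
  have "1\<^sub>m k * g = g" if "g \<in> Gamma k" for g using Gamma_carrier[OF that] by simp
  then show ?thesis by (force simp: Gcoset_def)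
qed

lemma Gamma_cosets: "Gamma k \<in> cosets k"
  using Gcoset_one Gamma_Delta[OF one_Gamma] by (auto simp: cosets_def)

lemma lmul_Gamma_set: "D \<in> Delta k \<Longrightarrow> lmul D (Gamma k) = Gcoset k D"
  using lmul_Gcoset[OF _ Gamma_Delta[OF one_Gamma], of D k] Delta_carrier[of D k] by (simp add: Gcoset_one)

lemma lmul_Gamma_fixes: "g \<in> Gamma k \<Longrightarrow> lmul g (Gamma k) = Gamma k"
  using lmul_Gamma_set[OF Gamma_Delta, of g k] Gcoset_Gamma[OF Gamma_Delta[OF one_Gamma], of g k]
    Gamma_carrier[of g k] by (simp add: Gcoset_one)

section \<open>The bijection between cosets and finite subgroups\<close>

lemma phi_Gcoset:
  assumes A: "A \<in> Delta k"
  shows "phi k (Gcoset k A) = kern k (transpose_mat A)"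
proof -
  note Ac = Delta_carrier[OF A]
  have eq: "kern k (transpose_mat (A * g)) = kern k (transpose_mat A)" if g: "g \<in> Gamma k" for g
    using transpose_mult[OF Ac Gamma_carrier[OF g]] Ac Gamma_carrier[OF g] pull_Gamma_zero[OF transpose_Gamma[OF g]]
    by (simp add: pull_mult)
  have "phi k (Gcoset k A) = (\<Union>g\<in>Gamma k. kern k (transpose_mat (A * g)))"
    by (auto simp: phi_def Gcoset_def pull_def)
  also have "\<dots> = kern k (transpose_mat A)" using one_Gamma[of k] eq by blast
  finally show ?thesis .
qed

text \<open>If the transposes of A and B have equal kernels, they differ by an invertible factor on
  the left; transposed, this is a factor on the right, so the cosets agree. Surjectivity is
  \<open>fsub_is_kernel\<close>.\<close>

lemma phi_bij: "bij_betw (phi k) (cosets k) {H :: 'a::prime_card prufer vec set. fsub k H}"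
proof (rule bij_betw_imageI)
  show "inj_on (phi k) (cosets k :: 'a padic_int mat set set)"
  proof (rule inj_onI)
    fix c d :: "'a padic_int mat set"
    assume cd: "c \<in> cosets k" "d \<in> cosets k" "phi k c = phi k d"
    then obtain A B where AB: "c = Gcoset k A" "A \<in> Delta k" "d = Gcoset k B" "B \<in> Delta k" by (auto simp: cosets_def)
    then have "kern k (transpose_mat A) = kern k (transpose_mat B)"
      using cd by (simp add: phi_Gcoset)
    then obtain g where g: "g \<in> Gamma k" "transpose_mat B = g * transpose_mat A"
      using kernel_eq_Gamma[OF transpose_Delta[OF AB(2)] transpose_Delta[OF AB(4)]] by metis
    have "B = A * transpose_mat g"
      using arg_cong[OF g(2), of transpose_mat] transpose_mult[of g k k "transpose_mat A" k] Gamma_carrier[OF g(1)]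
        Delta_carrier[OF AB(2)] by simp
    then show "c = d" using Gcoset_Gamma[OF AB(2) transpose_Gamma[OF g(1)]] AB by simp
  qed
  show "phi k ` cosets k = {H :: 'a prufer vec set. fsub k H}"
  proof (intro subset_antisym subsetI)
    fix H :: "'a prufer vec set" assume "H \<in> {H. fsub k H}"
    then obtain A where A: "A \<in> Delta k" "kern k A = H" using fsub_is_kernel by blast
    then have "H = phi k (Gcoset k (transpose_mat A))" using phi_Gcoset[OF transpose_Delta[OF A(1)]] by simp
    then show "H \<in> phi k ` cosets k" using transpose_Delta[OF A(1)] by (auto simp: cosets_def)
  next
    fix H :: "'a prufer vec set" assume "H \<in> phi k ` cosets k"
    then show "H \<in> {H. fsub k H}"
      using fsub_pull[OF transpose_Delta fsub_zero] by (auto simp: cosets_def phi_Gcoset)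
  qed
qed

lemma phi_fsub: "c \<in> cosets k \<Longrightarrow> fsub k (phi k c)"
  using phi_bij[of k] by (auto simp: bij_betw_def)

lemma phi_inj: "c \<in> cosets k \<Longrightarrow> d \<in> cosets k \<Longrightarrow> phi k c = phi k d \<longleftrightarrow> c = d"
  using phi_bij[of k] by (metis bij_betw_imp_inj_on inj_on_eq_iff)

lemma phi_lmul:
  assumes D: "D \<in> Delta k" and c: "c \<in> cosets k"
  shows "phi k (lmul D c) = pull k (transpose_mat D) (phi k c)"
proof -
  obtain A where A: "c = Gcoset k A" "A \<in> Delta k" using c by (auto simp: cosets_def)
  then show ?thesis
    using D transpose_mult[OF Delta_carrier[OF D] Delta_carrier[OF A(2)]] Delta_carrier[OF D] Delta_carrier[OF A(2)]
    by (simp add: lmul_Gcoset phi_Gcoset Delta_mult pull_mult)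
qed

lemma phi_Gamma: "phi k (Gamma k) = {0\<^sub>v k}"
proof -
  have "phi k (Gcoset k (1\<^sub>m k)) = pull k (1\<^sub>m k) {0\<^sub>v k :: 'a prufer vec}"
    using phi_Gcoset[OF Gamma_Delta[OF one_Gamma], of k] by simp
  then show ?thesis unfolding Gcoset_one by (simp add: pull_one)
qed

section \<open>Elements of the Hecke algebra\<close>

abbreviation base :: "nat \<Rightarrow> ('p::prime_card padic_int mat set \<Rightarrow>\<^sub>0 int)" where
  "base k \<equiv> frag_of (Gamma k)"

lemma coset_module_induct [consumes 1, case_names zero diff one]:
  assumes "x \<in> cmod k" "P 0"
    "\<And>x y. x \<in> cmod k \<Longrightarrow> y \<in> cmod k \<Longrightarrow> P x \<Longrightarrow> P y \<Longrightarrow> P (x - y)"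
    "\<And>c. c \<in> cosets k \<Longrightarrow> P (frag_of c)"
  shows "P x"
  by (rule free_Abelian_group_induct[of x "cosets k"]) (use assms in \<open>auto simp: carrier_coset_module\<close>)

lemma frag_of_carrier [simp]: "frag_of c \<in> cmod k \<longleftrightarrow> c \<in> cosets k"
  by (simp add: carrier_coset_module)

lemma coset_module_diff: "x \<in> cmod k \<Longrightarrow> y \<in> cmod k \<Longrightarrow> x - y \<in> cmod k"
  using coset_module_simps(2)[of x k "- y"] coset_module_simps(3)[of y k] by simp

lemma coset_act_mult:
  assumes "A \<in> Delta k" "B \<in> Delta k" "x \<in> cmod k"
  shows "coset_act (A * B) x = coset_act A (coset_act B x)"
  using assms(3) by (induction x rule: coset_module_induct) (simp_all add: coset_act_diff lmul_mult[OF assms(1,2)])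

section \<open>Operators and their values on the coset \<open>Gamma k\<close>\<close>

lemma hecke_diff:
  assumes "T \<in> carrier (hecke k)" "x \<in> cmod k" "y \<in> cmod k"
  shows "T (x - y) = T x - T y"
proof -
  have "T (x - y + y) = T (x - y) + T y"
    using assms coset_module_diff[OF assms(2,3)] unfolding hecke_carrier_iff by blast
  then show ?thesis by simp
qed

lemma hecke_0: "T \<in> carrier (hecke k) \<Longrightarrow> T 0 = 0"
  using hecke_diff[of T k 0 0] coset_module_simps(1)[of k] by simp

lemma hecke_closed: "T \<in> carrier (hecke k) \<Longrightarrow> x \<in> cmod k \<Longrightarrow> T x \<in> cmod k"
  by (auto simp: hecke_carrier_iff)

lemma hecke_act: "T \<in> carrier (hecke k) \<Longrightarrow> D \<in> Delta k \<Longrightarrow> x \<in> cmod k \<Longrightarrow> T (coset_act D x) = coset_act D (T x)"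
  by (auto simp: hecke_carrier_iff)

lemma hecke_Gcoset:
  assumes "T \<in> carrier (hecke k)" "A \<in> Delta k"
  shows "T (frag_of (Gcoset k A)) = coset_act A (T (base k))"
  using hecke_act[OF assms, of "base k"] assms by (simp add: lmul_Gamma_set Gamma_cosets)

text \<open>The coset \<open>Gamma k\<close> generates the coset module under the action of
  \<open>Delta k\<close>.\<close>

lemma hecke_determined:
  fixes S T :: "'p::prime_card hecke_elt"
  assumes S: "S \<in> carrier (hecke k)" and T: "T \<in> carrier (hecke k)" and eq: "S (base k) = T (base k)"
  shows "S = T"
proof (rule hecke_eqI[of _ k])
  fix x :: "'p padic_int mat set \<Rightarrow>\<^sub>0 int" assume "x \<in> cmod k"
  then show "S x = T x"
  proof (induction x rule: coset_module_induct)
    case (one c)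
    then show ?case using hecke_Gcoset[OF S] hecke_Gcoset[OF T] eq by (auto simp: cosets_def)
  qed (simp_all add: hecke_0[OF S] hecke_0[OF T] hecke_diff[OF S] hecke_diff[OF T])
qed (use S T in \<open>simp_all add: hecke_carrier_iff\<close>)

lemma hecke_invariant:
  assumes "T \<in> carrier (hecke k)" "g \<in> Gamma k"
  shows "coset_act g (T (base k)) = T (base k)"
  using hecke_act[OF assms(1) Gamma_Delta[OF assms(2)], of "base k"] lmul_Gamma_fixes[OF assms(2)]
  by (simp add: Gamma_cosets)

text \<open>The operator has to send the coset of A to A t. By invariance of \<open>t\<close> this
  is independent of the representative chosen in \<open>u\<close>.\<close>

lemma hecke_exists:
  fixes t :: "'p::prime_card padic_int mat set \<Rightarrow>\<^sub>0 int"
  assumes t: "t \<in> cmod k" and inv: "\<And>g. g \<in> Gamma k \<Longrightarrow> coset_act g t = t"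
  obtains T where "T \<in> carrier (hecke k)" "T (base k) = t"
proof -
  define u where "u c = coset_act (SOME A. A \<in> Delta k \<and> c = Gcoset k A) t" for c
  have u: "u (Gcoset k A) = coset_act A t" if A: "A \<in> Delta k" for A
  proof -
    define B where "B = (SOME B. B \<in> Delta k \<and> Gcoset k A = Gcoset k B)"
    have B: "B \<in> Delta k" "Gcoset k A = Gcoset k B"
      unfolding B_def by (rule someI2[of _ A]; use A in simp)+
    have "A * 1\<^sub>m k \<in> Gcoset k A" using one_Gamma by (auto simp: Gcoset_def)
    then have "A \<in> Gcoset k B" using Delta_carrier[OF A] B(2) by simp
    then obtain g where g: "g \<in> Gamma k" "A = B * g" by (auto simp: Gcoset_def)
    have "coset_act A t = coset_act B t"
      unfolding g(2) coset_act_mult[OF B(1) Gamma_Delta[OF g(1)] t] inv[OF g(1)] ..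
    then show ?thesis by (simp add: u_def B_def)
  qed
  let ?C = "cmod k :: ('p padic_int mat set \<Rightarrow>\<^sub>0 int) set"
  define T where "T = (\<lambda>x\<in>?C. frag_extend u x)"
  have Tc: "frag_extend u x \<in> ?C" if "x \<in> ?C" for x
    using that
  proof (induction x rule: coset_module_induct)
    case (one c)
    then show ?case using u coset_act_closed[OF _ t] by (auto simp: cosets_def)
  qed (simp_all add: coset_module_simps(1) frag_extend_diff coset_module_diff)
  have Ta: "frag_extend u (coset_act D x) = coset_act D (frag_extend u x)" if D: "D \<in> Delta k" and "x \<in> ?C" for D x
    using that(2)
  proof (induction x rule: coset_module_induct)
    case (one c)
    then obtain A where A: "c = Gcoset k A" "A \<in> Delta k" by (auto simp: cosets_def)
    then show ?case using u[OF A(2)] u[OF Delta_mult[OF D A(2)]] lmul_Gcoset[OF D A(2)] coset_act_mult[OF D A(2) t] by simp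
  qed (simp_all add: frag_extend_diff coset_act_diff)
  have "T \<in> carrier (hecke k)"
    unfolding hecke_carrier_iff
  proof (intro conjI ballI)
    fix x y assume xy: "x \<in> ?C" "y \<in> ?C"
    show "T x \<in> ?C" using Tc xy by (simp add: T_def)
    show "T (x + y) = T x + T y" using xy coset_module_simps(2)[OF xy] by (simp add: T_def frag_extend_add)
    show "T (coset_act D x) = coset_act D (T x)" if "D \<in> Delta k" for D
      using Ta[OF that xy(1)] xy coset_act_closed[OF that xy(1)] by (simp add: T_def)
  qed (simp add: T_def)
  moreover have "T (base k) = t"
  proof -
    have "coset_act (1\<^sub>m k) t = t" by (rule inv[OF one_Gamma])
    then show ?thesis using u[OF Gamma_Delta[OF one_Gamma]] by (simp add: T_def Gamma_cosets Gcoset_one)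
  qed
  ultimately show ?thesis by (rule that)
qed

lemma lmul_inj:
  assumes g: "g \<in> Gamma k" and c: "c \<in> cosets k" and d: "d \<in> cosets k"
  shows "lmul g c = lmul g d \<longleftrightarrow> c = d"
proof -
  obtain h where h: "h \<in> Gamma k" "g * h = 1\<^sub>m k" "h * g = 1\<^sub>m k" using Gamma_inverse[OF g] .
  have "lmul h (lmul g x) = x" if "x \<in> cosets k" for x
    using lmul_mult[OF Gamma_Delta[OF h(1)] Gamma_Delta[OF g] that] lmul_one[OF that] h by simp
  then show ?thesis using c d by metis
qed

lemma lookup_coset_act:
  assumes g: "g \<in> Gamma k" and x: "x \<in> cmod k" and c: "c \<in> cosets k"
  shows "Poly_Mapping.lookup (coset_act g x) (lmul g c) = Poly_Mapping.lookup x c"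
  using x
proof (induction x rule: coset_module_induct)
  case (one d)
  then show ?case using lmul_inj[OF g c one] by (simp add: eq_commute)
qed (simp_all add: coset_act_diff lookup_minus)

lemma hecke_lookup_orbit:
  assumes T: "T \<in> carrier (hecke k)" and g: "g \<in> Gamma k" and c: "c \<in> cosets k"
  shows "Poly_Mapping.lookup (T (base k)) (lmul g c) = Poly_Mapping.lookup (T (base k)) c"
  using lookup_coset_act[OF g hecke_closed[OF T, of "base k"] c] hecke_invariant[OF T g]
  by (simp add: Gamma_cosets)

section \<open>The basis elements\<close>

definition iso_cosets :: "nat \<Rightarrow> nat monoid \<Rightarrow> 'p::prime_card padic_int mat set set" where
  "iso_cosets k M = {c \<in> cosets k. phi k c \<in> subgroups_iso k M}"

lemma phi_bij_iso_cosets: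
  assumes M: "M \<in> ab_pgroups q k"
  shows "bij_betw (phi k) (iso_cosets k M) (subgroups_iso k M :: 'p::prime_card prufer vec set set)"
proof (rule bij_betw_imageI)
  show "inj_on (phi k) (iso_cosets k M :: 'p padic_int mat set set)"
    by (rule inj_onI) (simp add: iso_cosets_def phi_inj)
  show "phi k ` iso_cosets k M = (subgroups_iso k M :: 'p prufer vec set set)"
  proof (intro subset_antisym subsetI)
    fix H :: "'p prufer vec set" assume H: "H \<in> subgroups_iso k M"
    then have "H \<in> phi k ` cosets k" using subgroups_iso_iff[OF M] phi_bij[of k] by (auto simp: bij_betw_def)
    then show "H \<in> phi k ` iso_cosets k M" using H by (auto simp: iso_cosets_def)
  qed (auto simp: iso_cosets_def)
qed

lemma iso_cosets_finite:
  assumes "M \<in> ab_pgroups q k"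
  shows "finite (iso_cosets k M :: 'p::prime_card padic_int mat set set)"
  using bij_betw_finite[OF phi_bij_iso_cosets[OF assms]] subgroups_iso_finite[OF assms] by blast

text \<open>The index set in \<open>hecke_basis\<close> is formed with the kernel of A, whereas
  \<open>phi\<close> sees the kernel of the transpose; \<open>kernel_transpose\<close> reconciles
  the two.\<close>

lemma iso_cosets_eq:
  assumes M: "M \<in> ab_pgroups q k"
  shows "{Gcoset k A | A. A \<in> Delta k \<and> (Lambda k)\<lparr>carrier := kernel (Lambda k) (Lambda k) (mat_act A)\<rparr> \<cong> M}
    = (iso_cosets k M :: 'p::prime_card padic_int mat set set)"
proof -
  have ker: "kernel (Lambda k) (Lambda k) (mat_act A) = kern k A" for A :: "'p padic_int mat"
    by (auto simp: kernel_def pull_def)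
  have "(Lambda k)\<lparr>carrier := kern k A\<rparr> \<cong> M \<longleftrightarrow> phi k (Gcoset k A) \<in> subgroups_iso k M"
    if A: "A \<in> Delta k" for A :: "'p padic_int mat"
  proof -
    have f: "fsub k (kern k A)" "fsub k (kern k (transpose_mat A))"
      using fsub_pull[OF A fsub_zero] fsub_pull[OF transpose_Delta[OF A] fsub_zero] .
    note iso = kernel_transpose[OF A]
    have "(Lambda k)\<lparr>carrier := kern k A\<rparr> \<cong> M \<longleftrightarrow> kern k A \<in> subgroups_iso k M"
      using subgroups_iso_iff[OF M] f by blast
    also have "\<dots> \<longleftrightarrow> kern k (transpose_mat A) \<in> subgroups_iso k M"
      using subgroups_iso_add_iso[OF M] f iso add_iso_sym[OF f(1) iso] by blast
    finally show ?thesis using phi_Gcoset[OF A] by simp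
  qed
  then show ?thesis unfolding iso_cosets_def cosets_def ker by blast
qed

lemma iso_cosets_lmul:
  assumes M: "M \<in> ab_pgroups q k" and c: "c \<in> iso_cosets k M" and g: "g \<in> Gamma k"
  shows "lmul g c \<in> iso_cosets k M"
proof -
  have c': "c \<in> cosets k" "phi k c \<in> subgroups_iso k M" using c by (auto simp: iso_cosets_def)
  have "fsub k (phi k c)" by (rule phi_fsub[OF c'(1)])
  then have "add_iso (pull k (transpose_mat g) (phi k c)) (phi k c)"
    by (intro add_iso_pull[OF transpose_Gamma[OF g]]) (simp add: fsub_def)
  moreover have f: "fsub k (pull k (transpose_mat g) (phi k c))"
    by (rule fsub_pull[OF Gamma_Delta[OF transpose_Gamma[OF g]] \<open>fsub k (phi k c)\<close>])
  ultimately have "add_iso (phi k c) (pull k (transpose_mat g) (phi k c))" by (metis add_iso_sym)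
  then show ?thesis
    using subgroups_iso_add_iso[OF M c'(2), of "pull k (transpose_mat g) (phi k c)" k] f c' lmul_cosets[OF Gamma_Delta[OF g] c'(1)]
    by (simp add: iso_cosets_def phi_lmul[OF Gamma_Delta[OF g]])
qed

text \<open>Together with \<open>hecke_lookup_orbit\<close> this makes the coefficients of an
  operator constant on each \<open>iso_cosets k M\<close>.\<close>

lemma iso_cosets_transitive:
  assumes M: "M \<in> ab_pgroups q k" and c: "c \<in> iso_cosets k M" and d: "d \<in> iso_cosets k M"
  obtains g where "g \<in> Gamma k" "d = lmul g c"
proof -
  have c': "c \<in> cosets k" "phi k c \<in> subgroups_iso k M" and d': "d \<in> cosets k" "phi k d \<in> subgroups_iso k M"
    using c d by (auto simp: iso_cosets_def)
  have "add_iso (phi k d) (phi k c)" using subgroups_iso_add_iso[OF M d'(2)] c'(2) by blast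
  then obtain g where g: "g \<in> Gamma k" "pull k g (phi k c) = phi k d"
    using fsub_homogeneous[OF phi_fsub[OF d'(1)] phi_fsub[OF c'(1)]] by blast
  have tg: "transpose_mat g \<in> Delta k" by (rule Gamma_Delta[OF transpose_Gamma[OF g(1)]])
  have "phi k (lmul (transpose_mat g) c) = phi k d" using phi_lmul[OF tg c'(1)] g(2) by simp
  then have "lmul (transpose_mat g) c = d" using phi_inj lmul_cosets[OF tg c'(1)] d'(1) by blast
  then show ?thesis using that transpose_Gamma[OF g(1)] by blast
qed

text \<open>\<open>hecke_exists\<close> and \<open>hecke_determined\<close> supply the existence and
  uniqueness behind the definite description; the sum is invariant because \<open>Gamma k\<close>
  permutes \<open>iso_cosets k M\<close>.\<close>

lemma hecke_basis:
  assumes M: "M \<in> ab_pgroups q k"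
  shows "(hecke_basis k M :: 'p::prime_card hecke_elt) \<in> carrier (hecke k)"
    and "(hecke_basis k M :: 'p hecke_elt) (base k) = (\<Sum>c\<in>iso_cosets k M. frag_of c)"
proof -
  let ?S = "iso_cosets k M :: 'p padic_int mat set set"
  let ?t = "\<Sum>c\<in>?S. frag_of c"
  have fin: "finite ?S" by (rule iso_cosets_finite[OF M])
  have tc: "?t \<in> cmod k"
    unfolding coset_module_def by (rule sum_closed_free_Abelian_group) (auto simp: iso_cosets_def cosets_def)
  have inv: "coset_act g ?t = ?t" if g: "g \<in> Gamma k" for g
  proof -
    have inj: "inj_on (lmul g) ?S" by (rule inj_onI) (simp add: iso_cosets_def lmul_inj[OF g])
    moreover have "lmul g ` ?S \<subseteq> ?S" using iso_cosets_lmul[OF M _ g] by blast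
    ultimately have im: "lmul g ` ?S = ?S" using endo_inj_surj[OF fin] by blast
    have "coset_act g ?t = (\<Sum>c\<in>?S. coset_act g (frag_of c))"
      unfolding coset_act_def frag_extend_sum[OF fin] by simp
    also have "\<dots> = (\<Sum>c\<in>lmul g ` ?S. frag_of c)" by (simp add: sum.reindex[OF inj])
    finally show ?thesis by (simp add: im)
  qed
  obtain T :: "'p hecke_elt" where T: "T \<in> carrier (hecke k)" "T (base k) = ?t"
    using hecke_exists[OF tc inv] by metis
  have "hecke_basis k M = T"
    unfolding hecke_basis_def iso_cosets_eq[OF M]
  proof (rule the_equality)
    show "T \<in> carrier (hecke k) \<and> T (base k) = ?t" using T by blast
    fix f :: "'p hecke_elt"
    assume "f \<in> carrier (hecke k) \<and> f (base k) = ?t"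
    then show "f = T" using hecke_determined[of f k T] T by metis
  qed
  then show "(hecke_basis k M :: 'p hecke_elt) \<in> carrier (hecke k)"
    "(hecke_basis k M :: 'p hecke_elt) (base k) = ?t"
    using T by simp_all
qed

lemma hecke_basis_lookup:
  assumes M: "M \<in> ab_pgroups q k"
  shows "Poly_Mapping.lookup ((hecke_basis k M :: 'p::prime_card hecke_elt) (base k)) c =
    (if c \<in> iso_cosets k M then 1 else 0)"
  using iso_cosets_finite[OF M, where 'p='p] by (simp add: hecke_basis(2)[OF M] lookup_sum)

section \<open>Computing at the coset \<open>Gamma k\<close>, and generation by the basis\<close>

lemma hecke_value_hom:
  "(\<lambda>T. T (base k)) \<in> hom (add_monoid (hecke k)) (free_Abelian_group (cosets k))"
  using hecke_closed[of _ k "base k"]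
  by (auto simp: hom_def hecke_simps Gamma_cosets carrier_coset_module free_Abelian_group_def)

lemma group_add_hecke: "group (add_monoid (hecke k :: 'a::prime_card hecke_elt ring))"
proof -
  interpret R: Ring.ring "hecke k :: 'a hecke_elt ring" by (rule ring_hecke)
  show "group (add_monoid (hecke k :: 'a hecke_elt ring))" by (rule R.add.is_group)
qed

lemma hecke_value_add_pow:
  fixes a :: int
  assumes T: "T \<in> carrier (hecke k)"
  shows "([a] \<cdot>\<^bsub>hecke k\<^esub> T) (base k) = frag_cmul a (T (base k))"
proof -
  have "([a] \<cdot>\<^bsub>hecke k\<^esub> T) (base k) = T (base k) [^]\<^bsub>free_Abelian_group (cosets k)\<^esub> a"
    unfolding add_pow_def
    by (rule hom_int_pow[OF hecke_value_hom _ group_add_hecke group_free_Abelian_group]) (use T in simp)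
  also have "\<dots> = frag_cmul a (T (base k))"
    using hecke_closed[OF T, of "base k"] by (simp add: Gamma_cosets carrier_coset_module)
  finally show ?thesis .
qed

lemma hecke_value_add:
  "(S \<oplus>\<^bsub>hecke k\<^esub> T) (base k) = S (base k) + T (base k)"
  by (simp add: hecke_simps Gamma_cosets)

lemma hecke_value_minus:
  fixes S T :: "'a::prime_card hecke_elt"
  assumes "S \<in> carrier (hecke k)" "T \<in> carrier (hecke k)"
  shows "(S \<ominus>\<^bsub>hecke k\<^esub> T) (base k) = S (base k) - T (base k)"
proof -
  interpret R: Ring.ring "hecke k :: 'a hecke_elt ring" by (rule ring_hecke)
  have "S = (S \<ominus>\<^bsub>hecke k\<^esub> T) \<oplus>\<^bsub>hecke k\<^esub> T" using assms by algebra
  then have "S (base k) = (S \<ominus>\<^bsub>hecke k\<^esub> T) (base k) + T (base k)"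
    using hecke_value_add[of k "S \<ominus>\<^bsub>hecke k\<^esub> T" T] by simp
  then show ?thesis by simp
qed

text \<open>Induction on the size of the support. The coefficient \<open>a\<close> of a coset in the
  support is shared by its whole orbit, so subtracting \<open>a\<close> times the basis element
  removes exactly that orbit. Asking for basis elements only within the support of T is what makes
  the lemma usable inside the induction for surjectivity.\<close>

lemma hecke_generate:
  fixes T :: "'p::prime_card hecke_elt"
  assumes P: "subgroup P (add_monoid (hecke k))" and T: "T \<in> carrier (hecke k)"
    and B: "\<And>M. M \<in> ab_pgroups CARD('p) k \<Longrightarrow> iso_cosets k M \<subseteq> Poly_Mapping.keys (T (base k)) \<Longrightarrow>
      hecke_basis k M \<in> P"
  shows "T \<in> P"
  using T B
proof (induction "card (Poly_Mapping.keys (T (base k)))" arbitrary: T rule: less_induct)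
  case less
  interpret R: Ring.ring "hecke k :: 'p hecke_elt ring" by (rule ring_hecke)
  note T = less.prems(1)
  let ?v = "\<lambda>T :: 'p hecke_elt. T (base k)"
  show ?case
  proof (cases "Poly_Mapping.keys (?v T) = {}")
    case True
    then have "?v T = ?v \<zero>\<^bsub>hecke k\<^esub>" by (simp add: hecke_simps Gamma_cosets)
    then have "T = \<zero>\<^bsub>hecke k\<^esub>" by (rule hecke_determined[OF T R.zero_closed])
    then show ?thesis using subgroup.one_closed[OF P] by simp
  next
    case False
    then obtain c where c: "c \<in> Poly_Mapping.keys (?v T)" by blast
    have cc: "c \<in> cosets k"
      using c hecke_closed[OF T, of "base k"] by (auto simp: Gamma_cosets carrier_coset_module)
    obtain M where M: "M \<in> ab_pgroups CARD('p) k" "phi k c \<in> subgroups_iso k M"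
      using fsub_ab_pgroup[OF phi_fsub[OF cc]] by blast
    have cS: "c \<in> iso_cosets k M" using cc M by (simp add: iso_cosets_def)
    let ?B = "hecke_basis k M :: 'p hecke_elt"
    define a where "a = Poly_Mapping.lookup (?v T) c"
    have a: "Poly_Mapping.lookup (?v T) d = a" if d: "d \<in> iso_cosets k M" for d
    proof -
      obtain g where "g \<in> Gamma k" "d = lmul g c" using iso_cosets_transitive[OF M(1) cS d] .
      then show ?thesis using hecke_lookup_orbit[OF T _ cc] by (simp add: a_def)
    qed
    have a0: "a \<noteq> 0" using c by (simp add: a_def in_keys_iff)
    have Bc: "?B \<in> carrier (hecke k)" by (rule hecke_basis(1)[OF M(1)])
    then have aB: "[a] \<cdot>\<^bsub>hecke k\<^esub> ?B \<in> carrier (hecke k)" by (rule R.add.int_pow_closed[simplified])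
    define T' where "T' = T \<ominus>\<^bsub>hecke k\<^esub> ([a] \<cdot>\<^bsub>hecke k\<^esub> ?B)"
    have T': "T' \<in> carrier (hecke k)" using T aB by (simp add: T'_def)
    have "Poly_Mapping.lookup (?v T') d = Poly_Mapping.lookup (?v T) d - (if d \<in> iso_cosets k M then a else 0)" for d
      unfolding T'_def hecke_value_minus[OF T aB] hecke_value_add_pow[OF Bc]
      by (simp add: lookup_minus hecke_basis_lookup[OF M(1)])
    then have "d \<in> Poly_Mapping.keys (?v T') \<longleftrightarrow> d \<in> Poly_Mapping.keys (?v T) - iso_cosets k M" for d
      using a[of d] by (cases "d \<in> iso_cosets k M") (simp_all add: in_keys_iff)
    then have keys: "Poly_Mapping.keys (?v T') = Poly_Mapping.keys (?v T) - iso_cosets k M"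
      by blast
    have "iso_cosets k M \<subseteq> Poly_Mapping.keys (?v T)" using a a0 by (auto simp: in_keys_iff)
    then have BP: "?B \<in> P" using less.prems(2) M(1) by blast
    have "card (Poly_Mapping.keys (?v T')) < card (Poly_Mapping.keys (?v T))"
      unfolding keys by (rule psubset_card_mono) (use c cS in auto)
    then have TP: "T' \<in> P"
    proof (rule less.hyps[OF _ T'])
      fix L assume "L \<in> ab_pgroups CARD('p) k" "iso_cosets k L \<subseteq> Poly_Mapping.keys (?v T')"
      then show "hecke_basis k L \<in> P" using keys less.prems(2) by blast
    qed
    have aP: "[a] \<cdot>\<^bsub>hecke k\<^esub> ?B \<in> P"
      unfolding add_pow_def by (rule group.subgroup_int_pow_closed[OF group_add_hecke P BP])
    have "T = (T \<ominus>\<^bsub>hecke k\<^esub> X) \<oplus>\<^bsub>hecke k\<^esub> X" if "X \<in> carrier (hecke k)" for X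
      using T that by algebra
    then have "T = T' \<oplus>\<^bsub>hecke k\<^esub> ([a] \<cdot>\<^bsub>hecke k\<^esub> ?B)" unfolding T'_def using aB .
    then show ?thesis using subgroup.m_closed[OF P TP aP] by simp
  qed
qed

section \<open>Restriction to a hyperplane\<close>

definition first_col_zero :: "nat \<Rightarrow> 'a::zero mat \<Rightarrow> bool" where
  "first_col_zero n A \<longleftrightarrow> (\<forall>i. 0 < i \<longrightarrow> i \<le> n \<longrightarrow> A $$ (i, 0) = 0)"

lemma mat_delete_Delta:
  assumes A: "A \<in> Delta (Suc n)" and 0: "first_col_zero n A"
  shows "mat_delete A 0 0 \<in> Delta n"
proof -
  note Ac = Delta_carrier[OF A]
  have "det A = A $$ (0, 0) * det (mat_delete A 0 0)"
    using 0 by (intro det_first_column[OF Ac]) (auto simp: first_col_zero_def)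
  moreover have "mat_delete A 0 0 \<in> carrier_mat n n" using Ac by (auto simp: mat_delete_def)
  ultimately show ?thesis using A by (auto simp: Delta_iff)
qed

lemma slice_pull:
  assumes A: "A \<in> carrier_mat (Suc n) (Suc n)" and 0: "first_col_zero n A"
  shows "slice n (pull (Suc n) (transpose_mat A) H) = pull n (transpose_mat (mat_delete A 0 0)) (slice n H)"
proof -
  have "mat_delete A 0 0 \<in> carrier_mat n n" using A by (auto simp: mat_delete_def)
  moreover have "mat_act (transpose_mat A) (vCons 0 x) = vCons 0 (mat_act (transpose_mat (mat_delete A 0 0)) x)"
    if "x \<in> carrier_vec n" for x
    using 0 by (intro mat_act_vCons_0[OF A _ that]) (auto simp: first_col_zero_def)
  ultimately show ?thesis by (auto simp: slice_def pull_def)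
qed

section \<open>Restriction of cosets to the kernel of the first coordinate\<close>

definition psi :: "nat \<Rightarrow> 'p::prime_card padic_int mat set \<Rightarrow> 'p padic_int mat set" where
  "psi n c = inv_into (cosets n) (phi n) (slice n (phi (Suc n) c))"

lemma psi_cosets: "c \<in> cosets (Suc n) \<Longrightarrow> psi n c \<in> cosets n"
  and phi_psi: "c \<in> cosets (Suc n) \<Longrightarrow> phi n (psi n c) = slice n (phi (Suc n) c)"
proof -
  assume "c \<in> cosets (Suc n)"
  then have "slice n (phi (Suc n) c) \<in> phi n ` cosets n"
    using slice_fsub[OF phi_fsub] phi_bij[of n] by (auto simp: bij_betw_def)
  then show "psi n c \<in> cosets n" "phi n (psi n c) = slice n (phi (Suc n) c)"
    unfolding psi_def by (rule inv_into_into, rule f_inv_into_f)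
qed

lemma psi_Gamma: "psi n (Gamma (Suc n)) = Gamma n"
proof -
  have "slice n {0\<^sub>v (Suc n)} = {0\<^sub>v n :: 'a prufer vec}" by (auto simp: slice_def zero_vec_Suc)
  then have "phi n (psi n (Gamma (Suc n) :: 'a padic_int mat set)) = phi n (Gamma n)"
    by (simp add: phi_psi Gamma_cosets phi_Gamma)
  then show ?thesis using phi_inj[OF psi_cosets[OF Gamma_cosets] Gamma_cosets] by blast
qed

lemma psi_lmul:
  assumes A: "A \<in> Delta (Suc n)" "first_col_zero n A" and c: "c \<in> cosets (Suc n)"
  shows "psi n (lmul A c) = lmul (mat_delete A 0 0) (psi n c)"
proof -
  note d = mat_delete_Delta[OF A]
  have "phi n (psi n (lmul A c)) = phi n (lmul (mat_delete A 0 0) (psi n c))"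
    by (simp add: phi_psi lmul_cosets[OF A(1) c] phi_lmul[OF A(1) c] phi_lmul[OF d psi_cosets[OF c]] c
        slice_pull[OF Delta_carrier[OF A(1)] A(2)])
  then show ?thesis
    using phi_inj[OF psi_cosets[OF lmul_cosets[OF A(1) c]] lmul_cosets[OF d psi_cosets[OF c]]] by blast
qed

lemma coset_triangular_rep:
  assumes "c \<in> cosets (Suc n)"
  obtains A where "A \<in> Delta (Suc n)" "first_col_zero n A" "c = Gcoset (Suc n) A"
proof -
  obtain B where B: "c = Gcoset (Suc n) B" "B \<in> Delta (Suc n)" using assms by (auto simp: cosets_def)
  obtain g where g: "g \<in> Gamma (Suc n)" "\<And>i. 0 < i \<Longrightarrow> i \<le> n \<Longrightarrow> (B * g) $$ (i, 0) = 0"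
    using Delta_column_reduction[OF B(2)] by metis
  then show ?thesis
    using that[of "B * g"] Delta_mult[OF B(2) Gamma_Delta[OF g(1)]] Gcoset_Gamma[OF B(2) g(1)] B(1)
    by (simp add: first_col_zero_def)
qed

section \<open>Push-forward of chains of cosets and construction of \<open>omega\<close>\<close>

definition push :: "nat \<Rightarrow> ('p::prime_card padic_int mat set \<Rightarrow>\<^sub>0 int) \<Rightarrow> ('p padic_int mat set \<Rightarrow>\<^sub>0 int)" where
  "push n = frag_extend (\<lambda>c. frag_of (psi n c))"

lemma push_frag_of [simp]: "push n (frag_of c) = frag_of (psi n c)"
  and push_0 [simp]: "push n 0 = 0"
  and push_diff: "push n (x - y) = push n x - push n y"
  and push_add: "push n (x + y) = push n x + push n y"
  by (simp_all add: push_def frag_extend_diff frag_extend_add)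

lemma push_closed: "x \<in> cmod (Suc n) \<Longrightarrow> push n x \<in> cmod n"
  by (induction x rule: coset_module_induct)
     (simp_all add: coset_module_simps(1) push_diff coset_module_diff psi_cosets)

lemma push_act:
  assumes A: "A \<in> Delta (Suc n)" "first_col_zero n A" and x: "x \<in> cmod (Suc n)"
  shows "push n (coset_act A x) = coset_act (mat_delete A 0 0) (push n x)"
  using x by (induction x rule: coset_module_induct) (simp_all add: coset_act_diff push_diff psi_lmul[OF A])

lemma first_col_zero_dsum: "D \<in> carrier_mat n n \<Longrightarrow> first_col_zero n (dsum a D)"
  by (auto simp: first_col_zero_def dsum_def)

text \<open>By \<open>hecke_determined\<close> there is at most one such S. The restriction to the
  carrier provides the extensionality that \<open>is_omega\<close> demands.\<close>

definition omega :: "nat \<Rightarrow> 'p::prime_card hecke_elt \<Rightarrow> 'p hecke_elt" where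
  "omega n = (\<lambda>T\<in>carrier (hecke (Suc n)). SOME S. S \<in> carrier (hecke n) \<and>
     S (base n) = push n (T (base (Suc n))))"

lemma omega:
  fixes T :: "'p::prime_card hecke_elt"
  assumes T: "T \<in> carrier (hecke (Suc n))"
  shows "omega n T \<in> carrier (hecke n)"
    and "omega n T (base n) = push n (T (base (Suc n)))"
proof -
  let ?t = "T (base (Suc n))"
  have tc: "?t \<in> cmod (Suc n)" using hecke_closed[OF T] by (simp add: Gamma_cosets)
  have inv: "coset_act g (push n ?t) = push n ?t" if g: "g \<in> Gamma n" for g
  proof -
    \<comment> \<open>Invariance is lifted: diag(1, g) lies in \<open>Gamma (Suc n)\<close>, fixes
      the value of T, and has \<open>g\<close> as lower right block.\<close>
    have "coset_act g (push n ?t) = push n (coset_act (dsum 1 g) ?t)"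
      using push_act[OF Gamma_Delta[OF dsum_Gamma[OF g]] first_col_zero_dsum[OF Gamma_carrier[OF g]] tc]
      by (simp add: mat_delete_dsum)
    then show ?thesis using hecke_invariant[OF T dsum_Gamma[OF g]] by simp
  qed
  have "\<exists>S. S \<in> carrier (hecke n) \<and> S (base n) = push n ?t"
    using hecke_exists[OF push_closed[OF tc] inv] by metis
  from someI_ex[OF this] show "omega n T \<in> carrier (hecke n)" "omega n T (base n) = push n ?t"
    using T by (simp_all add: omega_def)
qed

text \<open>By definition this holds for the coset \<open>Gamma (Suc n)\<close>. A block triangular
  representative A carries it to an arbitrary coset, acting below through its lower right
  block.\<close>

lemma omega_push:
  assumes T: "T \<in> carrier (hecke (Suc n))" and x: "x \<in> cmod (Suc n)"
  shows "omega n T (push n x) = push n (T x)"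
  using x
proof (induction x rule: coset_module_induct)
  case (one c)
  obtain A where A: "A \<in> Delta (Suc n)" "first_col_zero n A" "c = Gcoset (Suc n) A"
    using coset_triangular_rep[OF one] .
  have d: "mat_delete A 0 0 \<in> Delta n" by (rule mat_delete_Delta[OF A(1,2)])
  have "psi n c = lmul (mat_delete A 0 0) (psi n (Gamma (Suc n)))"
    using psi_lmul[OF A(1,2) Gamma_cosets] lmul_Gamma_set[OF A(1)] A(3) by simp
  then have pc: "psi n c = Gcoset n (mat_delete A 0 0)" by (simp add: psi_Gamma lmul_Gamma_set[OF d])
  have "omega n T (push n (frag_of c)) = coset_act (mat_delete A 0 0) (omega n T (base n))"
    using hecke_Gcoset[OF omega(1)[OF T] d] pc by simp
  also have "\<dots> = push n (coset_act A (T (base (Suc n))))"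
    using push_act[OF A(1,2) hecke_closed[OF T, of "base (Suc n)"]]
    by (simp add: omega(2)[OF T] Gamma_cosets)
  also have "\<dots> = push n (T (frag_of c))" using hecke_Gcoset[OF T A(1)] A(3) by simp
  finally show ?case .
qed (simp_all add: hecke_0[OF T] hecke_0[OF omega(1)[OF T]] hecke_diff[OF T] hecke_diff[OF omega(1)[OF T]]
    push_diff push_closed)

text \<open>Multiplication is composition, so for products it suffices to apply
  \<open>omega_push\<close> for T to the element \<open>U (base (Suc n))\<close>, whose push-forward
  is the value of \<open>omega n U\<close>.\<close>

lemma omega_ring_hom: "omega n \<in> ring_hom (hecke (Suc n)) (hecke n :: 'p::prime_card hecke_elt ring)"
proof (rule ring_hom_memI)
  interpret R: Ring.ring "hecke (Suc n) :: 'p hecke_elt ring" by (rule ring_hecke)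
  interpret S: Ring.ring "hecke n :: 'p hecke_elt ring" by (rule ring_hecke)
  have g: "base k \<in> carrier (coset_module k :: ('p padic_int mat set \<Rightarrow>\<^sub>0 int) monoid)" for k
    by (simp add: Gamma_cosets)
  fix T U :: "'p hecke_elt"
  assume T: "T \<in> carrier (hecke (Suc n))"
  then show "omega n T \<in> carrier (hecke n)" by (rule omega)
  assume U: "U \<in> carrier (hecke (Suc n))"
  show "omega n (T \<otimes>\<^bsub>hecke (Suc n)\<^esub> U) = omega n T \<otimes>\<^bsub>hecke n\<^esub> omega n U"
  proof (rule hecke_determined)
    show "omega n (T \<otimes>\<^bsub>hecke (Suc n)\<^esub> U) \<in> carrier (hecke n)" using T U by (intro omega R.m_closed)
    show "omega n T \<otimes>\<^bsub>hecke n\<^esub> omega n U \<in> carrier (hecke n)" using T U by (intro omega S.m_closed)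
    have "omega n (T \<otimes>\<^bsub>hecke (Suc n)\<^esub> U) (base n) = push n (T (U (base (Suc n))))"
      unfolding omega(2)[OF R.m_closed[OF T U]] using g[of "Suc n"]
      by (simp add: hecke_simps compose_def del: frag_of_carrier)
    also have "\<dots> = omega n T (omega n U (base n))"
      using omega_push[OF T hecke_closed[OF U g]] by (simp add: omega(2)[OF U])
    also have "\<dots> = (omega n T \<otimes>\<^bsub>hecke n\<^esub> omega n U) (base n)"
      using g[of n] by (simp add: hecke_simps compose_def del: frag_of_carrier)
    finally show "omega n (T \<otimes>\<^bsub>hecke (Suc n)\<^esub> U) (base n) = (omega n T \<otimes>\<^bsub>hecke n\<^esub> omega n U) (base n)" .
  qed
  show "omega n (T \<oplus>\<^bsub>hecke (Suc n)\<^esub> U) = omega n T \<oplus>\<^bsub>hecke n\<^esub> omega n U"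
  proof (rule hecke_determined)
    show "omega n (T \<oplus>\<^bsub>hecke (Suc n)\<^esub> U) \<in> carrier (hecke n)" using T U by (intro omega R.a_closed)
    show "omega n T \<oplus>\<^bsub>hecke n\<^esub> omega n U \<in> carrier (hecke n)" using T U by (intro omega S.a_closed)
    show "omega n (T \<oplus>\<^bsub>hecke (Suc n)\<^esub> U) (base n) = (omega n T \<oplus>\<^bsub>hecke n\<^esub> omega n U) (base n)"
      using T U by (simp add: omega(2) hecke_value_add push_add)
  qed
next
  interpret R: Ring.ring "hecke (Suc n) :: 'p hecke_elt ring" by (rule ring_hecke)
  interpret S: Ring.ring "hecke n :: 'p hecke_elt ring" by (rule ring_hecke)
  show "omega n \<one>\<^bsub>hecke (Suc n)\<^esub> = (\<one>\<^bsub>hecke n\<^esub> :: 'p hecke_elt)"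
  proof (rule hecke_determined)
    show "omega n \<one>\<^bsub>hecke (Suc n)\<^esub> \<in> carrier (hecke n :: 'p hecke_elt ring)" by (intro omega R.one_closed)
    show "omega n \<one>\<^bsub>hecke (Suc n)\<^esub> (base n) = (\<one>\<^bsub>hecke n\<^esub> :: 'p hecke_elt) (base n)"
      unfolding omega(2)[OF R.one_closed] by (simp add: hecke_simps Gamma_cosets psi_Gamma)
  qed (rule S.one_closed)
qed

section \<open>The integers \<open>a_int\<close>\<close>

text \<open>As endomorphisms of Q_p/Z_p are scalars, \<mu> is a row \<open>a\<close> and its section
  a column \<open>c\<close>, and the sum of the products \<open>a i * c i\<close> acts as the
  identity. Hence some \<open>a i\<close> is a unit, and the row extends to an invertible
  matrix.\<close>

lemma split_surjection_first_coordinate: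
  fixes \<mu> :: "'p::prime_card prufer vec \<Rightarrow> 'p prufer"
  assumes "split_surjection (Lambda (Suc n)) prufer_group \<mu>"
  obtains g where "g \<in> Gamma (Suc n)" "\<And>v. v \<in> carrier_vec (Suc n) \<Longrightarrow> \<mu> v = mat_act g v $ 0"
proof -
  let ?k = "Suc n"
  have add: "\<mu> (x + y) = \<mu> x + \<mu> y" if "x \<in> carrier_vec ?k" "y \<in> carrier_vec ?k" for x y
    using assms that by (auto simp: split_surjection_def hom_def prufer_group_def)
  obtain s where s: "s \<in> hom prufer_group (Lambda ?k)" "\<And>y. \<mu> (s y) = y"
    using assms by (auto simp: split_surjection_def prufer_group_def)
  have sc: "s x \<in> carrier_vec ?k" and sadd: "s (x + y) = s x + s y" for x y
    using s(1) by (auto simp: hom_def prufer_group_def)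
  define single where "single i x = vec ?k (\<lambda>j. if j = i then x else 0)" for i :: nat and x :: "'p prufer"
  have sgc: "single i x \<in> carrier_vec ?k" for i x by (simp add: single_def)
  have "\<exists>a. (\<lambda>x. \<mu> (single i x)) = padic_scale a" for i
  proof -
    have "\<mu> (single i (x + y)) = \<mu> (single i x) + \<mu> (single i y)" for x y
    proof -
      have "single i (x + y) = single i x + single i y" by (intro eq_vecI) (auto simp: single_def)
      then show ?thesis using add sgc by simp
    qed
    then show ?thesis using prufer_endo_scale[of "\<lambda>x. \<mu> (single i x)"] by metis
  qed
  then obtain a where a: "\<And>i x. \<mu> (single i x) = padic_scale (a i) x" by metis
  have mu: "\<mu> v = (\<Sum>i<?k. padic_scale (a i) (v $ i))" if v: "v \<in> carrier_vec ?k" for v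
  proof -
    \<comment> \<open>Truncations of \<open>v\<close>: consecutive ones differ in a single
      coordinate, so additivity of \<mu> can be used one coordinate at a time.\<close>
    define w where "w m = vec ?k (\<lambda>i. if i < m then v $ i else 0)" for m
    have wc: "w m \<in> carrier_vec ?k" for m by (simp add: w_def)
    have "\<mu> (w m) = (\<Sum>i<m. padic_scale (a i) (v $ i))" if "m \<le> ?k" for m
      using that
    proof (induction m)
      case 0
      have "w 0 + w 0 = w 0" by (intro eq_vecI) (auto simp: w_def)
      then show ?case using add[OF wc wc, of 0 0] by simp
    next
      case (Suc m)
      have "w (Suc m) = w m + single m (v $ m)"
        using Suc.prems by (intro eq_vecI) (auto simp: w_def single_def)
      then show ?case using Suc add[OF wc sgc] a by simp
    qed
    moreover have "w ?k = v" using v by (intro eq_vecI) (auto simp: w_def)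
    ultimately show ?thesis by (metis order_refl)
  qed
  have "\<exists>c. (\<lambda>x. s x $ i) = padic_scale c" if "i < ?k" for i
  proof -
    have "s (x + y) $ i = s x $ i + s y $ i" for x y
      unfolding sadd using sc[of x] sc[of y] that by simp
    then show ?thesis using prufer_endo_scale[of "\<lambda>x. s x $ i"] by metis
  qed
  then obtain c where c: "\<And>i x. i < ?k \<Longrightarrow> s x $ i = padic_scale (c i) x" by metis
  have y: "y = padic_scale (\<Sum>i<?k. a i * c i) y" for y
  proof -
    have "y = (\<Sum>i<?k. padic_scale (a i) (s y $ i))" using mu[OF sc] s(2) by metis
    also have "\<dots> = (\<Sum>i<?k. padic_scale (a i * c i) y)"
      by (intro sum.cong) (simp_all add: c padic_scale_mult)
    finally show ?thesis unfolding padic_scale_sum_left .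
  qed
  have "\<exists>i<?k. a i dvd 1"
  proof (rule ccontr)
    assume "\<not> ?thesis"
    then have "unif dvd a i" if "i < ?k" for i using that padic_int_unit_iff by blast
    then have "unif dvd (\<Sum>i<?k. a i * c i)" by (intro dvd_sum dvd_mult2) auto
    \<comment> \<open>If p divided every \<open>a i\<close>, the scalar would kill 1 / p instead of
      fixing it.\<close>
    then have "pf 1 1 = (0 :: 'p prufer)"
      using y[of "pf 1 1"] by (simp add: scale_pf pf_eq_0_iff)
    then show False using padic_int_unit_iff[of "1 :: 'p padic_int"] by (simp add: pf_eq_0_iff)
  qed
  then obtain i where i: "i < ?k" "vec ?k a $ i dvd 1" by auto
  obtain h where h: "h \<in> Gamma ?k" "col h 0 = vec ?k a" using primitive_completion[OF _ i] by auto
  have ha: "h $$ (j, 0) = a j" if "j < ?k" for j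
  proof -
    have "col h 0 $ j = a j" unfolding h(2) using that by simp
    then show ?thesis using that Gamma_carrier[OF h(1)] by simp
  qed
  have "\<mu> v = mat_act (transpose_mat h) v $ 0" if v: "v \<in> carrier_vec ?k" for v
    unfolding mu[OF v] using v Gamma_carrier[OF h(1)] by (auto simp: mat_act_def ha intro!: sum.cong)
  then show ?thesis using that transpose_Gamma[OF h(1)] by blast
qed

section \<open>Fibres of the slice map\<close>

definition fibre :: "nat \<Rightarrow> nat monoid \<Rightarrow> 'p::prime_card prufer vec set \<Rightarrow> 'p prufer vec set set" where
  "fibre n M K = {H \<in> subgroups_iso (Suc n) M. slice n H = K}"

lemma subgroups_iso_pull:
  assumes M: "M \<in> ab_pgroups q k" and g: "g \<in> Gamma l" and H: "H \<in> subgroups_iso l M"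
  shows "pull l g H \<in> subgroups_iso l M"
proof -
  have fH: "fsub l H" using H subgroups_iso_iff[OF M] by blast
  have f: "fsub l (pull l g H)" by (rule fsub_pull[OF Gamma_Delta[OF g] fH])
  have "add_iso (pull l g H) H" using fH by (intro add_iso_pull[OF g]) (simp add: fsub_def)
  then have "add_iso H (pull l g H)" by (rule add_iso_sym[OF f])
  then show ?thesis using subgroups_iso_add_iso[OF M H] f by blast
qed

lemma inj_on_pull:
  assumes g: "g \<in> Gamma k"
  shows "inj_on (pull k g) {H. H \<subseteq> carrier_vec k}"
proof (rule inj_onI)
  fix H K assume HK: "H \<in> {H. H \<subseteq> carrier_vec k}" "K \<in> {H. H \<subseteq> carrier_vec k}" "pull k g H = pull k g K"
  obtain h where h: "h \<in> Gamma k" "g * h = 1\<^sub>m k" "h * g = 1\<^sub>m k" using Gamma_inverse[OF g] .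
  show "H = K" using HK pull_Gamma_inverse[OF h(2) Gamma_carrier[OF g] Gamma_carrier[OF h(1)]] by (metis mem_Collect_eq)
qed

lemma fibre_finite:
  assumes M: "M \<in> ab_pgroups q (Suc n)"
  shows "finite (fibre n M (K :: 'p::prime_card prufer vec set))"
  using subgroups_iso_finite[OF M, of "Suc n", where 'p='p] by (auto simp: fibre_def)

text \<open>H and K are conjugate under some \<open>g\<close>, and pulling back along diag(1, g)
  maps one fibre injectively into the other. Exchanging H and K gives equal cardinalities.\<close>

lemma fibre_card_le:
  fixes H K :: "'p::prime_card prufer vec set"
  assumes M: "M \<in> ab_pgroups q (Suc n)" and N: "N \<in> ab_pgroups q' n"
    and H: "H \<in> subgroups_iso n N" and K: "K \<in> subgroups_iso n N"
  shows "card (fibre n M K) \<le> card (fibre n M H)"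
proof -
  have "fsub n H" "fsub n K" "add_iso H K"
    using H K subgroups_iso_iff[OF N] subgroups_iso_add_iso[OF N H] by blast+
  then obtain g where g: "g \<in> Gamma n" "pull n g K = H" using fsub_homogeneous by blast
  let ?d = "dsum 1 g"
  have d: "?d \<in> Gamma (Suc n)" by (rule dsum_Gamma[OF g(1)])
  have "slice n (pull (Suc n) ?d L) = pull n g (slice n L)" for L
    using slice_pull[of "dsum 1 (transpose_mat g)" n L] Gamma_carrier[OF g(1)]
    by (simp add: first_col_zero_dsum dsum_carrier transpose_dsum mat_delete_dsum)
  then have "pull (Suc n) ?d ` fibre n M K \<subseteq> fibre n M H"
    using subgroups_iso_pull[OF M d] g(2) by (auto simp: fibre_def)
  moreover have "inj_on (pull (Suc n) ?d) (fibre n M K)"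
    by (rule inj_on_subset[OF inj_on_pull[OF d]]) (auto simp: fibre_def subgroups_iso_iff[OF M] fsub_def)
  moreover have "finite (fibre n M H)" by (rule fibre_finite[OF M])
  ultimately show ?thesis by (intro card_inj_on_le)
qed

text \<open>With \<mu> equal to the first coordinate of g v, pulling back along the inverse
  \<open>h\<close> of \<open>g\<close> turns the kernel of \<mu> into the kernel of the first
  coordinate, and keeps isomorphism types.\<close>

lemma I_set_card:
  fixes \<mu> :: "'p::prime_card prufer vec \<Rightarrow> 'p prufer"
  assumes mu: "split_surjection (Lambda (Suc n)) prufer_group \<mu>"
    and M: "M \<in> ab_pgroups q (Suc n)" and N: "N \<in> ab_pgroups q' n"
  shows "card (I_set n \<mu> M N) = card {H \<in> subgroups_iso (Suc n) M. slice n H \<in> (subgroups_iso n N :: 'p prufer vec set set)}"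
proof -
  let ?k = "Suc n" and ?J = "{H \<in> subgroups_iso (Suc n) M. slice n H \<in> (subgroups_iso n N :: 'p prufer vec set set)}"
  obtain g where g: "g \<in> Gamma ?k" "\<And>v. v \<in> carrier_vec ?k \<Longrightarrow> \<mu> v = mat_act g v $ 0"
    using split_surjection_first_coordinate[OF mu] by blast
  obtain h where h: "h \<in> Gamma ?k" "g * h = 1\<^sub>m ?k" "h * g = 1\<^sub>m ?k" using Gamma_inverse[OF g(1)] .
  note c = Gamma_carrier[OF g(1)] Gamma_carrier[OF h(1)]
  have gh: "mat_act g (mat_act h v) = v" "mat_act h (mat_act g v) = v" if "v \<in> carrier_vec ?k" for v
    using that c h by (simp_all add: mat_act_mult[of _ ?k ?k _ ?k, symmetric])
  have ker: "kernel (Lambda ?k) prufer_group \<mu> = {v \<in> carrier_vec ?k. mat_act g v $ 0 = 0}"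
    using g(2) by (auto simp: kernel_def prufer_group_def)
  have key: "(Lambda ?k)\<lparr>carrier := H \<inter> kernel (Lambda ?k) prufer_group \<mu>\<rparr> \<cong> N \<longleftrightarrow> slice n (pull ?k h H) \<in> subgroups_iso n N"
    if H: "fsub ?k H" for H
  proof -
    let ?L = "H \<inter> {v \<in> carrier_vec ?k. mat_act g v $ 0 = 0}" and ?S = "slice n (pull ?k h H)"
    have Hc: "H \<subseteq> carrier_vec ?k" using H by (simp add: fsub_def)
    have fL: "fsub ?k ?L"
      using H Hc c by (auto simp: fsub_def mat_act_diff[of _ ?k] carrier_vecD[OF mat_act_carrier[OF c(1)]])
    have fS: "fsub n ?S" by (rule slice_fsub[OF fsub_pull[OF Gamma_Delta[OF h(1)] H]])
    have "bij_betw (\<lambda>x. mat_act h (vCons 0 x)) ?S ?L"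
    proof (rule bij_betw_imageI)
      show "inj_on (\<lambda>x. mat_act h (vCons 0 x)) ?S"
      proof (rule inj_onI)
        fix x y assume xy: "x \<in> ?S" "y \<in> ?S" "mat_act h (vCons 0 x) = mat_act h (vCons 0 y)"
        then have "vCons 0 x \<in> carrier_vec ?k" "vCons 0 y \<in> carrier_vec ?k" by (auto simp: slice_def)
        then have "vCons 0 x = vCons 0 y" using gh(1) xy(3) by metis
        then show "x = y" by simp
      qed
      show "(\<lambda>x. mat_act h (vCons 0 x)) ` ?S = ?L"
      proof (intro subset_antisym subsetI)
        fix v assume v: "v \<in> ?L"
        then have vc: "v \<in> carrier_vec ?k" "mat_act g v \<in> carrier_vec ?k" "mat_act g v $ 0 = 0" using c by auto
        obtain b x where x: "mat_act g v = vCons b x" using vc(2) by (cases "mat_act g v") auto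
        then have "b = 0" "x \<in> carrier_vec n" using vc by auto
        then have gv: "mat_act g v = vCons 0 x" using x by simp
        then have hx: "mat_act h (vCons 0 x) = v" using gh(2)[OF vc(1)] by simp
        then have "x \<in> ?S" using \<open>x \<in> carrier_vec n\<close> v by (simp add: slice_def pull_def)
        then show "v \<in> (\<lambda>x. mat_act h (vCons 0 x)) ` ?S" using hx by blast
      next
        fix v assume "v \<in> (\<lambda>x. mat_act h (vCons 0 x)) ` ?S"
        then obtain x where x: "x \<in> carrier_vec n" "v = mat_act h (vCons 0 x)" "v \<in> H" by (auto simp: slice_def pull_def)
        then have "mat_act g v = vCons 0 x" using gh(1)[of "vCons 0 x"] by simp
        then show "v \<in> ?L" using x Hc by auto
      qed
    qed
    moreover have "mat_act h (vCons 0 (x + y)) = mat_act h (vCons 0 x) + mat_act h (vCons 0 y)"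
      if "x \<in> ?S" "y \<in> ?S" for x y
    proof -
      have "x \<in> carrier_vec n" "y \<in> carrier_vec n" using that by (auto simp: slice_def)
      then show ?thesis using mat_act_add[of "vCons 0 x" ?k "vCons 0 y" h] by (simp add: vCons_add)
    qed
    ultimately have iso: "add_iso ?S ?L" unfolding add_iso_def by blast
    have "(Lambda ?k)\<lparr>carrier := ?L\<rparr> \<cong> N \<longleftrightarrow> ?L \<in> subgroups_iso ?k N" using subgroups_iso_iff[OF N] fL by blast
    also have "\<dots> \<longleftrightarrow> ?S \<in> subgroups_iso n N"
      using subgroups_iso_add_iso[OF N] fL fS iso add_iso_sym[OF fS iso] by blast
    finally show ?thesis unfolding ker .
  qed
  have fM: "fsub ?k H" if "H \<in> subgroups_iso ?k M" for H :: "'p prufer vec set"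
    using that subgroups_iso_iff[OF M] by blast
  have I: "I_set n \<mu> M N = {H \<in> subgroups_iso ?k M. slice n (pull ?k h H) \<in> subgroups_iso n N}"
    unfolding I_set_def Suc_eq_plus1[symmetric] using key fM by blast
  have "bij_betw (pull ?k h) (I_set n \<mu> M N) ?J"
  proof (rule bij_betwI[where g = "pull ?k g"])
    show "pull ?k h \<in> I_set n \<mu> M N \<rightarrow> ?J" using subgroups_iso_pull[OF M h(1)] by (auto simp: I)
    have gg: "pull ?k h (pull ?k g H) = H" "pull ?k g (pull ?k h H) = H" if "H \<in> subgroups_iso ?k M" for H
      using fM[OF that] pull_Gamma_inverse[OF h(2) c] pull_Gamma_inverse[OF h(3) c(2,1)] by (auto simp: fsub_def)
    show "pull ?k g \<in> ?J \<rightarrow> I_set n \<mu> M N" using subgroups_iso_pull[OF M g(1)] gg by (auto simp: I)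
    show "pull ?k g (pull ?k h H) = H" if "H \<in> I_set n \<mu> M N" for H using that gg by (auto simp: I)
    show "pull ?k h (pull ?k g H) = H" if "H \<in> ?J" for H using that gg by auto
  qed
  then show ?thesis by (rule bij_betw_same_card)
qed

text \<open>I_n(M, N) is in bijection with the disjoint union of the fibres over the subgroups
  isomorphic to N, and these all have the same size. This explains both the integrality of the
  quotient and its independence of \<mu>.\<close>

lemma a_int_eq_fibre_card:
  fixes \<mu> :: "'p::prime_card prufer vec \<Rightarrow> 'p prufer" and K :: "'p prufer vec set"
  assumes mu: "split_surjection (Lambda (Suc n)) prufer_group \<mu>"
    and M: "M \<in> ab_pgroups q (Suc n)" and N: "N \<in> ab_pgroups q' n" and K: "K \<in> subgroups_iso n N"
  shows "a_int n \<mu> M N = int (card (fibre n M K))"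
proof -
  let ?SN = "subgroups_iso n N :: 'p prufer vec set set"
  have fin: "finite ?SN" by (rule subgroups_iso_finite[OF N])
  have "card (I_set n \<mu> M N) = card (\<Union>L\<in>?SN. fibre n M L)"
    unfolding I_set_card[OF mu M N] by (rule arg_cong[where f = card]) (auto simp: fibre_def)
  also have "\<dots> = (\<Sum>L\<in>?SN. card (fibre n M L))"
    by (intro card_UN_disjoint fin) (use fibre_finite[OF M] in blast, auto simp: fibre_def)
  also have "\<dots> = (\<Sum>L\<in>?SN. card (fibre n M K))"
    using fibre_card_le[OF M N K] fibre_card_le[OF M N _ K] by (intro sum.cong refl order_antisym) blast+
  also have "\<dots> = card ?SN * card (fibre n M K)" by simp
  finally have I: "int (card (I_set n \<mu> M N)) = int (card (fibre n M K)) * int (card ?SN)" by simp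
  have "card ?SN \<noteq> 0" using K fin by auto
  then show ?thesis unfolding a_int_def I by (intro the_equality) auto
qed

text \<open>The coefficient at \<open>c\<close> counts the cosets of type M that \<open>psi\<close>
  sends to \<open>c\<close>; through \<open>phi\<close> these are the subgroups in the
  fibre.\<close>

lemma omega_basis_lookup:
  fixes c :: "'p::prime_card padic_int mat set"
  assumes M: "M \<in> ab_pgroups q (Suc n)" and c: "c \<in> cosets n"
  shows "Poly_Mapping.lookup (omega n (hecke_basis (Suc n) M) (base n)) c = int (card (fibre n M (phi n c)))"
proof -
  let ?S = "iso_cosets (Suc n) M :: 'p padic_int mat set set"
  have fin: "finite ?S" by (rule iso_cosets_finite[OF M])
  have "omega n (hecke_basis (Suc n) M) (base n) = (\<Sum>d\<in>?S. frag_of (psi n d))"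
    unfolding omega(2)[OF hecke_basis(1)[OF M]] hecke_basis(2)[OF M] push_def frag_extend_sum[OF fin] by simp
  then have "Poly_Mapping.lookup (omega n (hecke_basis (Suc n) M) (base n)) c = (\<Sum>d\<in>?S. if c = psi n d then 1 else 0)"
    by (simp add: lookup_sum)
  also have "\<dots> = int (card {d \<in> ?S. psi n d = c})"
    using fin by (simp add: sum.If_cases Int_def eq_commute)
  also have "card {d \<in> ?S. psi n d = c} = card (fibre n M (phi n c))"
  proof (rule bij_betw_same_card[of "phi (Suc n)"])
    have b: "bij_betw (phi (Suc n)) ?S (subgroups_iso (Suc n) M)" by (rule phi_bij_iso_cosets[OF M])
    have e: "psi n d = c \<longleftrightarrow> slice n (phi (Suc n) d) = phi n c" if "d \<in> ?S" for d
      using that phi_psi[of d n] phi_inj[OF psi_cosets c, of d] by (auto simp: iso_cosets_def)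
    show "bij_betw (phi (Suc n)) {d \<in> ?S. psi n d = c} (fibre n M (phi n c))"
    proof (rule bij_betw_imageI)
      show "inj_on (phi (Suc n)) {d \<in> ?S. psi n d = c}"
        by (rule inj_on_subset[OF bij_betw_imp_inj_on[OF b]]) auto
      show "phi (Suc n) ` {d \<in> ?S. psi n d = c} = fibre n M (phi n c)"
      proof (intro subset_antisym subsetI)
        fix H assume "H \<in> fibre n M (phi n c)"
        then have H: "H \<in> subgroups_iso (Suc n) M" "slice n H = phi n c" by (auto simp: fibre_def)
        then obtain d where "d \<in> ?S" "H = phi (Suc n) d" using bij_betw_imp_surj_on[OF b] by blast
        then show "H \<in> phi (Suc n) ` {d \<in> ?S. psi n d = c}" using e[of d] H(2) by blast
      qed (use e bij_betw_imp_surj_on[OF b] in \<open>auto simp: fibre_def\<close>)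
    qed
  qed
  finally show ?thesis .
qed

section \<open>The map omega on the basis\<close>

lemma iso_class_relation:
  "equiv (ab_pgroups q k) {(G, H). G \<in> ab_pgroups q k \<and> H \<in> ab_pgroups q k \<and> G \<cong> H}"
proof (rule equivI)
  have g: "group G" if "G \<in> ab_pgroups q k" for G
    using that by (auto simp: ab_pgroups_def comm_group_def)
  show "refl_on (ab_pgroups q k) {(G, H). G \<in> ab_pgroups q k \<and> H \<in> ab_pgroups q k \<and> G \<cong> H}"
    by (auto simp: refl_on_def iso_refl)
  show "sym {(G, H). G \<in> ab_pgroups q k \<and> H \<in> ab_pgroups q k \<and> G \<cong> H}"
    using group.iso_sym g by (auto simp: sym_def)
  show "trans {(G, H). G \<in> ab_pgroups q k \<and> H \<in> ab_pgroups q k \<and> G \<cong> H}"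
    using iso_trans by (auto simp: trans_def)
qed auto

lemma class_rep:
  assumes "C \<in> iso_classes q k"
  shows "class_rep C \<in> C" "class_rep C \<in> ab_pgroups q k"
proof -
  have "C \<noteq> {}" "C \<subseteq> ab_pgroups q k"
    using assms in_quotient_imp_non_empty[OF iso_class_relation] in_quotient_imp_subset[OF iso_class_relation]
    unfolding iso_classes_def by blast+
  then show "class_rep C \<in> C" "class_rep C \<in> ab_pgroups q k"
    unfolding class_rep_def by (metis some_in_eq, metis some_in_eq subsetD)
qed

text \<open>Ensures that, in the sum over classes, a given coset receives a contribution from at
  most one term.\<close>

lemma ex1_iso_class:
  fixes K :: "'p::prime_card prufer vec set"
  assumes K: "fsub n K"
  shows "\<exists>!C. C \<in> iso_classes CARD('p) n \<and> K \<in> subgroups_iso n (class_rep C)"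
proof -
  let ?r = "{(G, H). G \<in> ab_pgroups CARD('p) n \<and> H \<in> ab_pgroups CARD('p) n \<and> G \<cong> H}"
  have iff: "K \<in> subgroups_iso n M \<longleftrightarrow> (Lambda n)\<lparr>carrier := K\<rparr> \<cong> M" if "M \<in> ab_pgroups CARD('p) n" for M
    using subgroups_iso_iff[OF that] K by blast
  obtain M where M: "M \<in> ab_pgroups CARD('p) n" "K \<in> subgroups_iso n M" using fsub_ab_pgroup[OF K] .
  let ?C = "?r `` {M}"
  have C: "?C \<in> iso_classes CARD('p) n" unfolding iso_classes_def using M(1) by (rule quotientI)
  then have "M \<cong> class_rep ?C" using class_rep(1)[OF C] by blast
  then have "(Lambda n)\<lparr>carrier := K\<rparr> \<cong> class_rep ?C" using iff[OF M(1)] M(2) iso_trans by blast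
  then have CK: "K \<in> subgroups_iso n (class_rep ?C)" using iff[OF class_rep(2)[OF C]] by blast
  have "D = ?C" if D: "D \<in> iso_classes CARD('p) n" "K \<in> subgroups_iso n (class_rep D)" for D
  proof -
    have "class_rep D \<cong> class_rep ?C"
      using iff[OF class_rep(2)[OF D(1)]] D(2) \<open>(Lambda n)\<lparr>carrier := K\<rparr> \<cong> class_rep ?C\<close>
        group.iso_sym[OF group_fsub[OF K]] iso_trans by blast
    then have "(class_rep D, class_rep ?C) \<in> ?r" using class_rep(2)[OF D(1)] class_rep(2)[OF C] by blast
    then show ?thesis
      using quotient_eq_iff[OF iso_class_relation D(1)[unfolded iso_classes_def] C[unfolded iso_classes_def]
          class_rep(1)[OF D(1)] class_rep(1)[OF C]] by blast
  qed
  then show ?thesis using C CK by blast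
qed

lemma hecke_value_finsum:
  fixes f :: "'i \<Rightarrow> 'p::prime_card hecke_elt"
  assumes "finite J" "\<And>j. j \<in> J \<Longrightarrow> f j \<in> carrier (hecke k)"
  shows "(\<Oplus>\<^bsub>hecke k\<^esub>j\<in>J. f j) (base k) = (\<Sum>j\<in>J. f j (base k))"
  using assms
proof (induction J)
  case empty
  interpret R: Ring.ring "hecke k :: 'p hecke_elt ring" by (rule ring_hecke)
  show ?case by (simp add: hecke_simps Gamma_cosets)
next
  case (insert i J)
  interpret R: Ring.ring "hecke k :: 'p hecke_elt ring" by (rule ring_hecke)
  have "(\<Oplus>\<^bsub>hecke k\<^esub>j\<in>insert i J. f j) = f i \<oplus>\<^bsub>hecke k\<^esub> (\<Oplus>\<^bsub>hecke k\<^esub>j\<in>J. f j)"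
    using insert by (intro R.finsum_insert) auto
  then show ?case using insert by (simp add: hecke_value_add)
qed

lemma omega_basis:
  fixes \<mu> :: "'p::prime_card prufer vec \<Rightarrow> 'p prufer"
  assumes mu: "split_surjection (Lambda (Suc n)) prufer_group \<mu>" and M: "M \<in> ab_pgroups CARD('p) (Suc n)"
  shows "omega n (hecke_basis (Suc n) M :: 'p hecke_elt) =
    (\<Oplus>\<^bsub>hecke n\<^esub> C \<in> {C \<in> iso_classes CARD('p) n. a_int n \<mu> M (class_rep C) \<noteq> 0}.
       [a_int n \<mu> M (class_rep C)] \<cdot>\<^bsub>hecke n\<^esub> hecke_basis n (class_rep C))"
proof -
  interpret R: Ring.ring "hecke n :: 'p hecke_elt ring" by (rule ring_hecke)
  let ?J = "{C \<in> iso_classes CARD('p) n. a_int n \<mu> M (class_rep C) \<noteq> 0}"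
  let ?a = "\<lambda>C. a_int n \<mu> M (class_rep C)"
  let ?f = "\<lambda>C. [?a C] \<cdot>\<^bsub>hecke n\<^esub> hecke_basis n (class_rep C) :: 'p hecke_elt"
  have a: "?a C = int (card (fibre n M K))" if "C \<in> iso_classes CARD('p) n" "K \<in> subgroups_iso n (class_rep C)"
    for C and K :: "'p prufer vec set"
    using a_int_eq_fibre_card[OF mu M class_rep(2)[OF that(1)] that(2)] .
  define cls where "cls K = (THE C. C \<in> iso_classes CARD('p) n \<and> K \<in> subgroups_iso n (class_rep C))"
    for K :: "'p prufer vec set"
  have cls: "cls K \<in> iso_classes CARD('p) n" "K \<in> subgroups_iso n (class_rep (cls K))" if "fsub n K" for K
    using theI'[OF ex1_iso_class[OF that]] by (simp_all add: cls_def)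
  have cls_eq: "C = cls K" if "fsub n K" "C \<in> iso_classes CARD('p) n" "K \<in> subgroups_iso n (class_rep C)" for C K
    using ex1_iso_class[OF that(1)] cls[OF that(1)] that(2,3) by blast
  \<comment> \<open>Finiteness of the index set: a nonzero coefficient needs a nonempty fibre, so
    the class is that of \<open>slice n H\<close> for one of the finitely many H isomorphic to
    M.\<close>
  have "?J \<subseteq> (\<lambda>H. cls (slice n H)) ` subgroups_iso (Suc n) M"
  proof
    fix C assume C: "C \<in> ?J"
    then have Cc: "C \<in> iso_classes CARD('p) n" by blast
    obtain K :: "'p prufer vec set" where K: "K \<in> subgroups_iso n (class_rep C)"
      using subgroups_iso_nonempty[OF class_rep(2)[OF Cc]] .
    have "card (fibre n M K) \<noteq> 0" using a[OF Cc K] C by simp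
    then obtain H where H: "H \<in> fibre n M K" by (metis all_not_in_conv card.empty)
    have "fsub n K" using K subgroups_iso_iff[OF class_rep(2)[OF Cc]] by blast
    then have "C = cls K" using cls_eq Cc K by blast
    then show "C \<in> (\<lambda>H. cls (slice n H)) ` subgroups_iso (Suc n) M" using H by (auto simp: fibre_def)
  qed
  then have finJ: "finite ?J" using subgroups_iso_finite[OF M] finite_subset by blast
  have bc: "hecke_basis n (class_rep C) \<in> carrier (hecke n :: 'p hecke_elt ring)" if "C \<in> ?J" for C
    using hecke_basis(1)[OF class_rep(2)] that by blast
  have fc: "?f C \<in> carrier (hecke n)" if "C \<in> ?J" for C
    using bc[OF that] by (rule R.add.int_pow_closed[simplified])
  have "omega n (hecke_basis (Suc n) M :: 'p hecke_elt) = (\<Oplus>\<^bsub>hecke n\<^esub> C \<in> ?J. ?f C)"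
  proof (rule hecke_determined)
    show "omega n (hecke_basis (Suc n) M) \<in> carrier (hecke n :: 'p hecke_elt ring)"
      by (rule omega(1)[OF hecke_basis(1)[OF M]])
    show sc: "(\<Oplus>\<^bsub>hecke n\<^esub> C \<in> ?J. ?f C) \<in> carrier (hecke n)" using fc by (intro R.finsum_closed) auto
    have "Poly_Mapping.lookup (omega n (hecke_basis (Suc n) M :: 'p hecke_elt) (base n)) c =
        Poly_Mapping.lookup ((\<Oplus>\<^bsub>hecke n\<^esub> C \<in> ?J. ?f C) (base n)) c" for c
    proof (cases "c \<in> cosets n")
      case True
      let ?D = "cls (phi n c)"
      note K = phi_fsub[OF True]
      have "Poly_Mapping.lookup ((\<Oplus>\<^bsub>hecke n\<^esub> C \<in> ?J. ?f C) (base n)) c =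
          (\<Sum>C\<in>?J. Poly_Mapping.lookup (?f C (base n)) c)"
        using hecke_value_finsum[OF finJ fc] by (simp add: lookup_sum)
      also have "\<dots> = (\<Sum>C\<in>?J. if C = ?D then ?a ?D else 0)"
      proof (rule sum.cong[OF refl])
        fix C assume C: "C \<in> ?J"
        then have Cc: "C \<in> iso_classes CARD('p) n" by blast
        have "phi n c \<in> subgroups_iso n (class_rep C) \<longleftrightarrow> C = ?D"
          using cls(2)[OF K] cls_eq[OF K Cc] by blast
        then have "c \<in> iso_cosets n (class_rep C) \<longleftrightarrow> C = ?D"
          using True unfolding iso_cosets_def by blast
        moreover have "class_rep C \<in> ab_pgroups CARD('p) n" using C class_rep(2) by blast
        ultimately show "Poly_Mapping.lookup (?f C (base n)) c = (if C = ?D then ?a ?D else 0)"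
          by (simp add: hecke_value_add_pow[OF bc[OF C]] hecke_basis_lookup)
      qed
      also have "\<dots> = ?a ?D" using finJ cls(1)[OF K] by (simp add: sum.delta')
      also have "\<dots> = int (card (fibre n M (phi n c)))" by (rule a[OF cls[OF K]])
      finally show ?thesis using omega_basis_lookup[OF M True] by simp
    next
      case False
      have l0: "Poly_Mapping.lookup (T (base n)) c = 0" if "T \<in> carrier (hecke n)" for T
        using hecke_closed[OF that, of "base n"] False
        by (auto simp: Gamma_cosets carrier_coset_module in_keys_iff)
      show ?thesis using l0[OF sc] l0[OF omega(1)[OF hecke_basis(1)[OF M]]] by (simp only:)
    qed
    then show "omega n (hecke_basis (Suc n) M :: 'p hecke_elt) (base n) = (\<Oplus>\<^bsub>hecke n\<^esub> C \<in> ?J. ?f C) (base n)"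
      by (rule poly_mapping_eqI)
  qed
  then show ?thesis .
qed

section \<open>Existence and uniqueness of the map described by \<open>is_omega\<close>\<close>

lemma omega_additive: "omega n \<in> hom (add_monoid (hecke (Suc n))) (add_monoid (hecke n :: 'p::prime_card hecke_elt ring))"
  using omega_ring_hom[of n] by (auto simp: ring_hom_def hom_def)

lemma is_omega_omega:
  fixes \<mu> :: "'p::prime_card prufer vec \<Rightarrow> 'p prufer"
  assumes mu: "split_surjection (Lambda (Suc n)) prufer_group \<mu>"
  shows "is_omega n \<mu> (omega n)"
  unfolding is_omega_def Suc_eq_plus1[symmetric]
  using omega_additive omega_basis[OF mu] by (auto simp: omega_def)

text \<open>The operators on which two additive maps agree form a subgroup; here it contains all
  basis elements, which generate.\<close>

lemma is_omega_unique:
  fixes \<mu> :: "'p::prime_card prufer vec \<Rightarrow> 'p prufer"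
  assumes w: "is_omega n \<mu> w" and w': "is_omega n \<mu> w'"
  shows "w = w'"
proof (rule extensionalityI)
  let ?R = "hecke (Suc n) :: 'p hecke_elt ring" and ?S = "hecke n :: 'p hecke_elt ring"
  note W = w[unfolded is_omega_def Suc_eq_plus1[symmetric]] w'[unfolded is_omega_def Suc_eq_plus1[symmetric]]
  show "w \<in> extensional (carrier ?R)" "w' \<in> extensional (carrier ?R)" using W by blast+
  interpret R: group "add_monoid ?R" by (rule group_add_hecke)
  interpret S: group "add_monoid ?S" by (rule group_add_hecke)
  interpret h: group_hom "add_monoid ?R" "add_monoid ?S" w using W by unfold_locales blast
  interpret h': group_hom "add_monoid ?R" "add_monoid ?S" w' using W by unfold_locales blast
  let ?P = "{T \<in> carrier (add_monoid ?R). w T = w' T}"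
  have P: "subgroup ?P (add_monoid ?R)"
  proof (rule R.subgroupI)
    show "?P \<noteq> {}" using R.one_closed h.hom_one h'.hom_one by fastforce
    show "inv\<^bsub>add_monoid ?R\<^esub> T \<in> ?P" if "T \<in> ?P" for T using that h.hom_inv[of T] h'.hom_inv[of T] R.inv_closed[of T] by auto
    show "T \<otimes>\<^bsub>add_monoid ?R\<^esub> U \<in> ?P" if "T \<in> ?P" "U \<in> ?P" for T U
      using that h.hom_mult[of T U] h'.hom_mult[of T U] R.m_closed[of T U] by auto
  qed auto
  fix T assume T: "T \<in> carrier ?R"
  have "T \<in> ?P"
  proof (rule hecke_generate[OF P T])
    fix M assume "M \<in> ab_pgroups CARD('p) (Suc n)"
    then show "hecke_basis (Suc n) M \<in> ?P" using W hecke_basis(1) by fastforce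
  qed
  then show "w T = w' T" by blast
qed

section \<open>Surjectivity\<close>

lemma slice_card:
  assumes H: "fsub (Suc n) H"
  shows "card (slice n H) \<le> card H" "card (slice n H) = card H \<Longrightarrow> vCons 0 ` slice n H = H"
proof -
  have sub: "vCons 0 ` slice n H \<subseteq> H" by (auto simp: slice_def)
  have fin: "finite H" using H by (simp add: fsub_def)
  have c: "card (vCons 0 ` slice n H) = card (slice n H)" by (rule card_image) (auto simp: inj_on_def)
  show "card (slice n H) \<le> card H" using card_mono[OF fin sub] c by simp
  show "vCons 0 ` slice n H = H" if "card (slice n H) = card H"
    using card_subset_eq[OF fin sub] c that by simp
qed

lemma add_iso_vCons: "K \<subseteq> carrier_vec n \<Longrightarrow> add_iso K (vCons 0 ` (K :: 'p::prime_card prufer vec set))"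
proof -
  assume K: "K \<subseteq> carrier_vec n"
  have "vCons 0 (x + y) = vCons 0 x + vCons 0 y" if "x \<in> K" "y \<in> K" for x y
  proof -
    have "x \<in> carrier_vec n" "y \<in> carrier_vec n" using K that by auto
    then show ?thesis by (simp add: vCons_add)
  qed
  moreover have "bij_betw (vCons 0) K (vCons 0 ` K)" by (auto simp: bij_betw_def inj_on_def)
  ultimately show ?thesis unfolding add_iso_def by blast
qed

lemma fsub_vCons:
  assumes K: "fsub n K" shows "fsub (Suc n) (vCons 0 ` K)"
  unfolding fsub_def
proof (intro conjI ballI)
  show "0\<^sub>v (Suc n) \<in> vCons 0 ` K" using K by (auto simp: zero_vec_Suc fsub_def)
  fix x y assume "x \<in> vCons 0 ` K" "y \<in> vCons 0 ` K"
  then obtain a b where ab: "x = vCons 0 a" "y = vCons 0 b" "a \<in> K" "b \<in> K" by blast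
  then have "a \<in> carrier_vec n" "b \<in> carrier_vec n" "a - b \<in> K" using K by (auto simp: fsub_def)
  then show "x - y \<in> vCons 0 ` K" using ab by (simp add: vCons_diff)
qed (use K in \<open>auto simp: fsub_def\<close>)

lemma subgroups_iso_card: "H \<in> subgroups_iso k M \<Longrightarrow> card H = card (carrier M)"
  using iso_same_card[of "(Lambda k)\<lparr>carrier := H\<rparr>" M] by (auto simp: subgroups_iso_def)

text \<open>Strong induction on the order of N. The image of the basis element of N in rank n + 1
  differs from the one in rank n by an operator supported on groups of smaller order, so
  \<open>hecke_generate\<close> asks only for basis elements already known to lie in the
  image.\<close>

lemma omega_surjective: "omega n ` carrier (hecke (Suc n)) = carrier (hecke n :: 'p::prime_card hecke_elt ring)"
proof
  let ?R = "hecke (Suc n) :: 'p hecke_elt ring" and ?S = "hecke n :: 'p hecke_elt ring"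
  interpret S: Ring.ring ?S by (rule ring_hecke)
  show "omega n ` carrier ?R \<subseteq> carrier ?S" using omega(1) by blast
  let ?P = "omega n ` carrier ?R"
  have "group_hom (add_monoid ?R) (add_monoid ?S) (omega n)"
    unfolding group_hom_def group_hom_axioms_def by (intro conjI group_add_hecke omega_additive)
  then have P: "subgroup ?P (add_monoid ?S)" using group_hom.img_is_subgroup[of "add_monoid ?R"] by simp
  have basis: "hecke_basis n N \<in> ?P" if "N \<in> ab_pgroups CARD('p) n" for N
    using that
  proof (induction "card (carrier N)" arbitrary: N rule: less_induct)
    case less
    note N = less.prems
    \<comment> \<open>A group of p-rank at most n also indexes a basis element in rank n + 1, which
      serves as the approximate preimage.\<close>
    have N': "N \<in> ab_pgroups CARD('p) (Suc n)" using N by (auto simp: ab_pgroups_def)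
    let ?B = "hecke_basis n N :: 'p hecke_elt" and ?T = "omega n (hecke_basis (Suc n) N :: 'p hecke_elt)"
    have Bc: "?B \<in> carrier ?S" by (rule hecke_basis(1)[OF N])
    have TP: "?T \<in> ?P" using hecke_basis(1)[OF N'] by blast
    have Tc: "?T \<in> carrier ?S" by (rule omega(1)[OF hecke_basis(1)[OF N']])
    let ?D = "?T \<ominus>\<^bsub>?S\<^esub> ?B"
    have Dc: "?D \<in> carrier ?S" using Tc Bc by simp
    have look: "Poly_Mapping.lookup (?D (base n)) c =
        int (card (fibre n N (phi n c))) - (if c \<in> iso_cosets n N then 1 else 0)" if "c \<in> cosets n" for c
      unfolding hecke_value_minus[OF Tc Bc]
      by (simp add: lookup_minus omega_basis_lookup[OF N' that] hecke_basis_lookup[OF N])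
    have "?D \<in> ?P"
    proof (rule hecke_generate[OF P Dc])
      fix L assume L: "L \<in> ab_pgroups CARD('p) n" "iso_cosets n L \<subseteq> Poly_Mapping.keys (?D (base n))"
      obtain K :: "'p prufer vec set" where K: "K \<in> subgroups_iso n L" using subgroups_iso_nonempty[OF L(1)] .
      then have "K \<in> phi n ` iso_cosets n L"
        by (simp only: bij_betw_imp_surj_on[OF phi_bij_iso_cosets[OF L(1), where 'p='p]])
      then obtain c where c: "c \<in> iso_cosets n L" "phi n c = K" by blast
      then have cc: "c \<in> cosets n" by (simp add: iso_cosets_def)
      have fK: "fsub n K" using phi_fsub[OF cc] c by simp
      have nz: "int (card (fibre n N K)) \<noteq> (if K \<in> subgroups_iso n N then 1 else 0)"
        using look[OF cc] L(2) c cc by (auto simp: in_keys_iff iso_cosets_def)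
      \<comment> \<open>Over a subgroup K isomorphic to N the fibre is the single subgroup 0 x K,
        since equal orders force H into the kernel of the first coordinate. The coefficient of the
        difference there is 1 - 1 = 0.\<close>
      have KN: "K \<notin> subgroups_iso n N"
      proof
        assume KN: "K \<in> subgroups_iso n N"
        have "H = vCons 0 ` K" if "H \<in> fibre n N K" for H
        proof -
          have H: "H \<in> subgroups_iso (Suc n) N" "slice n H = K" using that by (auto simp: fibre_def)
          then have "fsub (Suc n) H" using subgroups_iso_iff[OF N] by blast
          then show ?thesis
            using slice_card(2)[of n H] subgroups_iso_card[OF H(1)] subgroups_iso_card[OF KN] H(2) by simp
        qed
        moreover have "vCons 0 ` K \<in> fibre n N K"
        proof -
          have "K \<subseteq> carrier_vec n" using fK by (simp add: fsub_def)
          then have "vCons 0 ` K \<in> subgroups_iso (Suc n) N" "slice n (vCons 0 ` K) = K"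
            using subgroups_iso_add_iso[OF N KN] fsub_vCons[OF fK] add_iso_vCons[of K n] by (auto simp: slice_def)
          then show ?thesis by (simp add: fibre_def)
        qed
        ultimately have "fibre n N K = {vCons 0 ` K}" by blast
        then show False using nz KN by simp
      qed
      then have "card (fibre n N K) \<noteq> 0" using nz by simp
      then obtain H where "H \<in> fibre n N K" by (metis all_not_in_conv card.empty)
      then have H: "H \<in> subgroups_iso (Suc n) N" "slice n H = K" by (auto simp: fibre_def)
      then have fH: "fsub (Suc n) H" using subgroups_iso_iff[OF N] by blast
      \<comment> \<open>Equal orders would make H a copy of K, contradicting that K is not
        isomorphic to N.\<close>
      have "card K \<noteq> card H"
      proof
        assume "card K = card H"
        then have "H = vCons 0 ` K" using slice_card(2)[OF fH] H(2) by simp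
        moreover have "add_iso K (vCons 0 ` K)" using fK by (intro add_iso_vCons[of K n]) (simp add: fsub_def)
        ultimately have "add_iso H K" using add_iso_sym[OF fK] by blast
        then show False using KN subgroups_iso_add_iso[OF N H(1)] fK by blast
      qed
      then have "card K < card H" using slice_card(1)[OF fH] H(2) by simp
      then have "card (carrier L) < card (carrier N)"
        using subgroups_iso_card[OF K] subgroups_iso_card[OF H(1)] by simp
      then show "hecke_basis n L \<in> ?P" using less.hyps L(1) by blast
    qed
    then have "?T \<oplus>\<^bsub>?S\<^esub> (\<ominus>\<^bsub>?S\<^esub> ?D) \<in> ?P"
      using subgroup.m_closed[OF P TP] subgroup.m_inv_closed[OF P] by (simp add: a_inv_def)
    moreover have "?T \<oplus>\<^bsub>?S\<^esub> (\<ominus>\<^bsub>?S\<^esub> ?D) = ?B" using Tc Bc by algebra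
    ultimately show ?case by metis
  qed
  show "carrier ?S \<subseteq> ?P" using hecke_generate[OF P] basis by blast
qed

theorem proposition4p8:
  fixes n :: nat and \<mu> :: "'p::prime_card prufer vec \<Rightarrow> 'p prufer"
  assumes "n \<ge> 1"
    and "split_surjection (Lambda (n + 1)) prufer_group \<mu>"
  shows "(\<exists>!w. is_omega n \<mu> w) \<and>
    (\<forall>w. is_omega n \<mu> w \<longrightarrow>
       w \<in> ring_hom (hecke (n + 1)) (hecke n) \<and>
       w ` carrier (hecke (n + 1)) = carrier (hecke n))"
proof -
  have mu: "split_surjection (Lambda (Suc n)) prufer_group \<mu>" using assms(2) by simp
  have unique: "w = omega n" if "is_omega n \<mu> w" for w
    by (rule is_omega_unique[OF that is_omega_omega[OF mu]])
  have props: "omega n \<in> ring_hom (hecke (n + 1)) (hecke n :: 'p hecke_elt ring)"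
    "omega n ` carrier (hecke (n + 1)) = carrier (hecke n :: 'p hecke_elt ring)"
    using omega_ring_hom omega_surjective unfolding Suc_eq_plus1[symmetric] by blast+
  show ?thesis
  proof (intro conjI allI impI)
    show "\<exists>!w. is_omega n \<mu> w" using is_omega_omega[OF mu] unique by blast
    fix w assume w: "is_omega n \<mu> w"
    show "w \<in> ring_hom (hecke (n + 1)) (hecke n)" unfolding unique[OF w] by (rule props)
    show "w ` carrier (hecke (n + 1)) = carrier (hecke n)" unfolding unique[OF w] by (rule props)
  qed
qed

end
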